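(* Let $f=\mathcal{I}(F)\in\mathcal{GS}(\Omega_D)$ with stem function $F\in C^1(\overline{D})$, and set $\Omega=\Omega_D$. If $U$ is a domain in $\mathbb{R}^{p+q+1}$ such that $U_{\underline{\eta}}\subset\Omega_{\underline{\eta}}$ is a bounded domain in $\mathbb{R}^{p+2}$ with smooth boundary $\partial U_{\underline{\eta}}\subset\Omega_{\underline{\eta}}$ for some $\underline{\eta}\in\mathbb{S}$, then $$f(\mathbf{x})=\int_{\partial U_{\underline{\eta}}}\mathcal{E}_{\mathbf{y}}(\mathbf{x})\,n(\mathbf{y})\,f(\mathbf{y})\,dS(\mathbf{y})-\int_{U_{\underline{\eta}}}\mathcal{E}_{\mathbf{y}}(\mathbf{x})\,(D_{\underline{\eta}}f)(\mathbf{y})\,dV(\mathbf{y}),\qquad \mathbf{x}\in U,$$ where $n(\mathbf{y})=\sum_{i=0}^pn_i(\mathbf{y})e_i+n_{p+1}(\mathbf{y})\underline{\eta}$ is the unit exterior normal to $\partial U_{\underline{\eta}}$ at $\mathbf{y}$, and $dS$ and $dV$ stand for the classical Lebesgue surface element and volume element in $\mathbb{R}^{p+2}$, respectively.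
   Context: Fix integers $p\ge 0$, $q\ge 1$. $\mathbb{R}_{p+q}$ is the real Clifford algebra generated by $e_1,\dots,e_{p+q}$ with $e_ie_j+e_je_i=-2\delta_{ij}$; put $e_0=1$. A point $\mathbf{x}=(x_0,\dots,x_{p+q})\in\mathbb{R}^{p+q+1}$ is identified with the paravector $\mathbf{x}=\mathbf{x}_p+\underline{\mathbf{x}}_q$, where $\mathbf{x}_p=\sum_{i=0}^p x_ie_i\in\mathbb{R}^{p+1}$ and $\underline{\mathbf{x}}_q=\sum_{i=p+1}^{p+q}x_ie_i\in\mathbb{R}^q$; its conjugate is $\overline{\mathbf{x}}=x_0-\sum_{i\ge1}x_ie_i$. Let $\mathbb{S}=\{\sum_{i=p+1}^{p+q}x_ie_i:\sum_{i=p+1}^{p+q} x_i^2=1\}$, so that $\underline{\omega}^2=-1$ for $\underline{\omega}\in\mathbb{S}$. Every $\mathbf{x}$ can be written $\mathbf{x}=\mathbf{x}_p+r\underline{\omega}$ with $r=|\underline{\mathbf{x}}_q|\ge0$, $\underline{\omega}\in\mathbb{S}$ ($\underline{\omega}$ is unique if $r>0$, arbitrary if $r=0$). For an open set $V\subseteq\mathbb{R}^{p+q+1}$ and $\underline{\omega}\in\mathbb{S}$, put $V_{\underline{\omega}}=V\cap(\mathbb{R}^{p+1}\oplus\underline{\omega}\mathbb{R})$, viewed as a subset of $\mathbb{R}^{p+2}$ via $(\mathbf{x}_p,r)\leftrightarrow\mathbf{x}_p+r\underline{\omega}$; this notation is used for both $\Omega$ and $U$. A domain is an open connected set. Operator: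 $D_{\underline{\eta}}f(\mathbf{y}_p+\widetilde r\,\underline{\eta})=\big(\sum_{i=0}^pe_i\partial_{y_i}+\underline{\eta}\,\partial_{\widetilde r}\big)f(\mathbf{y}_p+\widetilde r\,\underline{\eta})$, applied to the restriction of $f$ to $\Omega_{\underline{\eta}}$. Stem functions: let $D\subseteq\mathbb{R}^{p+2}$ be an open set invariant under reflection of the last variable, i.e. $(\mathbf{x}_p,r)\in D\Rightarrow(\mathbf{x}_p,-r)\in D$. Its p-symmetric completion is $\Omega_D=\bigcup_{\underline{\omega}\in\mathbb{S}}\{\mathbf{x}_p+r\underline{\omega}:(\mathbf{x}_p,r)\in D,\ r\ge0\}\subseteq\mathbb{R}^{p+q+1}$. A stem function on $D$ is a function $F=F_1+iF_2:D\to\mathbb{R}_{p+q}\otimes_{\mathbb{R}}\mathbb{C}$ whose $\mathbb{R}_{p+q}$-valued components satisfy $F_1(\mathbf{x}_p,-r)=F_1(\mathbf{x}_p,r)$ and $F_2(\mathbf{x}_p,-r)=-F_2(\mathbf{x}_p,r)$. It induces the (left) generalized partial-slice function $f=\mathcal{I}(F):\Omega_D\to\mathbb{R}_{p+q}$, $f(\mathbf{x}_p+r\underline{\omega})=F_1(\mathbf{x}_p,r)+\underline{\omega}F_2(\mathbf{x}_p,r)$. $\mathcal{GS}(\Omega_D)$ is the set of all functions $\mathcal{I}(F)$ with $F$ a stem function on $D$. Cauchy kernel: $E(\mathbf{x})=\frac{1}{\sigma_{p+1}}\frac{\overline{\mathbf{x}}}{|\mathbf{x}|^{p+2}}$ for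 $\mathbf{x}\ne0$, with $\sigma_{p+1}=2\,\Gamma(\tfrac12)^{p+2}/\Gamma(\tfrac{p+2}{2})$ (the surface area of the unit ball in $\mathbb{R}^{p+2}$), and $E_{\mathbf{y}}(\mathbf{x})=E(\mathbf{y}-\mathbf{x})$. For $\mathbf{y}=\mathbf{y}_p+\widetilde r\,\underline{\eta}$ and $\mathbf{x}=\mathbf{x}_p+r\underline{\omega}$ ($\underline{\eta},\underline{\omega}\in\mathbb{S}$), the left generalized partial-slice Cauchy kernel is $$\mathcal{E}_{\mathbf{y}}(\mathbf{x})=\tfrac12(1-\underline{\omega}\,\underline{\eta})E_{\mathbf{y}}(\mathbf{x}_p+r\underline{\eta})+\tfrac12(1+\underline{\omega}\,\underline{\eta})E_{\mathbf{y}}(\mathbf{x}_p-r\underline{\eta}).$$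
   Formalization: The formula is proved for those x = x_p + rω in U that lie in the plane R^{p+1} ⊕ ηR or for which both x_p + rη and x_p − rη lie in U_η; for other x in U the claim as stated fails (e.g. f = 1, U a ball with a tentacle off that plane). *)

theory Defs
  imports "HOL-Analysis.Analysis"
begin

text \<open>
  The type \<open>'a\<close> indexes the coordinates \<open>0,\<dots>,p\<close> of \<open>\<real>\<^sup>p\<^sup>+\<^sup>1\<close> (so \<open>p + 1 = CARD('a)\<close>, and \<open>p = 0\<close> is
  allowed), its least element playing the role of the index \<open>0\<close>; the type \<open>'b\<close> indexes
  \<open>p+1,\<dots>,p+q\<close> (so \<open>q = CARD('b) \<ge> 1\<close>). Hence \<open>\<real>\<^sup>p\<^sup>+\<^sup>q\<^sup>+\<^sup>1\<close> is \<open>real^'a \<times> real^'b\<close>, and \<open>\<real>\<^sup>p\<^sup>+\<^sup>2\<close> is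
  \<open>real^'a \<times> real\<close>; the norms on these products are Euclidean.
\<close>

definition idx0 :: "'a::{finite,linorder}" where
  "idx0 = Min UNIV"


section \<open>The Clifford algebra\<close>

text \<open>
  A basis blade is a set of generators. Only \<open>Inl i\<close> with \<open>i \<noteq> idx0\<close> (that is
  \<open>e\<^sub>1,\<dots>,e\<^sub>p\<close>) and \<open>Inr j\<close> (that is \<open>e\<^sub>p\<^sub>+\<^sub>1,\<dots>,e\<^sub>p\<^sub>+\<^sub>q\<close>) are generators, so there are \<open>2^(p+q)\<close> blades.
\<close>

typedef (overloaded) ('a, 'b) blade = "{A :: ('a::{finite,linorder} + 'b::{finite,linorder}) set. Inl idx0 \<notin> A}"
  by (rule exI[of _ "{}"]) simp

instance blade :: ("{finite,linorder}", "{finite,linorder}") finite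
proof
  have "finite (range (Rep_blade :: ('a, 'b) blade \<Rightarrow> _))"
    by (rule finite_subset[OF subset_UNIV]) simp
  then show "finite (UNIV :: ('a, 'b) blade set)"
    by (rule finite_imageD) (simp add: Rep_blade_inject inj_on_def)
qed

type_synonym ('a, 'b) clifford = "real^('a, 'b) blade"

fun gen_le :: "'a::linorder + 'b::linorder \<Rightarrow> 'a + 'b \<Rightarrow> bool" where
  "gen_le (Inl i) (Inl j) = (i \<le> j)"
| "gen_le (Inl i) (Inr j) = True"
| "gen_le (Inr i) (Inl j) = False"
| "gen_le (Inr i) (Inr j) = (i \<le> j)"

text \<open>
  \<open>e\<^sub>A e\<^sub>B = blade_sign A B e\<^sub>A\<^sub>\<triangle>\<^sub>B\<close>: sorting the product costs a factor \<open>-1\<close> for every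
  \<open>a \<in> A\<close>, \<open>b \<in> B\<close> with \<open>b < a\<close>, and each common generator contributes \<open>e\<^sub>a\<^sup>2 = -1\<close>.
\<close>

definition blade_sign :: "('a::{finite,linorder}, 'b::{finite,linorder}) blade \<Rightarrow> ('a, 'b) blade \<Rightarrow> real" where
  "blade_sign A B = (\<Prod>a\<in>Rep_blade A. \<Prod>b\<in>Rep_blade B. if gen_le b a then - 1 else 1)"

definition blade_diff :: "('a::{finite,linorder}, 'b::{finite,linorder}) blade \<Rightarrow> ('a, 'b) blade \<Rightarrow> ('a, 'b) blade" where
  "blade_diff A B = Abs_blade (sym_diff (Rep_blade A) (Rep_blade B))"

text \<open>The Clifford product is written \<open>\<odot>\<close>; the library's \<open>*\<close> on vectors is componentwise.\<close>

definition clifford_mult ::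
  "('a::{finite,linorder}, 'b::{finite,linorder}) clifford \<Rightarrow> ('a, 'b) clifford \<Rightarrow> ('a, 'b) clifford"
  (infixl \<open>\<odot>\<close> 70) where
  "x \<odot> y = (\<Sum>A\<in>UNIV. \<Sum>B\<in>UNIV. (x $ A * y $ B * blade_sign A B) *\<^sub>R axis (blade_diff A B) 1)"

definition clifford_one :: "('a::{finite,linorder}, 'b::{finite,linorder}) clifford" where
  "clifford_one = axis (Abs_blade {}) 1"

text \<open>\<open>clifford_unit g\<close> is the generator \<open>e\<^sub>g\<close>, with \<open>e\<^sub>0 = 1\<close> for \<open>g = Inl idx0\<close>.\<close>

definition clifford_unit :: "'a::{finite,linorder} + 'b::{finite,linorder} \<Rightarrow> ('a, 'b) clifford" where
  "clifford_unit g = axis (Abs_blade ({g} - {Inl idx0})) 1"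

lemma Rep_blade_diff: "Rep_blade (blade_diff A B) = sym_diff (Rep_blade A) (Rep_blade B)"
  using Rep_blade[of A] Rep_blade[of B] by (auto simp: blade_diff_def Abs_blade_inverse)

lemma blade_diff_assoc: "blade_diff (blade_diff A B) C = blade_diff A (blade_diff B C)"
  by (subst Rep_blade_inject[symmetric]) (auto simp: Rep_blade_diff)

lemma prod_sym_diff_sign:
  fixes h :: "'c::finite \<Rightarrow> real"
  assumes "\<And>x. h x * h x = 1"
  shows "prod h (sym_diff A B) = prod h A * prod h B"
proof -
  have 1: "prod h A = prod h (A - B) * prod h (A \<inter> B)"
    by (subst prod.union_disjoint[symmetric]) (auto intro!: prod.cong)
  have 2: "prod h B = prod h (B - A) * prod h (A \<inter> B)"
    by (subst prod.union_disjoint[symmetric]) (auto intro!: prod.cong)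
  have 3: "prod h (sym_diff A B) = prod h (A - B) * prod h (B - A)"
    by (subst prod.union_disjoint) auto
  have "prod h (A \<inter> B) * prod h (A \<inter> B) = 1"
    by (simp add: prod.distrib[symmetric] assms)
  then show ?thesis
    by (simp add: 1 2 3 algebra_simps)
qed

lemma blade_sign_diff_left: "blade_sign (blade_diff A B) C = blade_sign A C * blade_sign B C"
  unfolding blade_sign_def Rep_blade_diff
  by (rule prod_sym_diff_sign) (auto simp: prod.distrib[symmetric] intro!: prod.neutral)

lemma blade_sign_diff_right: "blade_sign A (blade_diff B C) = blade_sign A B * blade_sign A C"
  unfolding blade_sign_def Rep_blade_diff
  by (subst prod_sym_diff_sign) (simp_all add: prod.distrib)

lemma clifford_mult_axis:
  "axis A 1 \<odot> axis B 1 = blade_sign A B *\<^sub>R axis (blade_diff A B) 1"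
proof -
  have "axis A 1 \<odot> axis B 1 = (\<Sum>A'\<in>UNIV. if A' = A then
      (\<Sum>B'\<in>UNIV. if B' = B then blade_sign A B *\<^sub>R axis (blade_diff A B) (1::real) else 0) else 0)"
    unfolding clifford_mult_def
    by (intro sum.cong refl) (auto simp: axis_def[of A] axis_def[of B] if_distrib[of "\<lambda>t. t * _"]
        if_distrib[of "\<lambda>t. t *\<^sub>R _"] cong: if_cong)
  then show ?thesis by simp
qed

lemma bounded_bilinear_clifford_mult: "bounded_bilinear (\<odot>)"
  unfolding bilinear_conv_bounded_bilinear[symmetric] clifford_mult_def
  by (auto simp: bilinear_def algebra_simps sum.distrib scaleR_right.sum
      intro!: linearI sum.cong)

lemma clifford_axis_expansion: "(x :: real^'n) = (\<Sum>A\<in>UNIV. x $ A *\<^sub>R axis A 1)"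
  using basis_expansion[of x] by (simp add: scalar_mult_eq_scaleR)

lemma clifford_mult_assoc: "(x \<odot> y) \<odot> z = x \<odot> (y \<odot> z)"
proof -
  interpret bounded_bilinear "(\<odot>) :: ('a, 'b) clifford \<Rightarrow> _"
    by (rule bounded_bilinear_clifford_mult)
  have ax: "(axis A 1 \<odot> axis B 1) \<odot> axis C 1 = axis A 1 \<odot> (axis B 1 \<odot> axis C 1)"
    for A B C :: "('a, 'b) blade"
    by (simp add: clifford_mult_axis scaleR_left scaleR_right blade_sign_diff_left
        blade_sign_diff_right blade_diff_assoc)
  have "(x \<odot> y) \<odot> z = ((\<Sum>A\<in>UNIV. x $ A *\<^sub>R axis A 1) \<odot> (\<Sum>B\<in>UNIV. y $ B *\<^sub>R axis B 1))
      \<odot> (\<Sum>C\<in>UNIV. z $ C *\<^sub>R axis C 1)"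
    by (simp only: clifford_axis_expansion[symmetric])
  also have "\<dots> = (\<Sum>A\<in>UNIV. x $ A *\<^sub>R axis A 1) \<odot> ((\<Sum>B\<in>UNIV. y $ B *\<^sub>R axis B 1)
      \<odot> (\<Sum>C\<in>UNIV. z $ C *\<^sub>R axis C 1))"
    by (simp add: sum_left sum_right scaleR_left scaleR_right ax)
  also have "\<dots> = x \<odot> (y \<odot> z)"
    by (simp only: clifford_axis_expansion[symmetric])
  finally show ?thesis .
qed

lemma Rep_Abs_unit: "Rep_blade (Abs_blade ({g} - {Inl idx0})) = {g} - {Inl idx0}"
  by (rule Abs_blade_inverse) auto

lemma clifford_one_left: "clifford_one \<odot> x = x"
proof -
  interpret bounded_bilinear "(\<odot>) :: ('a, 'b) clifford \<Rightarrow> _"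
    by (rule bounded_bilinear_clifford_mult)
  have "clifford_one \<odot> axis A 1 = axis A 1" for A :: "('a, 'b) blade"
    unfolding clifford_one_def clifford_mult_axis
    by (simp add: blade_sign_def blade_diff_def Abs_blade_inverse Rep_blade_inverse)
  then have "clifford_one \<odot> (\<Sum>A\<in>UNIV. x $ A *\<^sub>R axis A 1) = (\<Sum>A\<in>UNIV. x $ A *\<^sub>R axis A 1)"
    by (simp add: sum_right scaleR_right)
  then show ?thesis
    by (simp only: clifford_axis_expansion[symmetric])
qed

lemma clifford_one_right: "x \<odot> clifford_one = x"
proof -
  interpret bounded_bilinear "(\<odot>) :: ('a, 'b) clifford \<Rightarrow> _"
    by (rule bounded_bilinear_clifford_mult)
  have "axis A 1 \<odot> clifford_one = axis A 1" for A :: "('a, 'b) blade"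
    unfolding clifford_one_def clifford_mult_axis
    by (simp add: blade_sign_def blade_diff_def Abs_blade_inverse Rep_blade_inverse)
  then have "(\<Sum>A\<in>UNIV. x $ A *\<^sub>R axis A 1) \<odot> clifford_one = (\<Sum>A\<in>UNIV. x $ A *\<^sub>R axis A 1)"
    by (simp add: sum_left scaleR_left)
  then show ?thesis
    by (simp only: clifford_axis_expansion[symmetric])
qed

lemma clifford_unit_0: "clifford_unit (Inl idx0) = clifford_one"
  by (simp add: clifford_unit_def clifford_one_def)

lemma gen_le_total: "g \<noteq> h \<Longrightarrow> gen_le h g \<longleftrightarrow> \<not> gen_le g h"
  by (cases g; cases h) auto

lemma gen_le_refl: "gen_le g g"
  by (cases g) auto

lemma clifford_unit_relations:
  fixes g h :: "'a::{finite,linorder} + 'b::{finite,linorder}"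
  assumes "g \<noteq> Inl idx0" "h \<noteq> Inl idx0"
  shows "clifford_unit g \<odot> clifford_unit h + clifford_unit h \<odot> clifford_unit g
    = (if g = h then - 2 else 0) *\<^sub>R clifford_one"
proof -
  define bl :: "'a + 'b \<Rightarrow> ('a, 'b) blade" where "bl k = Abs_blade {k}" for k
  have u: "clifford_unit g = axis (bl g) 1" "clifford_unit h = axis (bl h) 1"
    using assms by (auto simp: clifford_unit_def bl_def)
  have R: "Rep_blade (bl g) = {g}" "Rep_blade (bl h) = {h}"
    using assms by (auto simp: bl_def Abs_blade_inverse)
  have s: "blade_sign (bl g) (bl h) = (if gen_le h g then - 1 else 1)"
    "blade_sign (bl h) (bl g) = (if gen_le g h then - 1 else 1)"
    by (simp_all add: blade_sign_def R)
  have d: "blade_diff (bl h) (bl g) = blade_diff (bl g) (bl h)"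
    by (simp add: blade_diff_def Un_commute)
  show ?thesis
  proof (cases "g = h")
    case True
    then have "blade_diff (bl g) (bl h) = Abs_blade {}"
      by (simp add: blade_diff_def R)
    then show ?thesis
      using True unfolding u clifford_mult_axis s d
      by (simp add: gen_le_refl clifford_one_def scaleR_2[symmetric] flip: scaleR_left_distrib)
  next
    case False
    then show ?thesis
      unfolding u clifford_mult_axis s d using gen_le_total[OF False] by simp
  qed
qed


section \<open>Paravectors and slices\<close>

type_synonym ('a, 'b) point = "(real^'a) \<times> (real^'b)"
type_synonym 'a slice_point = "(real^'a) \<times> real"

definition paravector :: "('a::{finite,linorder}, 'b::{finite,linorder}) point \<Rightarrow> ('a, 'b) clifford" where
  "paravector x = (\<Sum>i\<in>UNIV. (fst x $ i) *\<^sub>R clifford_unit (Inl i)) +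
                  (\<Sum>j\<in>UNIV. (snd x $ j) *\<^sub>R clifford_unit (Inr j))"

definition conjugate :: "('a::{finite,linorder}, 'b::{finite,linorder}) point \<Rightarrow> ('a, 'b) point" where
  "conjugate x = ((\<chi> i. if i = idx0 then fst x $ i else - (fst x $ i)), - snd x)"

text \<open>The element of the Clifford algebra given by \<open>\<omega> \<in> \<real>\<^sup>q\<close>; the sphere of the theory is \<open>sphere 0 1\<close>.\<close>

definition imag :: "real^'b::{finite,linorder} \<Rightarrow> ('a::{finite,linorder}, 'b) clifford" where
  "imag w = paravector (0, w)"

text \<open>The \<open>\<omega>\<close> in \<open>x = x\<^sub>p + r \<omega>\<close>, \<open>r = norm (snd x)\<close>; an arbitrary unit vector if \<open>r = 0\<close>.\<close>

definition direction :: "real^'b \<Rightarrow> real^'b" where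
  "direction v = (if v = 0 then (SOME w. w \<in> sphere 0 1) else v /\<^sub>R norm v)"

definition slice_embed :: "real^'b \<Rightarrow> 'a slice_point \<Rightarrow> ('a::finite, 'b::finite) point" where
  "slice_embed \<eta> z = (fst z, snd z *\<^sub>R \<eta>)"

text \<open>\<open>V\<^sub>\<eta>\<close> as a subset of \<open>\<real>\<^sup>p\<^sup>+\<^sup>2\<close>.\<close>

definition slice :: "real^'b \<Rightarrow> ('a::finite, 'b::finite) point set \<Rightarrow> 'a slice_point set" where
  "slice \<eta> V = {z. slice_embed \<eta> z \<in> V}"


section \<open>Generalized partial-slice functions\<close>

definition reflection_invariant :: "'a::finite slice_point set \<Rightarrow> bool" where
  "reflection_invariant D \<longleftrightarrow> (\<forall>xp r. (xp, r) \<in> D \<longrightarrow> (xp, - r) \<in> D)"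

definition p_completion :: "'a slice_point set \<Rightarrow> ('a::finite, 'b::finite) point set" where
  "p_completion D = (\<Union>\<omega>\<in>sphere 0 1. {(xp, r *\<^sub>R \<omega>) | xp r. (xp, r) \<in> D \<and> r \<ge> 0})"

text \<open>The complexified Clifford algebra consists of vectors with complex blade coefficients.\<close>

definition part1 :: "complex^'n \<Rightarrow> real^'n" where
  "part1 c = (\<chi> A. Re (c $ A))"

definition part2 :: "complex^'n \<Rightarrow> real^'n" where
  "part2 c = (\<chi> A. Im (c $ A))"

definition stem_function ::
  "'a::{finite,linorder} slice_point set \<Rightarrow> ('a slice_point \<Rightarrow> complex^('a, 'b::{finite,linorder}) blade) \<Rightarrow> bool" where
  "stem_function D F \<longleftrightarrow> (\<forall>xp r. (xp, r) \<in> D \<longrightarrow>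
     part1 (F (xp, - r)) = part1 (F (xp, r)) \<and> part2 (F (xp, - r)) = - part2 (F (xp, r)))"

definition induced ::
  "('a::{finite,linorder} slice_point \<Rightarrow> complex^('a, 'b::{finite,linorder}) blade) \<Rightarrow> ('a, 'b) point \<Rightarrow> ('a, 'b) clifford" where
  "induced F x = (let z = (fst x, norm (snd x)) in part1 (F z) + imag (direction (snd x)) \<odot> part2 (F z))"

text \<open>\<open>F \<in> C\<^sup>1(closure D)\<close>: continuously differentiable on the open set \<open>D\<close>, the function and its
  derivative having continuous extensions to the closure.\<close>

definition C1_closure :: "'v::real_normed_vector set \<Rightarrow> ('v \<Rightarrow> 'w::real_normed_vector) \<Rightarrow> bool" where
  "C1_closure D F \<longleftrightarrow> (\<exists>G (G' :: 'v \<Rightarrow> 'v \<Rightarrow>\<^sub>L 'w).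
     continuous_on (closure D) G \<and> continuous_on (closure D) G' \<and>
     (\<forall>x\<in>D. F x = G x \<and> (F has_derivative blinfun_apply (G' x)) (at x)))"

text \<open>The operator \<open>D\<^sub>\<eta>\<close> at \<open>y\<^sub>p + r \<eta>\<close>, where \<open>z = (y\<^sub>p, r)\<close>.\<close>

definition partial_deriv :: "('v::real_normed_vector \<Rightarrow> 'w::real_normed_vector) \<Rightarrow> 'v \<Rightarrow> 'v \<Rightarrow> 'w" where
  "partial_deriv h v z = vector_derivative (\<lambda>t. h (z + t *\<^sub>R v)) (at 0)"

definition slice_dirac ::
  "real^'b::{finite,linorder} \<Rightarrow> (('a, 'b) point \<Rightarrow> ('a, 'b) clifford) \<Rightarrow> 'a::{finite,linorder} slice_point \<Rightarrow> ('a, 'b) clifford" where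
  "slice_dirac \<eta> f z = (let h = (\<lambda>z. f (slice_embed \<eta> z)) in
     (\<Sum>i\<in>UNIV. clifford_unit (Inl i) \<odot> partial_deriv h (axis i 1, 0) z) + imag \<eta> \<odot> partial_deriv h (0, 1) z)"


section \<open>The Cauchy kernel\<close>

text \<open>Here \<open>p + 2 = CARD('a) + 1\<close>.\<close>

definition cauchy_E :: "('a::{finite,linorder}, 'b::{finite,linorder}) point \<Rightarrow> ('a, 'b) clifford" where
  "cauchy_E x = (let N = CARD('a) + 1; \<sigma> = 2 * Gamma (1/2) ^ N / Gamma (real N / 2) in
     (1 / \<sigma>) *\<^sub>R (1 / norm x ^ N) *\<^sub>R paravector (conjugate x))"

definition slice_cauchy_kernel ::
  "real^'b::{finite,linorder} \<Rightarrow> ('a::{finite,linorder}, 'b) point \<Rightarrow> ('a, 'b) point \<Rightarrow> ('a, 'b) clifford" where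
  "slice_cauchy_kernel \<eta> y x = (let r = norm (snd x); \<omega> = direction (snd x) in
     (1/2) *\<^sub>R (clifford_one - imag \<omega> \<odot> imag \<eta>) \<odot> cauchy_E (y - (fst x, r *\<^sub>R \<eta>)) +
     (1/2) *\<^sub>R (clifford_one + imag \<omega> \<odot> imag \<eta>) \<odot> cauchy_E (y - (fst x, - r *\<^sub>R \<eta>)))"


section \<open>Smooth boundaries, exterior normals and surface measure\<close>

definition C1_gradient :: "'v::real_inner set \<Rightarrow> ('v \<Rightarrow> real) \<Rightarrow> ('v \<Rightarrow> 'v) \<Rightarrow> bool" where
  "C1_gradient V g g' \<longleftrightarrow> open V \<and> continuous_on V g' \<and>
     (\<forall>u\<in>V. (g has_derivative (\<lambda>h. g' u \<bullet> h)) (at u))"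

text \<open>
  After a rotation of the coordinates, near each boundary point \<open>G\<close> is the region on
  one side of the graph of a continuously differentiable function.
\<close>

definition smooth_boundary :: "('v::euclidean_space \<times> real) set \<Rightarrow> bool" where
  "smooth_boundary G \<longleftrightarrow> (\<forall>y\<in>frontier G. \<exists>\<epsilon>>0. \<exists>(T :: 'v \<times> real \<Rightarrow> 'v \<times> real) V g g'.
     orthogonal_transformation T \<and> C1_gradient V g g' \<and>
     (\<forall>u s. T (u, s) \<in> ball y \<epsilon> \<longrightarrow> u \<in> V \<and> (T (u, s) \<in> G \<longleftrightarrow> s < g u)))"

text \<open>A unit vector orthogonal to all tangent vectors of the boundary at \<open>y\<close> and pointing out of \<open>G\<close>.\<close>

definition unit_exterior_normal :: "'v::euclidean_space set \<Rightarrow> 'v \<Rightarrow> 'v \<Rightarrow> bool" where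
  "unit_exterior_normal G y n \<longleftrightarrow> norm n = 1 \<and>
     (\<forall>\<gamma> v. \<gamma> 0 = y \<and> eventually (\<lambda>t. \<gamma> t \<in> frontier G) (at (0::real)) \<and>
        (\<gamma> has_vector_derivative v) (at 0) \<longrightarrow> n \<bullet> v = 0) \<and>
     eventually (\<lambda>t. y + t *\<^sub>R n \<notin> closure G \<and> y - t *\<^sub>R n \<in> G) (at_right 0)"

text \<open>
  The classical surface measure of a hypersurface \<open>S\<close>: the Borel measure carried by \<open>S\<close> which on
  every piece of \<open>S\<close> that is (in rotated coordinates) the graph of a \<open>C\<^sup>1\<close> function \<open>g\<close> is
  \<open>dS = sqrt (1 + \<bar>\<nabla>g(u)\<bar>\<^sup>2) du\<close>. If \<open>S\<close> is a compact \<open>C\<^sup>1\<close> hypersurface there is exactly one such measure.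
\<close>

definition is_surface_measure :: "('v::euclidean_space \<times> real) set \<Rightarrow> ('v \<times> real) measure \<Rightarrow> bool" where
  "is_surface_measure S \<mu> \<longleftrightarrow> sets \<mu> = sets borel \<and> emeasure \<mu> (- S) = 0 \<and>
     (\<forall>(T :: 'v \<times> real \<Rightarrow> 'v \<times> real) V g g'. orthogonal_transformation T \<and> C1_gradient V g g' \<and> (\<lambda>u. T (u, g u)) ` V \<subseteq> S \<longrightarrow>
       (\<forall>A\<in>sets borel. A \<subseteq> V \<longrightarrow>
         emeasure \<mu> ((\<lambda>u. T (u, g u)) ` A) = (\<integral>\<^sup>+ u\<in>A. ennreal (sqrt (1 + (norm (g' u))\<^sup>2)) \<partial>lborel)))"

definition surface_measure :: "('v::euclidean_space \<times> real) set \<Rightarrow> ('v \<times> real) measure" where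
  "surface_measure S = (SOME \<mu>. is_surface_measure S \<mu>)"

end

theory Submission
  imports Defs
begin

text \<open>
  On the slice \<open>\<real>\<^sup>p\<^sup>+\<^sup>2\<close> the function \<open>h z = f (slice_embed \<eta> z)\<close> is \<open>F\<^sub>1 + \<eta> F\<^sub>2\<close>, so it is \<open>C\<^sup>1\<close>, and \<open>f x\<close> is the combination
  of \<open>h (x\<^sub>p, r)\<close> and \<open>h (x\<^sub>p, - r)\<close> whose coefficients \<open>(1 - \<omega> \<eta>) / 2\<close> and \<open>(1 + \<omega> \<eta>) / 2\<close> also define the slice
  kernel. The theorem is therefore the Cauchy-Pompeiu formula for \<open>h\<close> at these two points (at \<open>x\<close> alone
  if \<open>x\<close> lies in the slice, where the kernel reduces to \<open>E\<close>). This in turn is the divergence theorem for the fields \<open>E e\<^sub>k h\<close>, where \<open>E\<close> is first regularised near its pole; the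
  divergence of the regularised kernel is an approximate identity.

  Straightening the boundary in a graph chart shows that \<open>\<integral>\<^sub>G \<partial>\<^sub>v \<psi>\<close> is the flux of \<open>\<psi> v\<close> through the
  graph, for \<open>\<psi>\<close> supported in the chart. The left-hand side does not depend on the chart; hence the graph measures of any
  two charts agree on their overlap, the surface measure exists, and a partition of unity gives the
  divergence theorem.
\<close>

section \<open>Continuously differentiable functions\<close>

text \<open>\<open>surface_measure\<close> is a choice among measures tested on every C1 graph
  contained in the frontier, in any rotation and with \<open>G\<close> on either side. No surface
  integral can be computed before such a measure is known to exist; for that, every graph of this
  kind has to be recognised, near each of its points, as a chart of \<open>G\<close>, possibly after
  reversing its vertical axis. Comparing fluxes instead of parametrisations means that transition
  maps between charts, and their Jacobians, never appear.

  The pole is regularised and not cut out by a small ball, so the divergence theorem is needed for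
  \<open>G\<close> alone and no integral over a small sphere has to be evaluated. Continuing the
  radial factor by its tangent line keeps it C1, which is all that the theorem asks, and turns the
  divergence into an explicit function of computable mass.

  Of the Clifford algebra the formula for \<open>h\<close> uses only associativity and conj(w) w =
  |w|^2, on basis vectors and on w itself. All functions may be taken C1 on the open set
  \<open>D\<close>: the frontier of the slice of \<open>U\<close> lies in the slice of
  \<open>\<Omega>\<close>, which is \<open>D\<close>, so \<open>D\<close> contains the closure of
  \<open>G\<close>.\<close>

definition C1_on :: "'v::euclidean_space set \<Rightarrow> ('v \<Rightarrow> 'w::euclidean_space) \<Rightarrow> bool" where
  "C1_on X \<phi> \<longleftrightarrow> (\<forall>z\<in>X. \<phi> differentiable (at z)) \<and>
     (\<forall>v. continuous_on X (\<lambda>z. frechet_derivative \<phi> (at z) v))"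

lemma C1_onI:
  assumes "\<And>z. z \<in> X \<Longrightarrow> (\<phi> has_derivative \<phi>' z) (at z)"
    and "\<And>v. continuous_on X (\<lambda>z. \<phi>' z v)"
  shows "C1_on X \<phi>"
proof -
  have "frechet_derivative \<phi> (at z) = \<phi>' z" if "z \<in> X" for z
    using assms(1)[OF that] frechet_derivative_at by metis
  then have "continuous_on X (\<lambda>z. frechet_derivative \<phi> (at z) v)" for v
    using assms(2)[of v] by (simp cong: continuous_on_cong)
  then show ?thesis
    unfolding C1_on_def using assms(1) differentiable_def by blast
qed

lemma C1_on_has_derivative:
  "C1_on X \<phi> \<Longrightarrow> z \<in> X \<Longrightarrow> (\<phi> has_derivative frechet_derivative \<phi> (at z)) (at z)"
  by (simp add: C1_on_def frechet_derivative_works)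

lemma C1_on_continuous_deriv:
  "C1_on X \<phi> \<Longrightarrow> continuous_on X (\<lambda>z. frechet_derivative \<phi> (at z) v)"
  by (simp add: C1_on_def)

lemma C1_on_continuous: "C1_on X \<phi> \<Longrightarrow> continuous_on X \<phi>"
  by (meson C1_on_has_derivative continuous_at_imp_continuous_on has_derivative_continuous)

lemma C1_on_subset: "C1_on X \<phi> \<Longrightarrow> Y \<subseteq> X \<Longrightarrow> C1_on Y \<phi>"
  unfolding C1_on_def by (meson continuous_on_subset subsetD)

lemma C1_on_cong:
  assumes "C1_on X \<phi>" "open X" "\<And>z. z \<in> X \<Longrightarrow> \<psi> z = \<phi> z"
  shows "C1_on X \<psi>"
proof (rule C1_onI)
  fix z assume "z \<in> X"
  then show "(\<psi> has_derivative frechet_derivative \<phi> (at z)) (at z)"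
    using C1_on_has_derivative[OF assms(1)] assms(2,3)
    by (metis has_derivative_transform_within_open)
qed (rule C1_on_continuous_deriv[OF assms(1)])

lemma C1_on_Un:
  assumes "C1_on X \<phi>" "C1_on Y \<phi>" "open X" "open Y"
  shows "C1_on (X \<union> Y) \<phi>"
  using assms unfolding C1_on_def by (auto intro: continuous_on_open_Un)

lemma C1_on_const: "C1_on X (\<lambda>z. c)"
  by (rule C1_onI[where \<phi>'="\<lambda>_ _. 0"]) auto

lemma C1_on_linear: "bounded_linear L \<Longrightarrow> C1_on X L"
  by (rule C1_onI[where \<phi>'="\<lambda>_. L"]) (auto intro: bounded_linear_imp_has_derivative)

lemma C1_on_add: "C1_on X f \<Longrightarrow> C1_on X g \<Longrightarrow> C1_on X (\<lambda>z. f z + g z)"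
  by (rule C1_onI[where \<phi>'="\<lambda>z v. frechet_derivative f (at z) v + frechet_derivative g (at z) v"])
    (auto intro!: has_derivative_add C1_on_has_derivative continuous_intros C1_on_continuous_deriv)

lemma C1_on_diff: "C1_on X f \<Longrightarrow> C1_on X g \<Longrightarrow> C1_on X (\<lambda>z. f z - g z)"
  by (rule C1_onI[where \<phi>'="\<lambda>z v. frechet_derivative f (at z) v - frechet_derivative g (at z) v"])
    (auto intro!: has_derivative_diff C1_on_has_derivative continuous_intros C1_on_continuous_deriv)

lemma C1_on_bilinear:
  assumes "bounded_bilinear prd" "C1_on X f" "C1_on X g"
  shows "C1_on X (\<lambda>z. prd (f z) (g z))"
proof (rule C1_onI)
  interpret bounded_bilinear prd by fact
  show "((\<lambda>z. prd (f z) (g z)) has_derivative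
      (\<lambda>v. prd (f z) (frechet_derivative g (at z) v) + prd (frechet_derivative f (at z) v) (g z))) (at z)"
    if "z \<in> X" for z
    by (rule FDERIV) (use assms that in \<open>auto intro: C1_on_has_derivative\<close>)
  show "continuous_on X (\<lambda>z. prd (f z) (frechet_derivative g (at z) v) +
      prd (frechet_derivative f (at z) v) (g z))" for v
    by (intro continuous_intros continuous_on)
      (auto intro: assms C1_on_continuous_deriv C1_on_continuous)
qed

lemmas C1_on_scaleR = C1_on_bilinear[OF bounded_bilinear_scaleR]
lemmas C1_on_mult = C1_on_bilinear[OF bounded_bilinear_mult]
lemmas C1_on_inner = C1_on_bilinear[OF bounded_bilinear_inner]

lemma C1_on_sum: "finite I \<Longrightarrow> (\<And>i. i \<in> I \<Longrightarrow> C1_on X (f i)) \<Longrightarrow> C1_on X (\<lambda>z. \<Sum>i\<in>I. f i z)"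
  by (induction rule: finite_induct) (auto intro: C1_on_add C1_on_const)

lemma C1_on_prod:
  fixes f :: "'i \<Rightarrow> 'v::euclidean_space \<Rightarrow> real"
  shows "finite I \<Longrightarrow> (\<And>i. i \<in> I \<Longrightarrow> C1_on X (f i)) \<Longrightarrow> C1_on X (\<lambda>z. \<Prod>i\<in>I. f i z)"
  by (induction rule: finite_induct) (auto intro: C1_on_mult C1_on_const)

lemma C1_on_compose_real:
  fixes \<phi> :: "'v::euclidean_space \<Rightarrow> real" and \<rho> :: "real \<Rightarrow> real"
  assumes "C1_on X \<phi>" "\<And>t. t \<in> \<phi> ` X \<Longrightarrow> (\<rho> has_real_derivative \<rho>' t) (at t)" "continuous_on (\<phi> ` X) \<rho>'"
  shows "C1_on X (\<lambda>z. \<rho> (\<phi> z))"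
proof (rule C1_onI)
  show "((\<lambda>z. \<rho> (\<phi> z)) has_derivative (\<lambda>v. frechet_derivative \<phi> (at z) v *\<^sub>R \<rho>' (\<phi> z))) (at z)" if "z \<in> X" for z
    using has_derivative_compose[OF C1_on_has_derivative[OF assms(1) that]
      assms(2)[of "\<phi> z", unfolded has_field_derivative_def]] that
    by (simp add: mult.commute)
  show "continuous_on X (\<lambda>z. frechet_derivative \<phi> (at z) v *\<^sub>R \<rho>' (\<phi> z))" for v
    using assms(1) continuous_on_compose2[OF assms(3) C1_on_continuous[OF assms(1)]]
    by (auto intro!: continuous_intros C1_on_continuous_deriv)
qed

lemma frechet_derivative_zero_off:
  assumes "closed K" "\<And>z. z \<notin> K \<Longrightarrow> \<phi> z = 0" "z \<notin> K"
  shows "(\<phi> has_derivative (\<lambda>v. 0)) (at z)" "frechet_derivative \<phi> (at z) = (\<lambda>v. 0)"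
proof -
  show *: "(\<phi> has_derivative (\<lambda>v. 0)) (at z)"
    by (rule has_derivative_transform_within_open[where f="\<lambda>_. 0" and s="-K"]) (use assms in auto)
  show "frechet_derivative \<phi> (at z) = (\<lambda>v. 0)"
    using frechet_derivative_at[OF *] by simp
qed

text \<open>The open sets \<open>X\<close> and \<open>-K\<close> cover the space and the extension
  vanishes on the second. This makes localised functions global, as the integration lemmas want C1
  functions on \<open>UNIV\<close>.\<close>

lemma C1_on_extend_zero:
  fixes \<phi> :: "'v::euclidean_space \<Rightarrow> 'w::euclidean_space"
  assumes "C1_on X \<phi>" "open X" "closed K" "K \<subseteq> X" "\<And>z. z \<in> X \<Longrightarrow> z \<notin> K \<Longrightarrow> \<phi> z = 0"
  shows "C1_on UNIV (\<lambda>z. if z \<in> X then \<phi> z else 0)"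
proof -
  let ?\<psi> = "\<lambda>z. if z \<in> X then \<phi> z else 0"
  have "C1_on X ?\<psi>"
    by (rule C1_on_cong[OF assms(1,2)]) auto
  moreover have "C1_on (-K) ?\<psi>"
    by (rule C1_on_cong[OF C1_on_const[of _ 0]]) (use assms in auto)
  ultimately have "C1_on (X \<union> -K) ?\<psi>"
    by (rule C1_on_Un) (use assms in auto)
  moreover have "X \<union> -K = UNIV" using assms by auto
  ultimately show ?thesis by simp
qed

lemma frechet_derivative_eq_on_open:
  assumes "open X" "z \<in> X" "\<And>z. z \<in> X \<Longrightarrow> \<phi> z = \<psi> z"
  shows "frechet_derivative \<phi> (at z) = frechet_derivative \<psi> (at z)"
proof -
  have "(\<phi> has_derivative D) (at z) \<longleftrightarrow> (\<psi> has_derivative D) (at z)" for D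
    using assms by (metis has_derivative_transform_within_open)
  then show ?thesis
    by (simp add: frechet_derivative_def)
qed

text \<open>Both functions built from two formulas, \<open>pos_sq\<close> and
  \<open>regularized_power\<close>, are C1 because value and slope match at the junction.\<close>

lemma real_glue_derivative:
  fixes f g :: "real \<Rightarrow> real"
  assumes f: "\<And>t. t \<le> c \<Longrightarrow> (f has_real_derivative f' t) (at t)"
    and g: "\<And>t. t \<ge> c \<Longrightarrow> (g has_real_derivative g' t) (at t)"
    and "f c = g c" "f' c = g' c"
  shows "((\<lambda>t. if t \<le> c then f t else g t) has_real_derivative (if t \<le> c then f' t else g' t)) (at t)"
proof -
  have "((\<lambda>t. if t \<in> {..c} then f t else g t) has_derivative
      (if t \<in> {..c} then (\<lambda>h. f' t * h) else (\<lambda>h. g' t * h))) (at t within {..c} \<union> {c<..})"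
    by (rule has_derivative_If_within_closures[where T="{c<..}" and f'="\<lambda>t h. f' t * h" and g'="\<lambda>t h. g' t * h"])
      (use assms in \<open>auto simp: has_field_derivative_def intro: has_derivative_at_withinI\<close>)
  moreover have "{..c} \<union> {c<..} = UNIV" by auto
  ultimately show ?thesis
    by (auto simp: has_field_derivative_def split: if_splits)
qed

text \<open>Squaring the positive part removes its kink. Only C1 cut-offs are needed, so this simple
  function replaces the usual smooth bump.\<close>

definition pos_sq :: "real \<Rightarrow> real" where
  "pos_sq t = (if t \<le> 0 then 0 else t\<^sup>2)"

lemma pos_sq_nonneg: "pos_sq t \<ge> 0"
  and pos_sq_pos_iff: "pos_sq t > 0 \<longleftrightarrow> t > 0"
  and pos_sq_zero_iff: "pos_sq t = 0 \<longleftrightarrow> t \<le> 0"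
  by (auto simp: pos_sq_def)

lemma C1_on_pos_sq:
  assumes "C1_on X \<phi>"
  shows "C1_on X (\<lambda>z. pos_sq (\<phi> z))"
proof (rule C1_on_compose_real[OF assms])
  show "(pos_sq has_real_derivative (if t \<le> 0 then 0 else 2 * t)) (at t)" for t
    unfolding pos_sq_def[abs_def]
    by (rule real_glue_derivative) (auto intro!: derivative_eq_intros)
  have "(\<lambda>t::real. if t \<le> 0 then 0 else 2 * t) = (\<lambda>t. 2 * max 0 t)"
    by auto
  moreover have "continuous_on S (\<lambda>t::real. 2 * max 0 t)" for S
    by (intro continuous_intros)
  ultimately show "continuous_on S (\<lambda>t::real. if t \<le> 0 then 0 else 2 * t)" for S
    by presburger
qed

text \<open>The image measure is again translation invariant, so by Fubini it is a multiple of Lebesgue measure;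
  the unit ball, which \<open>T\<close> preserves, shows that the factor is \<open>1\<close>.\<close>

lemma lborel_orthogonal:
  fixes T :: "'v::euclidean_space \<Rightarrow> 'v"
  assumes T: "orthogonal_transformation T"
  shows "distr lborel borel T = lborel"
proof (rule measure_eqI)
  have lin: "linear T" using T by (rule orthogonal_transformation_linear)
  have Tm[measurable]: "T \<in> borel \<rightarrow>\<^sub>M borel"
    using lin by (intro borel_measurable_continuous_onI linear_continuous_on linear_conv_bounded_linear[THEN iffD1])
  let ?\<nu> = "distr lborel borel T"
  define B where "B = ball (0::'v) 1"
  have [measurable]: "B \<in> sets borel" by (simp add: B_def)
  have pre: "T -` B = B"
    using orthogonal_transformation_norm[OF T] by (auto simp: B_def dist_norm)
  have \<nu>B: "emeasure ?\<nu> B = emeasure lborel B"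
    by (subst emeasure_distr) (auto simp: pre)
  have transl: "(\<integral>\<^sup>+y. h (a + y) \<partial>lborel) = (\<integral>\<^sup>+y. h y \<partial>lborel)"
    if [measurable]: "h \<in> borel_measurable borel" for h and a :: 'v
    by (subst (2) lborel_distr_plus[of a, symmetric]) (simp add: nn_integral_distr)
  have transl\<nu>: "(\<integral>\<^sup>+y. h (a + y) \<partial>?\<nu>) = (\<integral>\<^sup>+y. h y \<partial>?\<nu>)"
    if [measurable]: "h \<in> borel_measurable borel" for h a
  proof -
    obtain b where b: "a = T b" using orthogonal_transformation_surj[OF T] by auto
    have "(\<integral>\<^sup>+y. h (a + y) \<partial>?\<nu>) = (\<integral>\<^sup>+y. h (T (b + y)) \<partial>lborel)"
      by (simp add: nn_integral_distr b linear_add[OF lin])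
    also have "\<dots> = (\<integral>\<^sup>+y. h (T y) \<partial>lborel)"
      by (rule transl) simp
    finally show ?thesis by (simp add: nn_integral_distr)
  qed
  fix X :: "'v set" assume "X \<in> sets ?\<nu>"
  then have [measurable]: "X \<in> sets borel" by simp
  let ?f = "indicator X :: 'v \<Rightarrow> ennreal" and ?k = "indicator B :: 'v \<Rightarrow> ennreal"
  \<comment> \<open>Needed for Fubini; \<open>T\<close> preserves closed balls about 0, so these
    have finite image measure and exhaust the space.\<close>
  interpret \<nu>: sigma_finite_measure ?\<nu>
  proof
    have "T -` cball 0 r = cball 0 r" for r
      using orthogonal_transformation_norm[OF T] by (auto simp: dist_norm)
    then have "emeasure ?\<nu> (cball 0 r) = emeasure lborel (cball (0::'v) r)" for r :: real
      by (subst emeasure_distr) auto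
    then have "emeasure ?\<nu> (cball 0 r) \<noteq> \<infinity>" for r
      using emeasure_compact_finite[of "cball (0::'v) r"] by auto
    moreover have "(\<Union>n. cball (0::'v) (real n)) = UNIV"
      by (auto simp: real_arch_simple)
    ultimately show "\<exists>A. countable A \<and> A \<subseteq> sets ?\<nu> \<and> \<Union> A = space ?\<nu> \<and> (\<forall>a\<in>A. emeasure ?\<nu> a \<noteq> \<infinity>)"
      by (intro exI[of _ "range (\<lambda>n. cball 0 (real n))"]) auto
  qed
  interpret pair_sigma_finite lborel ?\<nu> ..
  \<comment> \<open>The double integral of \<open>?f (y + x) * ?k y\<close> is taken in both orders.
    Invariance of \<open>lborel\<close> in \<open>x\<close> yields the left-hand side; invariance of
    \<open>?\<nu>\<close> in \<open>y\<close> moves the shift to \<open>?k\<close>, whose integral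
    over \<open>x\<close> is the volume of the unit ball.\<close>
  have "(\<integral>\<^sup>+x. ?f x \<partial>lborel) * (\<integral>\<^sup>+y. ?k y \<partial>?\<nu>) = (\<integral>\<^sup>+y. (\<integral>\<^sup>+x. ?f x * ?k y \<partial>lborel) \<partial>?\<nu>)"
    by (simp add: nn_integral_cmult nn_integral_multc nn_integral_cmult_indicator)
  also have "\<dots> = (\<integral>\<^sup>+y. (\<integral>\<^sup>+x. ?f (y + x) * ?k y \<partial>lborel) \<partial>?\<nu>)"
    by (subst (2) nn_integral_multc) (auto simp: nn_integral_multc transl[of "?f"] measurable_If)
  also have "\<dots> = (\<integral>\<^sup>+x. (\<integral>\<^sup>+y. ?f (y + x) * ?k y \<partial>?\<nu>) \<partial>lborel)"
    by (rule Fubini') (simp add: split_beta', measurable)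
  also have "\<dots> = (\<integral>\<^sup>+x. (\<integral>\<^sup>+y. ?f y * ?k (y - x) \<partial>?\<nu>) \<partial>lborel)"
  proof (rule nn_integral_cong)
    fix x
    show "(\<integral>\<^sup>+y. ?f (y + x) * ?k y \<partial>?\<nu>) = (\<integral>\<^sup>+y. ?f y * ?k (y - x) \<partial>?\<nu>)"
      using transl\<nu>[of "\<lambda>y. ?f y * ?k (y - x)" x] by (simp add: add.commute)
  qed
  also have "\<dots> = (\<integral>\<^sup>+y. (\<integral>\<^sup>+x. ?f y * ?k (y - x) \<partial>lborel) \<partial>?\<nu>)"
    by (rule Fubini'[symmetric]) (simp add: split_beta', measurable)
  also have "\<dots> = (\<integral>\<^sup>+y. ?f y * emeasure lborel B \<partial>?\<nu>)"
  proof (rule nn_integral_cong)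
    fix y
    have "(\<integral>\<^sup>+x. ?k (y - x) \<partial>lborel) = (\<integral>\<^sup>+x. indicator (ball y 1) x \<partial>lborel)"
      by (intro nn_integral_cong) (auto simp: B_def dist_norm norm_minus_commute split: split_indicator)
    also have "\<dots> = emeasure lborel B"
      by (simp add: emeasure_ball B_def)
    finally show "(\<integral>\<^sup>+x. ?f y * ?k (y - x) \<partial>lborel) = ?f y * emeasure lborel B"
      by (simp add: nn_integral_cmult)
  qed
  also have "\<dots> = emeasure ?\<nu> X * emeasure lborel B"
    by (simp add: nn_integral_multc)
  finally have eq: "emeasure lborel X * emeasure lborel B = emeasure ?\<nu> X * emeasure lborel B"
    by (simp add: \<nu>B)
  have "emeasure lborel B \<noteq> 0" "emeasure lborel B \<noteq> top"
    using unit_ball_vol_pos[of "real DIM('v)"] by (simp_all add: emeasure_ball B_def del: unit_ball_vol_pos)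
  then show "emeasure ?\<nu> X = emeasure lborel X"
    using eq by (metis ennreal_mult_cancel_left mult.commute)
qed simp

section \<open>Translations, functions of compact support, and integrals of their
  derivatives\<close>

lemma lborel_integral_translate:
  fixes f :: "'v::euclidean_space \<Rightarrow> 'w::euclidean_space"
  assumes [measurable]: "f \<in> borel_measurable borel"
  shows "(\<integral>z. f (a + z) \<partial>lborel) = (\<integral>z. f z \<partial>lborel)"
  by (subst (2) lborel_distr_plus[of a, symmetric]) (simp add: integral_distr)

lemma lborel_integrable_translate:
  fixes f :: "'v::euclidean_space \<Rightarrow> 'w::euclidean_space"
  assumes "integrable lborel f"
  shows "integrable lborel (\<lambda>z. f (a + z))"
proof -
  have "integrable (distr lborel borel ((+) a)) f"
    using assms by (simp add: lborel_distr_plus)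
  then show ?thesis
    using borel_measurable_integrable[OF assms] by (subst (asm) integrable_distr_eq) auto
qed

lemma integrable_compact_support:
  fixes f :: "'v::euclidean_space \<Rightarrow> 'w::euclidean_space"
  assumes "compact K" "continuous_on K f" "\<And>z. z \<notin> K \<Longrightarrow> f z = 0"
  shows "integrable lborel f"
proof -
  have "(\<lambda>z. indicator K z *\<^sub>R f z) = f"
    using assms(3) by (auto simp: indicator_def)
  then show ?thesis using borel_integrable_compact[OF assms(1,2)] by simp
qed

lemma C1_compact_support:
  fixes \<psi> :: "'v::euclidean_space \<Rightarrow> 'w::euclidean_space"
  assumes "C1_on UNIV \<psi>" "compact K" "\<And>z. z \<notin> K \<Longrightarrow> \<psi> z = 0"
  shows "integrable lborel \<psi>" and "integrable lborel (\<lambda>z. frechet_derivative \<psi> (at z) a)"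
    and "\<exists>C. \<forall>z. norm (frechet_derivative \<psi> (at z) a) \<le> C"
    and "\<And>z. z \<notin> K \<Longrightarrow> frechet_derivative \<psi> (at z) a = 0"
proof -
  have *: "frechet_derivative \<psi> (at z) a = 0" if "z \<notin> K" for z
    using frechet_derivative_zero_off(2)[OF compact_imp_closed[OF assms(2)] assms(3) that] by simp
  have c: "continuous_on UNIV (\<lambda>z. frechet_derivative \<psi> (at z) a)"
    by (rule C1_on_continuous_deriv[OF assms(1)])
  show "integrable lborel \<psi>"
    by (rule integrable_compact_support[OF assms(2) _ assms(3)])
      (use C1_on_continuous[OF assms(1)] continuous_on_subset in blast)
  show "integrable lborel (\<lambda>z. frechet_derivative \<psi> (at z) a)"
    by (rule integrable_compact_support[OF assms(2) _ *])
      (use c continuous_on_subset in blast)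
  have "bounded ((\<lambda>z. frechet_derivative \<psi> (at z) a) ` K)"
    using assms(2) c continuous_on_subset by (intro compact_imp_bounded compact_continuous_image) blast+
  then obtain C where "\<forall>z\<in>K. norm (frechet_derivative \<psi> (at z) a) \<le> C"
    by (auto simp: bounded_iff)
  then show "\<exists>C. \<forall>z. norm (frechet_derivative \<psi> (at z) a) \<le> C"
    using * by (intro exI[of _ "max C 0"]) (metis max.cobounded2 max.coboundedI1 norm_zero)
qed (use frechet_derivative_zero_off(2)[OF compact_imp_closed[OF assms(2)] assms(3)] in auto)

lemma has_vector_derivative_along:
  assumes "C1_on X \<psi>" "z + s *\<^sub>R a \<in> X"
  shows "((\<lambda>s. \<psi> (z + s *\<^sub>R a)) has_vector_derivative frechet_derivative \<psi> (at (z + s *\<^sub>R a)) a) (at s within S)"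
proof -
  have "((\<lambda>s. \<psi> (z + s *\<^sub>R a)) has_derivative
      (\<lambda>h. frechet_derivative \<psi> (at (z + s *\<^sub>R a)) (h *\<^sub>R a))) (at s within S)"
    by (rule has_derivative_compose[where f="\<lambda>s. z + s *\<^sub>R a" and g=\<psi>, OF _ C1_on_has_derivative[OF assms]])
      (auto intro!: derivative_eq_intros)
  then show ?thesis
    using linear_cmul[OF has_derivative_linear[OF C1_on_has_derivative[OF assms]]]
    by (simp add: has_vector_derivative_def)
qed

text \<open>A sequence of increments, because dominated convergence is applied to sequences of
  difference quotients.\<close>

lemma vector_derivative_quotient_LIMSEQ:
  fixes f :: "real \<Rightarrow> 'w::real_normed_vector"
  assumes "(f has_vector_derivative d) (at 0)"
  shows "(\<lambda>n. real (Suc n) *\<^sub>R (f (1 / real (Suc n)) - f 0)) \<longlonglongrightarrow> d"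
proof -
  have "((\<lambda>h. norm (f (0 + h) - f 0 - h *\<^sub>R d) / norm h) \<longlongrightarrow> 0) (at 0)"
    using assms by (simp add: has_vector_derivative_def has_derivative_at)
  moreover have "filterlim (\<lambda>n. 1 / real (Suc n)) (at 0) sequentially"
    using LIMSEQ_inverse_real_of_nat
    by (intro filterlim_atI) (auto simp: inverse_eq_divide)
  ultimately have lim: "(\<lambda>n. norm (f (0 + 1 / real (Suc n)) - f 0 - (1 / real (Suc n)) *\<^sub>R d) / norm (1 / real (Suc n))) \<longlonglongrightarrow> 0"
    by (rule filterlim_compose)
  have "norm (f (0 + 1 / real (Suc n)) - f 0 - (1 / real (Suc n)) *\<^sub>R d) / norm (1 / real (Suc n))
      = norm (real (Suc n) *\<^sub>R (f (1 / real (Suc n)) - f 0) - d)" for n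
  proof -
    have "real (Suc n) *\<^sub>R (f (1 / real (Suc n)) - f 0) - d =
        real (Suc n) *\<^sub>R (f (0 + 1 / real (Suc n)) - f 0 - (1 / real (Suc n)) *\<^sub>R d)"
      by (simp add: scaleR_diff_right)
    then show ?thesis by simp
  qed
  with lim show ?thesis
    by (simp add: tendsto_norm_zero_iff LIM_zero_iff)
qed

text \<open>Each difference quotient integrates to 0 by translation invariance, as \<open>H\<close>
  is invariant along \<open>a\<close>; the derivative is their dominated limit. It serves for
  \<open>H = UNIV\<close>, and for the lower half space with a horizontal direction.\<close>

lemma integral_derivative_zero:
  fixes \<psi> :: "'v::euclidean_space \<Rightarrow> 'w::euclidean_space"
  assumes C1: "C1_on UNIV \<psi>" and K: "compact K" "\<And>z. z \<notin> K \<Longrightarrow> \<psi> z = 0"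
    and [measurable]: "H \<in> sets borel" and H: "\<And>z t. z + t *\<^sub>R a \<in> H \<longleftrightarrow> z \<in> H"
  shows "(\<integral>z. indicator H z *\<^sub>R frechet_derivative \<psi> (at z) a \<partial>lborel) = 0"
proof -
  define F where "F n z = indicator H z *\<^sub>R (real (Suc n) *\<^sub>R (\<psi> (z + (1 / real (Suc n)) *\<^sub>R a) - \<psi> z))" for n z
  obtain C where C: "\<And>z. norm (frechet_derivative \<psi> (at z) a) \<le> C"
    using C1_compact_support(3)[OF C1 K] by blast
  have C0: "C \<ge> 0" using C[of 0] norm_ge_zero order_trans by blast
  obtain R where R: "K \<subseteq> ball 0 R"
    using compact_imp_bounded[OF K(1)] bounded_subset_ballD by blast
  have \<psi>m[measurable]: "\<psi> \<in> borel_measurable borel"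
    by (intro borel_measurable_continuous_onI C1_on_continuous C1)
  have \<psi>i: "integrable lborel (\<lambda>z. indicator H z *\<^sub>R \<psi> z)"
    using C1_compact_support(1)[OF C1 K] by (intro integrable_mult_indicator) auto
  have Fint: "(\<integral>z. F n z \<partial>lborel) = 0" for n
  proof -
    let ?t = "(1 / real (Suc n)) *\<^sub>R a"
    have "F n z = real (Suc n) *\<^sub>R (indicator H (?t + z) *\<^sub>R \<psi> (?t + z) - indicator H z *\<^sub>R \<psi> z)" for z
      using H[of z "1 / real (Suc n)"] by (simp add: F_def add.commute indicator_def)
    moreover have "integrable lborel (\<lambda>z. indicator H (?t + z) *\<^sub>R \<psi> (?t + z))"
      using lborel_integrable_translate[OF \<psi>i] .
    moreover have "(\<integral>z. indicator H (?t + z) *\<^sub>R \<psi> (?t + z) \<partial>lborel) = (\<integral>z. indicator H z *\<^sub>R \<psi> z \<partial>lborel)"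
      by (rule lborel_integral_translate) measurable
    ultimately show ?thesis
      using \<psi>i by simp
  qed
  have "(\<lambda>n. \<integral>z. F n z \<partial>lborel) \<longlonglongrightarrow> (\<integral>z. indicator H z *\<^sub>R frechet_derivative \<psi> (at z) a \<partial>lborel)"
  \<comment> \<open>The mean value theorem bounds the quotients by \<open>C\<close>; increments of
    length at most \<open>norm a\<close> keep their supports within radius
    \<open>R + norm a\<close>.\<close>
  proof (rule integral_dominated_convergence[where w="\<lambda>z. C * indicator (cball 0 (R + norm a)) z"])
    show "(\<lambda>z. indicator H z *\<^sub>R frechet_derivative \<psi> (at z) a) \<in> borel_measurable lborel"
      using C1_compact_support(2)[OF C1 K] by (intro borel_measurable_scaleR) auto
    show "F n \<in> borel_measurable lborel" for n
      unfolding F_def by measurable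
    show "integrable lborel (\<lambda>z. C * indicator (cball (0::'v) (R + norm a)) z)"
      using emeasure_compact_finite[of "cball (0::'v) (R + norm a)"] by (intro integrable_mult_right) auto
    show "AE z in lborel. (\<lambda>n. F n z) \<longlonglongrightarrow> indicator H z *\<^sub>R frechet_derivative \<psi> (at z) a"
    proof (rule AE_I2)
      fix z
      have "((\<lambda>s. \<psi> (z + s *\<^sub>R a)) has_vector_derivative frechet_derivative \<psi> (at z) a) (at 0)"
        using has_vector_derivative_along[OF C1, of z 0 a UNIV] by simp
      from vector_derivative_quotient_LIMSEQ[OF this]
      show "(\<lambda>n. F n z) \<longlonglongrightarrow> indicator H z *\<^sub>R frechet_derivative \<psi> (at z) a"
        unfolding F_def by (intro tendsto_intros) simp
    qed
    show "AE z in lborel. norm (F n z) \<le> C * indicator (cball 0 (R + norm a)) z" for n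
    proof (rule AE_I2)
      fix z
      let ?t = "1 / real (Suc n)"
      show "norm (F n z) \<le> C * indicator (cball 0 (R + norm a)) z"
      proof (cases "z \<in> cball 0 (R + norm a)")
        case True
        have "norm (\<psi> (z + ?t *\<^sub>R a) - \<psi> (z + 0 *\<^sub>R a)) \<le> C * norm (?t - 0)"
        proof (rule differentiable_bound[where S=UNIV and f'="\<lambda>s h. h *\<^sub>R frechet_derivative \<psi> (at (z + s *\<^sub>R a)) a"])
          show "((\<lambda>s. \<psi> (z + s *\<^sub>R a)) has_derivative (\<lambda>h. h *\<^sub>R frechet_derivative \<psi> (at (z + s *\<^sub>R a)) a)) (at s within UNIV)" for s
            using has_vector_derivative_along[OF C1] by (auto simp: has_vector_derivative_def)
          show "onorm (\<lambda>h. h *\<^sub>R frechet_derivative \<psi> (at (z + s *\<^sub>R a)) a) \<le> C" for s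
            by (rule onorm_le) (use C[of "z + s *\<^sub>R a"] in \<open>auto simp: mult.commute[of C] intro: mult_left_mono\<close>)
        qed auto
        then have "real (Suc n) * norm (\<psi> (z + ?t *\<^sub>R a) - \<psi> z) \<le> C"
          by (simp add: field_simps)
        then show ?thesis
          using True C0 by (simp add: F_def indicator_def)
      next
        case False
        have "?t * norm a \<le> 1 * norm a" by (intro mult_right_mono) auto
        then have "norm (?t *\<^sub>R a) \<le> norm a" by simp
        then have "norm (z + ?t *\<^sub>R a) > R"
          using False norm_diff_ineq[of z "?t *\<^sub>R a"] by (simp add: not_le)
        moreover have "norm z > R" using False norm_ge_zero[of a] by (simp add: not_le del: norm_ge_zero)
        ultimately have "z + ?t *\<^sub>R a \<notin> K" "z \<notin> K" using R by auto
        then show ?thesis using K(2) False by (simp add: F_def)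
      qed
    qed
  qed
  then show ?thesis
    by (simp add: Fint LIMSEQ_const_iff)
qed

section \<open>The divergence theorem under a graph\<close>

lemma halfline_FTC:
  fixes \<xi> :: "real \<Rightarrow> 'w::euclidean_space"
  assumes d: "\<And>t. (\<xi> has_vector_derivative \<xi>' t) (at t)" and c: "continuous_on UNIV \<xi>'"
    and R: "R \<ge> 0" and z: "\<And>t. t \<le> - R \<Longrightarrow> \<xi> t = 0" "\<And>t. t < - R \<Longrightarrow> \<xi>' t = 0"
  shows "(\<integral>t. indicator {..<0} t *\<^sub>R \<xi>' t \<partial>lborel) = \<xi> 0"
proof -
  have "(\<integral>t. indicator {..<0} t *\<^sub>R \<xi>' t \<partial>lborel) = (\<integral>t. indicator {-R..0} t *\<^sub>R \<xi>' t \<partial>lborel)"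
  proof (rule integral_cong_AE)
    have [measurable]: "\<xi>' \<in> borel_measurable borel" by (rule borel_measurable_continuous_onI[OF c])
    show "(\<lambda>t. indicator {..<0} t *\<^sub>R \<xi>' t) \<in> borel_measurable lborel"
      "(\<lambda>t. indicator {-R..0} t *\<^sub>R \<xi>' t) \<in> borel_measurable lborel" by measurable
    show "AE t in lborel. indicator {..<0} t *\<^sub>R \<xi>' t = indicator {-R..0} t *\<^sub>R \<xi>' t"
      using AE_lborel_singleton[of 0] by eventually_elim (auto simp: indicator_def z(2))
  qed
  also have "\<dots> = \<xi> 0 - \<xi> (- R)"
  proof (rule integral_FTC_atLeastAtMost)
    show "- R \<le> 0" using R by simp
    show "(\<xi> has_vector_derivative \<xi>' x) (at x within {-R..0})" for x
      by (rule has_vector_derivative_at_within[OF d])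
    show "continuous_on {-R..0} \<xi>'" using c continuous_on_subset by blast
  qed
  finally show ?thesis using z(1)[of "-R"] by simp
qed

text \<open>Straightening the boundary by the volume preserving shear \<open>(u, t) \<mapsto> (u, g u + t)\<close> leaves a
  half space: the tangential derivative integrates to \<open>0\<close> and the normal one to the boundary term.\<close>

lemma hypograph_derivative_integral:
  fixes \<psi> :: "'v::euclidean_space \<times> real \<Rightarrow> 'w::euclidean_space"
  assumes C1: "C1_on UNIV \<psi>" and K: "compact K" "\<And>z. z \<notin> K \<Longrightarrow> \<psi> z = 0"
    and g: "C1_gradient V g g'" and Hm[measurable]: "H \<in> sets borel"
    and H: "\<And>u s. (u, s) \<in> K \<Longrightarrow> u \<in> V \<and> ((u, s) \<in> H \<longleftrightarrow> s < g u)"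
  shows "integrable lborel (\<lambda>u. indicator V u *\<^sub>R ((b - g' u \<bullet> a) *\<^sub>R \<psi> (u, g u)))" (is "integrable _ ?I2")
    and "(\<integral>z. indicator H z *\<^sub>R frechet_derivative \<psi> (at z) (a, b) \<partial>lborel) =
         (\<integral>u. indicator V u *\<^sub>R ((b - g' u \<bullet> a) *\<^sub>R \<psi> (u, g u)) \<partial>lborel)"
proof -
  define \<psi>' where "\<psi>' z = frechet_derivative \<psi> (at z)" for z
  have V: "open V" and g'c: "continuous_on V g'"
    and gd: "\<And>u. u \<in> V \<Longrightarrow> (g has_derivative (\<lambda>h. g' u \<bullet> h)) (at u)"
    using g by (auto simp: C1_gradient_def)
  have gc: "continuous_on V g"
    using gd by (meson continuous_at_imp_continuous_on has_derivative_continuous)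
  have \<psi>d: "(\<psi> has_derivative \<psi>' z) (at z)" for z
    unfolding \<psi>'_def by (rule C1_on_has_derivative[OF C1]) simp
  have \<psi>'0: "\<psi>' z v = 0" if "z \<notin> K" for z v
    unfolding \<psi>'_def by (rule C1_compact_support(4)[OF C1 K that])
  have \<psi>'c: "continuous_on UNIV (\<lambda>z. \<psi>' z v)" for v
    unfolding \<psi>'_def by (rule C1_on_continuous_deriv[OF C1])
  have lin: "linear (\<psi>' z)" for z using \<psi>d has_derivative_linear by blast
  have split: "\<psi>' z (a, c) = \<psi>' z (a, 0) + c *\<^sub>R \<psi>' z (0, 1)" for z a c
    using linear_add[OF lin, of z "(a,0)" "c *\<^sub>R (0,1)"] linear_cmul[OF lin, of z c "(0,1)"] by simp
  define P where "P = fst ` K"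
  have P: "compact P" "P \<subseteq> V"
    using K(1) H by (force simp: P_def intro!: compact_continuous_image continuous_intros)+
  have KP: "(u, s) \<notin> K" if "u \<notin> P" for u s
    using that by (force simp: P_def)
  \<comment> \<open>\<open>\<phi>\<close> is \<open>\<psi>\<close> in sheared coordinates, of use
    only over \<open>V\<close>, where \<open>g\<close> is controlled; \<open>\<psi>h\<close> is its
    extension by zero.\<close>
  define \<phi> where "\<phi> z = \<psi> (fst z, g (fst z) + snd z)" for z
  define \<psi>h where "\<psi>h z = (if z \<in> V \<times> UNIV then \<phi> z else 0)" for z
  let ?G = "\<lambda>z. (fst z, g (fst z) + snd z)"
  have \<phi>d: "(\<phi> has_derivative (\<lambda>h. \<psi>' (?G z) (fst h, g' (fst z) \<bullet> fst h + snd h))) (at z)"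
    if "z \<in> V \<times> UNIV" for z
    unfolding \<phi>_def
  proof (rule has_derivative_compose[where f="?G" and g=\<psi>, OF _ \<psi>d])
    have "fst z \<in> V" using that by auto
    then have "((\<lambda>z. g (fst z)) has_derivative (\<lambda>h. g' (fst z) \<bullet> fst h)) (at z)"
      by (intro has_derivative_compose[where f=fst and g=g, OF _ gd]) (auto intro!: derivative_intros)
    then show "(?G has_derivative (\<lambda>h. (fst h, g' (fst z) \<bullet> fst h + snd h))) (at z)"
      by (auto intro!: derivative_intros)
  qed
  have C1\<phi>: "C1_on (V \<times> UNIV) \<phi>"
  proof (rule C1_onI[OF \<phi>d])
    fix v :: "'v \<times> real"
    have Gc: "continuous_on (V \<times> UNIV) ?G"
      by (intro continuous_intros continuous_on_compose2[OF gc]) auto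
    show "continuous_on (V \<times> UNIV) (\<lambda>z. \<psi>' (?G z) (fst v, g' (fst z) \<bullet> fst v + snd v))"
      \<comment> \<open>Continuity of the derivative is known in fixed directions only, so the
        component that varies with the point is moved out as a scalar factor.\<close>
      unfolding split[of _ "fst v" "g' _ \<bullet> _ + _"]
      by (intro continuous_intros continuous_on_compose2[OF \<psi>'c Gc] continuous_on_compose2[OF g'c]) auto
  qed
  have \<psi>h0: "\<psi>h z = 0" if "z \<notin> P \<times> UNIV" for z
    using that KP K(2) by (cases z) (auto simp: \<psi>h_def \<phi>_def)
  have closedP: "closed (P \<times> (UNIV :: real set))"
    using compact_imp_closed[OF P(1)] by (intro closed_Times) auto
  have C1h: "C1_on UNIV \<psi>h"
    unfolding \<psi>h_def[abs_def]
  proof (rule C1_on_extend_zero[OF C1\<phi> _ closedP])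
    show "\<phi> z = 0" if "z \<in> V \<times> UNIV" "z \<notin> P \<times> UNIV" for z
      using \<psi>h0[OF that(2)] that(1) by (simp add: \<psi>h_def)
  qed (use V P in \<open>auto intro: open_Times\<close>)
  \<comment> \<open>The image of \<open>K\<close> under the inverse shear. It supplies compact
    support; the set \<open>P \<times> UNIV\<close> used for the extension is merely closed.\<close>
  define Kh where "Kh = (\<lambda>z. (fst z, snd z - g (fst z))) ` K"
  have Kh: "compact Kh"
    unfolding Kh_def using H
    by (intro compact_continuous_image K continuous_intros continuous_on_compose2[OF gc]) force+
  have Kh0: "\<psi>h z = 0" if "z \<notin> Kh" for z
  proof (rule ccontr)
    assume "\<psi>h z \<noteq> 0"
    then have "?G z \<in> K" using K(2) by (auto simp: \<psi>h_def \<phi>_def split: if_splits)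
    then have "z \<in> Kh" unfolding Kh_def by (intro image_eqI[where x="?G z"]) auto
    with that show False by simp
  qed
  define \<psi>h' where "\<psi>h' z = frechet_derivative \<psi>h (at z)" for z
  have \<psi>h'_eq: "\<psi>h' z = (\<lambda>h. \<psi>' (?G z) (fst h, g' (fst z) \<bullet> fst h + snd h))" if "z \<in> V \<times> UNIV" for z
  proof -
    have "\<psi>h' z = frechet_derivative \<phi> (at z)"
      unfolding \<psi>h'_def
      by (rule frechet_derivative_eq_on_open[of "V \<times> UNIV"]) (use V that in \<open>auto intro: open_Times simp: \<psi>h_def\<close>)
    then show ?thesis using frechet_derivative_at[OF \<phi>d[OF that]] by simp
  qed
  have \<psi>h'0: "\<psi>h' z v = 0" if "z \<notin> P \<times> UNIV" for z v
    unfolding \<psi>h'_def using frechet_derivative_zero_off(2)[OF closedP \<psi>h0 that] by simp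
  have \<psi>h'Kh: "\<psi>h' z v = 0" if "z \<notin> Kh" for z v
    unfolding \<psi>h'_def by (rule C1_compact_support(4)[OF C1h Kh Kh0 that])
  have \<psi>h'c: "continuous_on UNIV (\<lambda>z. \<psi>h' z v)" for v
    unfolding \<psi>h'_def by (rule C1_on_continuous_deriv[OF C1h])
  obtain R where R: "R > 0" "Kh \<subseteq> ball 0 R"
    using bounded_subset_ballD[OF compact_imp_bounded[OF Kh]] by blast
  have Rt: "(u, t) \<notin> Kh" if "\<bar>t\<bar> \<ge> R" for u t
  proof
    assume "(u, t) \<in> Kh"
    then have "norm (u, t) < R" using R by auto
    then show False using norm_snd_le[of t u] that by simp
  qed

  show I2: "integrable lborel ?I2"
  proof (rule integrable_compact_support[OF P(1)])
    have "continuous_on P (\<lambda>u. (b - g' u \<bullet> a) *\<^sub>R \<psi> (u, g u))"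
      using P(2) by (intro continuous_intros continuous_on_subset[OF g'c] continuous_on_subset[OF gc]
          continuous_on_compose2[OF C1_on_continuous[OF C1]]) auto
    then show "continuous_on P ?I2"
      using P(2) by (subst continuous_on_cong[OF refl]) auto
    show "?I2 z = 0" if "z \<notin> P" for z
      using K(2)[OF KP[OF that]] by simp
  qed

  \<comment> \<open>The tangential contribution on the vertical line over \<open>u\<close>. It need
    not vanish for a single \<open>u\<close>; only its integral over all \<open>u\<close> does, by
    Fubini.\<close>
  define I1 where "I1 u = (\<integral>t. indicator {..<0} t *\<^sub>R \<psi>h' (u, t) (a, 0) \<partial>lborel)" for u
  let ?F1 = "\<lambda>z. indicator {z. snd z < 0} z *\<^sub>R \<psi>h' z (a, 0)"
  have Hlow: "{z :: 'v \<times> real. snd z < 0} \<in> sets borel"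
    by (intro borel_open open_Collect_less continuous_intros)
  have F1: "(\<integral>z. ?F1 z \<partial>lborel) = 0"
    unfolding \<psi>h'_def
    by (rule integral_derivative_zero[OF C1h Kh Kh0]) (simp_all add: Hlow)
  have "integrable lborel ?F1"
    unfolding \<psi>h'_def using C1_compact_support(2)[OF C1h Kh Kh0] Hlow by (intro integrable_mult_indicator) auto
  then have F1i: "integrable (lborel \<Otimes>\<^sub>M lborel) ?F1" by (simp add: lborel_prod)
  have I1_eq: "I1 u = (\<integral>t. ?F1 (u, t) \<partial>lborel)" for u
    unfolding I1_def by (intro Bochner_Integration.integral_cong) (auto simp: indicator_def)
  have I1i: "integrable lborel I1"
    using lborel_pair.integrable_fst'[OF F1i] by (simp add: I1_eq[abs_def])
  have I10: "(\<integral>u. I1 u \<partial>lborel) = 0"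
    using lborel_pair.integral_fst'[OF F1i] F1 by (simp add: I1_eq[abs_def] lborel_prod)

  let ?F2 = "\<lambda>z. indicator H z *\<^sub>R \<psi>' z (a, b)"
  have "integrable lborel ?F2"
    unfolding \<psi>'_def using C1_compact_support(2)[OF C1 K] by (intro integrable_mult_indicator) auto
  then have F2i: "integrable (lborel \<Otimes>\<^sub>M lborel) ?F2" by (simp add: lborel_prod)
  have J: "(\<integral>s. ?F2 (u, s) \<partial>lborel) = I1 u + ?I2 u" for u
  proof (cases "u \<in> V")
    case False
    then have "(u, s) \<notin> K" for s using H by blast
    moreover have "(u, t) \<notin> P \<times> UNIV" for t using False P(2) by auto
    ultimately show ?thesis using False by (simp add: I1_def \<psi>'0 \<psi>h'0)
  next
    case True
    have cu: "continuous_on S (\<lambda>t. \<psi>h' (u, t) v)" for v S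
      by (rule continuous_on_compose2[OF \<psi>h'c]) (auto intro!: continuous_intros)
    have cu': "continuous_on UNIV (\<lambda>t. \<psi>' (u, t) v)" for v
      by (rule continuous_on_compose2[OF \<psi>'c]) (auto intro!: continuous_intros)
    have [measurable]: "(\<lambda>t. \<psi>' (u, t) v) \<in> borel_measurable borel" for v
      by (rule borel_measurable_continuous_onI[OF cu'])
    have int: "integrable lborel (\<lambda>t. indicator {..<0} t *\<^sub>R \<psi>h' (u, t) v)" for v
    proof (rule integrable_mult_indicator)
      show "integrable lborel (\<lambda>t. \<psi>h' (u, t) v)"
        by (rule integrable_compact_support[of "cball 0 R", OF _ cu])
          (auto intro!: \<psi>h'Kh Rt)
    qed auto
    have "(\<integral>s. ?F2 (u, s) \<partial>lborel) = (\<integral>s. indicator {..<g u} s *\<^sub>R \<psi>' (u, s) (a, b) \<partial>lborel)"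
    proof (intro Bochner_Integration.integral_cong refl)
      fix s show "?F2 (u, s) = indicator {..<g u} s *\<^sub>R \<psi>' (u, s) (a, b)"
        using H[of u s] \<psi>'0[of "(u,s)"] by (cases "(u, s) \<in> K") (auto simp: indicator_def)
    qed
    also have "\<dots> = (\<integral>t. indicator {..<g u} (g u + t) *\<^sub>R \<psi>' (u, g u + t) (a, b) \<partial>lborel)"
      by (rule lborel_integral_translate[symmetric]) measurable
    also have "\<dots> = (\<integral>t. indicator {..<0} t *\<^sub>R \<psi>h' (u, t) (a, 0)
        + (b - g' u \<bullet> a) *\<^sub>R (indicator {..<0} t *\<^sub>R \<psi>h' (u, t) (0, 1)) \<partial>lborel)"
    proof (intro Bochner_Integration.integral_cong refl)
      fix t
      \<comment> \<open>Undoing the shear turns the direction \<open>(a, b)\<close> into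
        \<open>(a, b - g' u \<bullet> a)\<close>. The last component does not depend on
        \<open>t\<close>, so it leaves the integral along the line.\<close>
      have "\<psi>h' (u, t) (a, 0) + (b - g' u \<bullet> a) *\<^sub>R \<psi>h' (u, t) (0, 1) = \<psi>' (u, g u + t) (a, b)"
        using True split[of _ a b] split[of _ a "g' u \<bullet> a"] by (simp add: \<psi>h'_eq algebra_simps)
      then show "indicator {..<g u} (g u + t) *\<^sub>R \<psi>' (u, g u + t) (a, b) =
          indicator {..<0} t *\<^sub>R \<psi>h' (u, t) (a, 0)
        + (b - g' u \<bullet> a) *\<^sub>R (indicator {..<0} t *\<^sub>R \<psi>h' (u, t) (0, 1))"
        by (simp add: indicator_def)
    qed
    also have "\<dots> = I1 u + (b - g' u \<bullet> a) *\<^sub>R (\<integral>t. indicator {..<0} t *\<^sub>R \<psi>h' (u, t) (0, 1) \<partial>lborel)"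
      using int by (simp add: I1_def del: scaleR_scaleR)
    also have "(\<integral>t. indicator {..<0} t *\<^sub>R \<psi>h' (u, t) (0, 1) \<partial>lborel) = \<psi>h (u, 0)"
    proof (rule halfline_FTC[where R=R])
      show "((\<lambda>t. \<psi>h (u, t)) has_vector_derivative \<psi>h' (u, t) (0, 1)) (at t)" for t
        using has_vector_derivative_along[OF C1h, of "(u, 0)" t "(0, 1)" UNIV] by (simp add: \<psi>h'_def)
      show "continuous_on UNIV (\<lambda>t. \<psi>h' (u, t) (0, 1))" by (rule cu)
    qed (use R in \<open>auto intro!: Kh0 \<psi>h'Kh Rt\<close>)
    also have "\<psi>h (u, 0) = \<psi> (u, g u)" using True by (simp add: \<psi>h_def \<phi>_def)
    finally show ?thesis using True by simp
  qed
  have "(\<integral>z. ?F2 z \<partial>lborel) = (\<integral>u. (\<integral>s. ?F2 (u, s) \<partial>lborel) \<partial>lborel)"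
    using lborel_pair.integral_fst'[OF F2i] by (simp add: lborel_prod)
  also have "\<dots> = (\<integral>u. I1 u + ?I2 u \<partial>lborel)" by (simp only: J)
  also have "\<dots> = (\<integral>u. ?I2 u \<partial>lborel)" using I1i I2 I10 by simp
  finally show "(\<integral>z. indicator H z *\<^sub>R frechet_derivative \<psi> (at z) (a, b) \<partial>lborel) = (\<integral>u. ?I2 u \<partial>lborel)"
    by (simp add: \<psi>'_def)
qed

text \<open>\<open>T\<close> preserves \<open>lborel\<close>, so substituting it reduces to the
  unrotated case. With \<open>v = T (a, b)\<close> the factor \<open>b - g' u \<bullet> a\<close>
  becomes the inner product of \<open>T (- g' u, 1)\<close> and \<open>v\<close>, free of the
  coordinates of \<open>v\<close>.\<close>

lemma rotated_hypograph_derivative_integral: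
  fixes \<phi> :: "'v::euclidean_space \<times> real \<Rightarrow> 'w::euclidean_space" and V :: "'v set"
  assumes C1: "C1_on UNIV \<phi>" and K: "compact K" "\<And>z. z \<notin> K \<Longrightarrow> \<phi> z = 0"
    and g: "C1_gradient V g g'" and T: "orthogonal_transformation T" and [measurable]: "G \<in> sets borel"
    and G: "\<And>u s. T (u, s) \<in> K \<Longrightarrow> u \<in> V \<and> (T (u, s) \<in> G \<longleftrightarrow> s < g u)"
  shows "integrable lborel (\<lambda>u. indicator V u *\<^sub>R ((T (- g' u, 1) \<bullet> v) *\<^sub>R \<phi> (T (u, g u))))"
    and "(\<integral>z. indicator G z *\<^sub>R frechet_derivative \<phi> (at z) v \<partial>lborel) =
         (\<integral>u. indicator V u *\<^sub>R ((T (- g' u, 1) \<bullet> v) *\<^sub>R \<phi> (T (u, g u))) \<partial>lborel)"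
proof -
  have lin: "linear T" using T by (rule orthogonal_transformation_linear)
  have bl: "bounded_linear T" using lin linear_conv_bounded_linear by blast
  have Tc: "continuous_on S T" for S using bl by (rule linear_continuous_on)
  have [measurable]: "T \<in> borel \<rightarrow>\<^sub>M borel" by (rule borel_measurable_continuous_onI[OF Tc])
  obtain a b where v: "v = T (a, b)"
    using orthogonal_transformation_surj[OF T] by (metis prod.collapse surjD)
  have inner: "T (- g' u, 1) \<bullet> v = b - g' u \<bullet> a" for u
    using T by (simp add: v orthogonal_transformation_def inner_prod_def)
  have d: "((\<lambda>z. \<phi> (T z)) has_derivative (\<lambda>h. frechet_derivative \<phi> (at (T z)) (T h))) (at z)" for z
    by (rule has_derivative_compose[where f=T and g=\<phi>, OF bounded_linear_imp_has_derivative[OF bl] C1_on_has_derivative[OF C1]]) simp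
  have C1': "C1_on UNIV (\<lambda>z. \<phi> (T z))"
    by (rule C1_onI[OF d]) (auto intro!: continuous_on_compose2[OF C1_on_continuous_deriv[OF C1] Tc])
  have bij: "bij T" using orthogonal_transformation_bij[OF T] .
  let ?K = "inv T ` K"
  have K': "compact ?K"
  proof -
    have "orthogonal_transformation (inv T)"
      using T by (rule orthogonal_transformation_inv)
    then have "bounded_linear (inv T)"
      using orthogonal_transformation_linear linear_conv_bounded_linear by blast
    then show ?thesis by (intro compact_continuous_image K linear_continuous_on)
  qed
  have K'_iff: "z \<in> ?K \<longleftrightarrow> T z \<in> K" for z
  proof
    show "T z \<in> K" if "z \<in> ?K"
      using that bij by (auto simp: bij_is_surj surj_f_inv_f)
    show "z \<in> ?K" if "T z \<in> K"
      using that bij by (intro image_eqI[of _ _ "T z"]) (auto simp: bij_is_inj inv_f_f)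
  qed
  have Hm: "T -` G \<in> sets borel"
    using measurable_sets[of T borel borel G] by simp
  note res = hypograph_derivative_integral[OF C1' K' _ g Hm, where a=a and b=b]
  have "\<phi> (T z) = 0" if "z \<notin> ?K" for z using that K(2) by (simp add: K'_iff)
  note res = res[OF this]
  have "u \<in> V \<and> ((u, s) \<in> T -` G \<longleftrightarrow> s < g u)" if "(u, s) \<in> ?K" for u s
    using that G by (simp add: K'_iff)
  note res = res[OF _ this]
  show "integrable lborel (\<lambda>u. indicator V u *\<^sub>R ((T (- g' u, 1) \<bullet> v) *\<^sub>R \<phi> (T (u, g u))))"
    using res(1) by (simp add: inner)
  have [measurable]: "(\<lambda>z. frechet_derivative \<phi> (at z) v) \<in> borel_measurable borel"
    by (rule borel_measurable_continuous_onI[OF C1_on_continuous_deriv[OF C1]])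
  have "(\<integral>z. indicator G z *\<^sub>R frechet_derivative \<phi> (at z) v \<partial>lborel)
      = (\<integral>z. indicator G z *\<^sub>R frechet_derivative \<phi> (at z) v \<partial>distr lborel borel T)"
    by (simp add: lborel_orthogonal[OF T])
  also have "\<dots> = (\<integral>z. indicator G (T z) *\<^sub>R frechet_derivative \<phi> (at (T z)) v \<partial>lborel)"
    by (rule integral_distr) measurable
  also have "\<dots> = (\<integral>z. indicator (T -` G) z *\<^sub>R frechet_derivative (\<lambda>z. \<phi> (T z)) (at z) (a, b) \<partial>lborel)"
    by (simp add: v indicator_def flip: frechet_derivative_at[OF d])
  also have "\<dots> = (\<integral>u. indicator V u *\<^sub>R ((T (- g' u, 1) \<bullet> v) *\<^sub>R \<phi> (T (u, g u))) \<partial>lborel)"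
    using res(2) by (simp add: inner)
  finally show "(\<integral>z. indicator G z *\<^sub>R frechet_derivative \<phi> (at z) v \<partial>lborel) =
         (\<integral>u. indicator V u *\<^sub>R ((T (- g' u, 1) \<bullet> v) *\<^sub>R \<phi> (T (u, g u))) \<partial>lborel)" .
qed

section \<open>Boundary charts\<close>

text \<open>In the coordinates \<open>(u, s) \<mapsto> T (u, s)\<close> the hypograph of \<open>g\<close> is \<open>{z. height T g z < 0}\<close>, and \<open>normal T g'\<close>
  is the gradient of \<open>height T g\<close>.\<close>

definition base :: "('v::euclidean_space \<times> real \<Rightarrow> 'v \<times> real) \<Rightarrow> 'v \<times> real \<Rightarrow> 'v" where
  "base T z = fst (inv T z)"

definition height :: "('v::euclidean_space \<times> real \<Rightarrow> 'v \<times> real) \<Rightarrow> ('v \<Rightarrow> real) \<Rightarrow> 'v \<times> real \<Rightarrow> real" where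
  "height T g z = snd (inv T z) - g (base T z)"

definition lift :: "('v::euclidean_space \<times> real \<Rightarrow> 'v \<times> real) \<Rightarrow> ('v \<Rightarrow> real) \<Rightarrow> 'v \<Rightarrow> 'v \<times> real" where
  "lift T g u = T (u, g u)"

definition normal :: "('v::euclidean_space \<times> real \<Rightarrow> 'v \<times> real) \<Rightarrow> ('v \<Rightarrow> 'v) \<Rightarrow> 'v \<times> real \<Rightarrow> 'v \<times> real" where
  "normal T g' z = T (- g' (base T z), 1)"

definition unit_normal :: "('v::euclidean_space \<times> real \<Rightarrow> 'v \<times> real) \<Rightarrow> ('v \<Rightarrow> 'v) \<Rightarrow> 'v \<times> real \<Rightarrow> 'v \<times> real" where
  "unit_normal T g' z = normal T g' z /\<^sub>R norm (normal T g' z)"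

lemma orthogonal_inv:
  fixes T :: "'a::euclidean_space \<Rightarrow> 'a"
  assumes "orthogonal_transformation T"
  shows "T (inv T z) = z" "inv T (T z) = z" "bounded_linear T" "bounded_linear (inv T)"
    "T x \<bullet> z = x \<bullet> inv T z" "T x \<bullet> T y = x \<bullet> y"
proof -
  show 1: "T (inv T z) = z" "inv T (T z) = z"
    using orthogonal_transformation_bij[OF assms] by (auto simp: bij_is_surj surj_f_inv_f bij_is_inj)
  show "bounded_linear T" "bounded_linear (inv T)"
    using assms orthogonal_transformation_inv[OF assms] orthogonal_transformation_linear
      linear_conv_bounded_linear by blast+
  show 2: "T x \<bullet> T y = x \<bullet> y" for x y
    using assms by (simp add: orthogonal_transformation_def)
  show "T x \<bullet> z = x \<bullet> inv T z"
    using 2[of x "inv T z"] by (simp add: 1)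
qed

lemma base_T: "orthogonal_transformation T \<Longrightarrow> base T (T (u, s)) = u"
  by (simp add: base_def orthogonal_inv)

lemma height_T: "orthogonal_transformation T \<Longrightarrow> height T g (T (u, s)) = s - g u"
  by (simp add: height_def base_def orthogonal_inv)

lemma base_lift: "orthogonal_transformation T \<Longrightarrow> base T (lift T g u) = u"
  by (simp add: lift_def base_T)

lemma height_lift: "orthogonal_transformation T \<Longrightarrow> height T g (lift T g u) = 0"
  by (simp add: lift_def height_T)

lemma lift_base:
  assumes "orthogonal_transformation T" "height T g z = 0"
  shows "lift T g (base T z) = z"
proof -
  have "(fst (inv T z), g (fst (inv T z))) = inv T z"
    using assms(2) by (simp add: height_def base_def prod_eq_iff)
  then show ?thesis by (simp add: lift_def base_def orthogonal_inv[OF assms(1)])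
qed

lemma continuous_base: "orthogonal_transformation T \<Longrightarrow> continuous_on S (base T)"
  unfolding base_def[abs_def] by (intro continuous_intros linear_continuous_on orthogonal_inv)

lemma norm_normal:
  "orthogonal_transformation T \<Longrightarrow> norm (normal T g' z) = sqrt (1 + (norm (g' (base T z)))\<^sup>2)"
  using orthogonal_transformation_norm[of T "(- g' (base T z), 1)"]
  by (simp add: normal_def norm_prod_def[of "(_, _)"] add.commute)

lemma norm_normal_pos: "orthogonal_transformation T \<Longrightarrow> norm (normal T g' z) > 0"
  unfolding norm_normal by (simp add: add_pos_nonneg)

lemma norm_unit_normal: "orthogonal_transformation T \<Longrightarrow> norm (unit_normal T g' z) = 1"
  using norm_normal_pos[of T g' z] by (simp add: unit_normal_def)

lemma unit_normal_inner: "unit_normal T g' z \<bullet> d = (normal T g' z \<bullet> d) / norm (normal T g' z)"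
  unfolding unit_normal_def inner_scaleR_left by (simp add: field_simps)

lemma open_base_vimage: "orthogonal_transformation T \<Longrightarrow> open V \<Longrightarrow> open {z. base T z \<in> V}"
  using open_vimage[OF _ continuous_base[of T UNIV], of V] by (simp add: vimage_def)

lemma C1_gradient_continuous: "C1_gradient V g g' \<Longrightarrow> continuous_on V g"
  by (auto simp: C1_gradient_def intro!: continuous_at_imp_continuous_on has_derivative_continuous)

lemma continuous_lift:
  assumes T: "orthogonal_transformation T" and g: "C1_gradient V g g'"
  shows "continuous_on V (lift T g)"
proof -
  have "continuous_on V (\<lambda>u. (u, g u))"
    by (intro continuous_intros C1_gradient_continuous[OF g])
  then show ?thesis
    unfolding lift_def[abs_def]
    by (rule continuous_on_compose2[OF linear_continuous_on[OF orthogonal_inv(3)[OF T]]]) auto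
qed

lemma continuous_normal:
  assumes T: "orthogonal_transformation T" and g: "C1_gradient V g g'"
  shows "continuous_on {z. base T z \<in> V} (normal T g')"
proof -
  have "continuous_on {z. base T z \<in> V} (\<lambda>z. g' (base T z))"
    using g by (intro continuous_on_compose2[OF _ continuous_base[OF T]]) (auto simp: C1_gradient_def)
  then have "continuous_on {z. base T z \<in> V} (\<lambda>z. (- g' (base T z), 1::real))"
    by (intro continuous_intros)
  then show ?thesis
    unfolding normal_def[abs_def]
    by (rule continuous_on_compose2[OF linear_continuous_on[OF orthogonal_inv(3)[OF T]]]) auto
qed

lemma height_has_derivative:
  assumes T: "orthogonal_transformation T" and g: "C1_gradient V g g'" and z: "base T z \<in> V"
  shows "(height T g has_derivative (\<lambda>h. normal T g' z \<bullet> h)) (at z)"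
proof -
  have i: "(inv T has_derivative inv T) (at z)"
    by (rule bounded_linear_imp_has_derivative[OF orthogonal_inv(4)[OF T]])
  have "((\<lambda>z. g (fst (inv T z))) has_derivative (\<lambda>h. g' (fst (inv T z)) \<bullet> fst (inv T h))) (at z)"
    using g z by (intro has_derivative_compose[where f="\<lambda>z. fst (inv T z)" and g=g])
      (auto intro!: derivative_eq_intros i simp: C1_gradient_def base_def)
  then have "((\<lambda>z. snd (inv T z) - g (fst (inv T z))) has_derivative
      (\<lambda>h. snd (inv T h) - g' (fst (inv T z)) \<bullet> fst (inv T h))) (at z)"
    by (intro derivative_intros i)
  moreover have "normal T g' z \<bullet> h = snd (inv T h) - g' (fst (inv T z)) \<bullet> fst (inv T h)" for h
    unfolding normal_def orthogonal_inv(5)[OF T] by (simp add: base_def inner_prod_def)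
  ultimately show ?thesis by (simp add: height_def[abs_def] base_def)
qed

lemma height_along:
  assumes T: "orthogonal_transformation T" and g: "C1_gradient V g g'" and "base T (z + t *\<^sub>R d) \<in> V"
  shows "((\<lambda>t. height T g (z + t *\<^sub>R d)) has_real_derivative normal T g' (z + t *\<^sub>R d) \<bullet> d) (at t)"
proof -
  have "((\<lambda>t. height T g (z + t *\<^sub>R d)) has_derivative (\<lambda>h. normal T g' (z + t *\<^sub>R d) \<bullet> (h *\<^sub>R d))) (at t)"
    by (rule has_derivative_compose[where f="\<lambda>t. z + t *\<^sub>R d" and g="height T g",
          OF _ height_has_derivative[OF T g assms(3)]]) (auto intro!: derivative_eq_intros)
  then show ?thesis by (simp add: has_field_derivative_def mult_commute_abs)
qed

lemma lift_along:
  fixes T :: "'v::euclidean_space \<times> real \<Rightarrow> 'v \<times> real"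
  assumes T: "orthogonal_transformation T" and g: "C1_gradient V g g'" and "u \<in> V"
  shows "((\<lambda>t. lift T g (u + t *\<^sub>R a)) has_vector_derivative T (a, g' u \<bullet> a)) (at 0)"
proof -
  have "((\<lambda>t. g (u + t *\<^sub>R a)) has_derivative (\<lambda>h. g' u \<bullet> (h *\<^sub>R a))) (at 0)"
    using g assms(3) by (intro has_derivative_compose[where f="\<lambda>t. u + t *\<^sub>R a" and g=g])
      (auto intro!: derivative_eq_intros simp: C1_gradient_def)
  then have "((\<lambda>t. (u + t *\<^sub>R a, g (u + t *\<^sub>R a))) has_derivative (\<lambda>h. (h *\<^sub>R a, g' u \<bullet> (h *\<^sub>R a)))) (at 0)"
    by (auto intro!: derivative_eq_intros)
  from bounded_linear.has_derivative[OF orthogonal_inv(3)[OF T] this]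
  have "((\<lambda>t. lift T g (u + t *\<^sub>R a)) has_derivative (\<lambda>h. T (h *\<^sub>R (a, g' u \<bullet> a)))) (at 0)"
    by (simp add: lift_def)
  then show ?thesis
    by (simp add: has_vector_derivative_def linear_cmul[OF orthogonal_transformation_linear[OF T]]
        del: scaleR_Pair)
qed

locale hypograph_chart =
  fixes G :: "('v::euclidean_space \<times> real) set" and y \<epsilon> and T :: "'v \<times> real \<Rightarrow> 'v \<times> real" and V g g'
  assumes \<epsilon>: "\<epsilon> > 0" and T: "orthogonal_transformation T" and g: "C1_gradient V g g'"
    and in_chart: "\<And>u s. T (u, s) \<in> ball y \<epsilon> \<Longrightarrow> u \<in> V \<and> (T (u, s) \<in> G \<longleftrightarrow> s < g u)"
    and openG: "open G"
begin

lemma openV: "open V" using g by (simp add: C1_gradient_def)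

lemma base_in: "z \<in> ball y \<epsilon> \<Longrightarrow> base T z \<in> V"
  using in_chart[of "fst (inv T z)" "snd (inv T z)"] by (simp add: base_def orthogonal_inv[OF T])

lemma in_G_iff: "z \<in> ball y \<epsilon> \<Longrightarrow> z \<in> G \<longleftrightarrow> height T g z < 0"
  using in_chart[of "fst (inv T z)" "snd (inv T z)"] by (simp add: height_def base_def orthogonal_inv[OF T])

lemma height_continuous: "continuous_on (ball y \<epsilon>) (height T g)"
  using height_has_derivative[OF T g base_in]
  by (meson continuous_at_imp_continuous_on has_derivative_continuous)

lemma eventually_in_ball:
  assumes "z \<in> ball y \<epsilon>"
  shows "eventually (\<lambda>t. z + t *\<^sub>R d \<in> ball y \<epsilon>) (at_right 0)"
proof -
  have "((\<lambda>t. z + t *\<^sub>R d) \<longlongrightarrow> z + 0 *\<^sub>R d) (at_right 0)" by (intro tendsto_intros)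
  then show ?thesis
    using topological_tendstoD[of _ z "at_right 0" "ball y \<epsilon>"] assms by simp
qed

text \<open>The derivative of \<open>height\<close> along \<open>d\<close> is the inner product with
  \<open>normal\<close>, so its sign decides the side. This and its counterpart for the outside
  settle every later question of orientation.\<close>

lemma eventually_inside:
  assumes "z \<in> ball y \<epsilon>" "height T g z = 0" "normal T g' z \<bullet> d < 0"
  shows "eventually (\<lambda>t. z + t *\<^sub>R d \<in> G) (at_right 0)"
proof -
  have "((\<lambda>t. height T g (z + t *\<^sub>R d)) has_real_derivative normal T g' z \<bullet> d) (at 0)"
    using height_along[OF T g, of z 0 d] base_in[OF assms(1)] by simp
  from DERIV_neg_dec_right[OF this assms(3)] obtain \<delta> where \<delta>: "\<delta> > 0"
    "\<And>h. h > 0 \<Longrightarrow> h < \<delta> \<Longrightarrow> height T g (z + h *\<^sub>R d) < 0" using assms(2) by auto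
  have "eventually (\<lambda>t. t \<in> {0<..<\<delta>}) (at_right 0)"
    using \<delta>(1) by (rule eventually_at_right_real)
  with eventually_in_ball[OF assms(1), of d] show ?thesis
    by eventually_elim (use \<delta> in_G_iff in auto)
qed

lemma eventually_outside:
  assumes "z \<in> ball y \<epsilon>" "height T g z = 0" "normal T g' z \<bullet> d > 0"
  shows "eventually (\<lambda>t. z + t *\<^sub>R d \<notin> G) (at_right 0)"
proof -
  have "((\<lambda>t. height T g (z + t *\<^sub>R d)) has_real_derivative normal T g' z \<bullet> d) (at 0)"
    using height_along[OF T g, of z 0 d] base_in[OF assms(1)] by simp
  from DERIV_pos_inc_right[OF this assms(3)] obtain \<delta> where \<delta>: "\<delta> > 0"
    "\<And>h. h > 0 \<Longrightarrow> h < \<delta> \<Longrightarrow> height T g (z + h *\<^sub>R d) > 0" using assms(2) by auto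
  have "eventually (\<lambda>t. t \<in> {0<..<\<delta>}) (at_right 0)"
    using \<delta>(1) by (rule eventually_at_right_real)
  with eventually_in_ball[OF assms(1), of d] show ?thesis
    by eventually_elim (metis \<delta>(2) greaterThanLessThan_iff in_G_iff less_asym)
qed

text \<open>A point of height 0 is approached from within \<open>G\<close> along the negative
  normal; the points of positive height in the ball form an open set that misses
  \<open>G\<close>.\<close>

lemma frontier_iff:
  assumes z: "z \<in> ball y \<epsilon>"
  shows "z \<in> frontier G \<longleftrightarrow> height T g z = 0"
proof -
  have "z \<in> closure G" if "height T g z = 0"
  proof -
    have "normal T g' z \<bullet> (- normal T g' z) < 0"
      using norm_normal_pos[OF T, of g' z] by (simp add: dot_square_norm)
    from eventually_inside[OF z that this]
    have "eventually (\<lambda>t. z + t *\<^sub>R (- normal T g' z) \<in> closure G) (at_right 0)"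
      by eventually_elim (rule subsetD[OF closure_subset])
    moreover have "((\<lambda>t. z + t *\<^sub>R (- normal T g' z)) \<longlongrightarrow> z + 0 *\<^sub>R (- normal T g' z)) (at_right 0)"
      by (intro tendsto_intros)
    ultimately show ?thesis
      by (intro Lim_in_closed_set[of "closure G" "\<lambda>t. z + t *\<^sub>R (- normal T g' z)" "at_right (0::real)"]) simp_all
  qed
  moreover have "z \<notin> closure G" if h: "height T g z > 0"
  proof
    assume "z \<in> closure G"
    moreover have o: "open (ball y \<epsilon> \<inter> height T g -` {0<..})"
      by (rule continuous_open_preimage[OF height_continuous]) auto
    moreover have "z \<in> ball y \<epsilon> \<inter> height T g -` {0<..}" using z h by simp
    ultimately have "(ball y \<epsilon> \<inter> height T g -` {0<..}) \<inter> G \<noteq> {}"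
      using open_Int_closure_eq_empty[OF o, of G] by blast
    then obtain x where "x \<in> ball y \<epsilon>" "height T g x > 0" "x \<in> G" by blast
    then show False using in_G_iff by simp
  qed
  moreover have "z \<in> G \<longleftrightarrow> height T g z < 0" using in_G_iff[OF z] .
  moreover have "frontier G = closure G - G" using openG by (simp add: frontier_def interior_open)
  ultimately show ?thesis
    by (cases "height T g z" "0::real" rule: linorder_cases) auto
qed

text \<open>Lines in the base, lifted to the graph, are curves in the frontier; orthogonality to
  their velocities forces \<open>n\<close> to be a multiple of \<open>normal\<close>. Pointing
  outwards fixes the sign and norm 1 the factor.\<close>

lemma exterior_normal_eq:
  assumes z: "z \<in> ball y \<epsilon>" "z \<in> frontier G" and n: "unit_exterior_normal G z n"
  shows "n = unit_normal T g' z"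
proof -
  have h: "height T g z = 0" using frontier_iff z by simp
  let ?u = "base T z"
  have u: "?u \<in> V" using base_in[OF z(1)] .
  have orth: "n \<bullet> T (a, g' ?u \<bullet> a) = 0" for a
  proof -
    let ?\<gamma> = "\<lambda>t. lift T g (?u + t *\<^sub>R a)"
    have \<gamma>0: "?\<gamma> 0 = z" using lift_base[OF T h] by simp
    have d: "(?\<gamma> has_vector_derivative T (a, g' ?u \<bullet> a)) (at 0)"
      by (rule lift_along[OF T g u])
    then have "(?\<gamma> \<longlongrightarrow> z) (at 0)"
      using has_vector_derivative_continuous[OF d] \<gamma>0 by (simp add: isCont_def)
    then have "eventually (\<lambda>t. ?\<gamma> t \<in> ball y \<epsilon>) (at 0)"
      using topological_tendstoD z(1) open_ball by blast
    then have "eventually (\<lambda>t. ?\<gamma> t \<in> frontier G) (at 0)"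
      by eventually_elim (simp add: frontier_iff height_lift[OF T])
    with d \<gamma>0 n[unfolded unit_exterior_normal_def, THEN conjunct2, THEN conjunct1, rule_format,
      of "?\<gamma>" "T (a, g' ?u \<bullet> a)"]
    show ?thesis by simp
  qed
  define p q where "p = fst (inv T n)" and "q = snd (inv T n)"
  have pq: "n = T (p, q)" by (simp add: p_def q_def orthogonal_inv[OF T])
  have "(p + q *\<^sub>R g' ?u) \<bullet> a = 0" for a
    using orth[of a] unfolding pq orthogonal_inv(6)[OF T] by (simp add: inner_prod_def inner_add_left)
  then have "p + q *\<^sub>R g' ?u = 0" by (metis inner_eq_zero_iff)
  then have "p = q *\<^sub>R (- g' ?u)" by (simp add: eq_neg_iff_add_eq_0)
  then have "(p, q) = q *\<^sub>R (- g' ?u, 1)" by simp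
  then have nq: "n = q *\<^sub>R normal T g' z"
    by (simp only: pq normal_def linear_cmul[OF orthogonal_transformation_linear[OF T]])
  have n1: "norm n = 1" using n by (simp add: unit_exterior_normal_def)
  have "q \<ge> 0"
  proof (rule ccontr)
    assume "\<not> q \<ge> 0"
    then have "normal T g' z \<bullet> n < 0"
      using norm_normal_pos[OF T, of g' z] by (simp add: nq mult_neg_pos dot_square_norm)
    from eventually_inside[OF z(1) h this]
    have "eventually (\<lambda>t. z + t *\<^sub>R n \<in> G) (at_right 0)" .
    moreover have "eventually (\<lambda>t. z + t *\<^sub>R n \<notin> closure G) (at_right 0)"
      using n unfolding unit_exterior_normal_def by (auto elim: eventually_mono)
    ultimately have "eventually (\<lambda>t. False) (at_right (0::real))"
      by eventually_elim (meson closure_subset subsetD)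
    then show False by simp
  qed
  with n1 have "q * norm (normal T g' z) = 1" by (simp add: nq)
  then have "q = inverse (norm (normal T g' z))"
    by (metis inverse_unique mult.commute)
  then show ?thesis by (simp add: nq unit_normal_def)
qed

lemma subchart:
  assumes "\<delta> > 0" "ball w \<delta> \<subseteq> ball y \<epsilon>"
  shows "hypograph_chart G w \<delta> T V g g'"
  using assms in_chart by unfold_locales (auto simp: T g openG)

end

text \<open>If the unit normals of two charts differed, the direction \<open>n\<^sub>2 - n\<^sub>1\<close> would point into \<open>G\<close>
  according to the first chart and out of \<open>G\<close> according to the second.\<close>

lemma unit_normal_unique:
  assumes "hypograph_chart G y1 \<epsilon>1 T1 V1 g1 g1'" "hypograph_chart G y2 \<epsilon>2 T2 V2 g2 g2'"
    and z: "z \<in> ball y1 \<epsilon>1" "z \<in> ball y2 \<epsilon>2" "z \<in> frontier G"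
  shows "unit_normal T1 g1' z = unit_normal T2 g2' z"
proof (rule ccontr)
  interpret c1: hypograph_chart G y1 \<epsilon>1 T1 V1 g1 g1' by fact
  interpret c2: hypograph_chart G y2 \<epsilon>2 T2 V2 g2 g2' by fact
  let ?n1 = "unit_normal T1 g1' z" and ?n2 = "unit_normal T2 g2' z"
  assume ne: "?n1 \<noteq> ?n2"
  have n: "norm ?n1 = 1" "norm ?n2 = 1" by (simp_all add: norm_unit_normal c1.T c2.T)
  have lt: "?n1 \<bullet> ?n2 < 1"
  proof -
    have "(norm (?n1 - ?n2))\<^sup>2 = 2 - 2 * (?n1 \<bullet> ?n2)"
      using n by (simp add: power2_norm_eq_inner algebra_simps inner_commute)
        (simp add: dot_square_norm)
    moreover have "(norm (?n1 - ?n2))\<^sup>2 > 0" using ne by simp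
    ultimately show ?thesis by simp
  qed
  have "?n1 \<bullet> (?n2 - ?n1) < 0" "?n2 \<bullet> (?n2 - ?n1) > 0"
    using lt n by (auto simp: inner_diff_right dot_square_norm inner_commute)
  then have "normal T1 g1' z \<bullet> (?n2 - ?n1) < 0" "normal T2 g2' z \<bullet> (?n2 - ?n1) > 0"
    using norm_normal_pos[OF c1.T, of g1' z] norm_normal_pos[OF c2.T, of g2' z]
    by (auto simp: unit_normal_inner zero_less_divide_iff divide_less_0_iff simp del: zero_less_norm_iff)
  then have "eventually (\<lambda>t. z + t *\<^sub>R (?n2 - ?n1) \<in> G) (at_right 0)"
    "eventually (\<lambda>t. z + t *\<^sub>R (?n2 - ?n1) \<notin> G) (at_right 0)"
    using z c1.frontier_iff c2.frontier_iff c1.eventually_inside c2.eventually_outside by blast+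
  then have "eventually (\<lambda>t. False) (at_right (0::real))"
    by eventually_elim auto
  then show False by simp
qed

text \<open>The height of the known chart vanishes on the new graph and strictly increases along the
  new vertical direction \<open>T (0, 1)\<close> near \<open>u0\<close>. Hence \<open>G\<close>,
  where that height is negative, is locally the part below the new graph.\<close>

lemma graph_in_frontier_oriented:
  fixes T :: "'v::euclidean_space \<times> real \<Rightarrow> 'v \<times> real"
  assumes "hypograph_chart G y2 \<epsilon>2 T2 V2 g2 g2'"
    and T: "orthogonal_transformation T" and g: "C1_gradient V g g'"
    and S: "lift T g ` V \<subseteq> frontier G" and u0: "u0 \<in> V" and w: "lift T g u0 \<in> ball y2 \<epsilon>2"
    and pos: "normal T2 g2' (lift T g u0) \<bullet> T (0, 1) > 0"
  shows "\<exists>\<epsilon>. hypograph_chart G (lift T g u0) \<epsilon> T V g g'"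
proof -
  interpret c2: hypograph_chart G y2 \<epsilon>2 T2 V2 g2 g2' by fact
  let ?w = "lift T g u0"
  have "continuous_on (ball y2 \<epsilon>2) (\<lambda>z. normal T2 g2' z \<bullet> T (0, 1))"
    by (intro continuous_intros continuous_on_subset[OF continuous_normal[OF c2.T c2.g]])
      (use c2.base_in in auto)
  then have "open (ball y2 \<epsilon>2 \<inter> (\<lambda>z. normal T2 g2' z \<bullet> T (0, 1)) -` {0<..})"
    by (rule continuous_open_preimage) auto
  moreover have "?w \<in> ball y2 \<epsilon>2 \<inter> (\<lambda>z. normal T2 g2' z \<bullet> T (0, 1)) -` {0<..}"
    using w pos by simp
  \<comment> \<open>By continuity the normal of the known chart keeps a positive component along
    \<open>T (0, 1)\<close> throughout this ball.\<close>
  ultimately obtain \<epsilon>3 where \<epsilon>3: "\<epsilon>3 > 0"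
    "ball ?w \<epsilon>3 \<subseteq> ball y2 \<epsilon>2 \<inter> (\<lambda>z. normal T2 g2' z \<bullet> T (0, 1)) -` {0<..}"
    using open_contains_ball_eq by blast
  have oV: "open {z. base T z \<in> V}" using open_base_vimage[OF T] g by (simp add: C1_gradient_def)
  have "continuous_on {z. base T z \<in> V} (\<lambda>z. lift T g (base T z))"
    by (rule continuous_on_compose2[OF continuous_lift[OF T g] continuous_base[OF T]]) auto
  then have "open ({z. base T z \<in> V} \<inter> (\<lambda>z. lift T g (base T z)) -` ball ?w \<epsilon>3)"
    by (rule continuous_open_preimage[OF _ oV]) auto
  then have "open ({z. base T z \<in> V} \<inter> (\<lambda>z. lift T g (base T z)) -` ball ?w \<epsilon>3 \<inter> ball ?w \<epsilon>3)"
    by (rule open_Int) auto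
  moreover have "?w \<in> {z. base T z \<in> V} \<inter> (\<lambda>z. lift T g (base T z)) -` ball ?w \<epsilon>3 \<inter> ball ?w \<epsilon>3"
    using u0 \<epsilon>3(1) by (simp add: base_lift[OF T])
  \<comment> \<open>Shrunk once more so that the point of the graph above or below \<open>z\<close>
    also lies in the ball of radius \<open>\<epsilon>3\<close>.\<close>
  ultimately obtain \<epsilon> where \<epsilon>: "\<epsilon> > 0"
    "ball ?w \<epsilon> \<subseteq> {z. base T z \<in> V} \<inter> (\<lambda>z. lift T g (base T z)) -` ball ?w \<epsilon>3 \<inter> ball ?w \<epsilon>3"
    using open_contains_ball_eq by blast
  have "hypograph_chart G ?w \<epsilon> T V g g'"
  proof
    fix u s assume z: "T (u, s) \<in> ball ?w \<epsilon>"
    have uV: "u \<in> V" using z \<epsilon>(2) by (auto simp: base_T[OF T])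
    have b3: "T (u, s) \<in> ball ?w \<epsilon>3" "T (u, g u) \<in> ball ?w \<epsilon>3"
      using z \<epsilon>(2) by (auto simp: base_T[OF T] lift_def)
    have line: "T (u, t) = T (u, 0) + t *\<^sub>R T (0, 1)" for t
      using linear_add[OF orthogonal_transformation_linear[OF T], of "(u,0)" "t *\<^sub>R (0,1)"]
        linear_cmul[OF orthogonal_transformation_linear[OF T], of t "(0,1)"] by simp
    let ?k = "\<lambda>t. height T2 g2 (T (u, t))"
    \<comment> \<open>Balls are convex, so the whole vertical segment from the point to the graph
      stays where the height is increasing.\<close>
    have between: "T (u, t) \<in> ball ?w \<epsilon>3" if "t \<in> closed_segment s (g u)" for t
    proof -
      from that obtain c where c: "0 \<le> c" "c \<le> 1" "t = (1 - c) * s + c * g u"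
        by (auto simp: in_segment)
      have "(u, t) = (1 - c) *\<^sub>R (u, s) + c *\<^sub>R (u, g u)"
        by (simp only: c(3) scaleR_Pair add_Pair scaleR_collapse real_scaleR_def)
      then have "T (u, t) = T ((1 - c) *\<^sub>R (u, s) + c *\<^sub>R (u, g u))" by (rule arg_cong[where f=T])
      also have "\<dots> = (1 - c) *\<^sub>R T (u, s) + c *\<^sub>R T (u, g u)"
        by (simp only: linear_add[OF orthogonal_transformation_linear[OF T]]
            linear_cmul[OF orthogonal_transformation_linear[OF T]])
      finally have e: "T (u, t) = (1 - c) *\<^sub>R T (u, s) + c *\<^sub>R T (u, g u)" .
      have "(1 - c) *\<^sub>R T (u, s) + c *\<^sub>R T (u, g u) \<in> ball ?w \<epsilon>3"
        by (rule convexD[OF convex_ball b3]) (use c(1,2) in simp_all)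
      then show ?thesis by (simp only: e)
    qed
    have deriv: "\<exists>y. (?k has_real_derivative y) (at t) \<and> 0 < y" if "t \<in> closed_segment s (g u)" for t
    proof -
      have tb: "T (u, t) \<in> ball y2 \<epsilon>2" "normal T2 g2' (T (u, t)) \<bullet> T (0, 1) > 0"
        using between[OF that] \<epsilon>3(2) by auto
      have "(?k has_real_derivative normal T2 g2' (T (u, t)) \<bullet> T (0, 1)) (at t)"
        using height_along[OF c2.T c2.g, of "T (u, 0)" t "T (0, 1)"] c2.base_in[OF tb(1)]
        by (simp only: line[symmetric])
      then show ?thesis using tb(2) by blast
    qed
    have k0: "?k (g u) = 0"
      using S uV b3(2) \<epsilon>3(2) c2.frontier_iff[of "T (u, g u)"] by (auto simp: lift_def image_subset_iff)
    have Gk: "T (u, s) \<in> G \<longleftrightarrow> ?k s < 0"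
      using c2.in_G_iff b3(1) \<epsilon>3(2) by blast
    have "?k s < ?k (g u)" if "s < g u"
      using that by (rule DERIV_pos_imp_increasing) (rule deriv, simp add: closed_segment_eq_real_ivl)
    moreover have "?k (g u) < ?k s" if "g u < s"
      using that by (rule DERIV_pos_imp_increasing) (rule deriv, use that in \<open>simp add: closed_segment_eq_real_ivl\<close>)
    ultimately show "u \<in> V \<and> (T (u, s) \<in> G \<longleftrightarrow> s < g u)"
      using uV k0 unfolding Gk by (cases "s < g u"; cases "g u < s") auto
  qed (use \<epsilon> T g c2.openG in auto)
  then show ?thesis by blast
qed

text \<open>Reversing the vertical axis turns the region above the graph of \<open>g\<close> into
  the region below the graph of \<open>- g\<close>, while the lifted points stay the same. It
  accounts for graphs that have \<open>G\<close> above them.\<close>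

definition flip :: "('v::euclidean_space \<times> real \<Rightarrow> 'v \<times> real) \<Rightarrow> 'v \<times> real \<Rightarrow> 'v \<times> real" where
  "flip T = (\<lambda>(u, s). T (u, - s))"

lemma orthogonal_flip: "orthogonal_transformation T \<Longrightarrow> orthogonal_transformation (flip T)"
proof -
  have "linear (\<lambda>(u::'a, s::real). (u, - s))" by (auto intro!: linearI)
  then have "orthogonal_transformation (\<lambda>(u::'a, s::real). (u, - s))"
    by (auto simp: orthogonal_transformation norm_prod_def)
  moreover assume "orthogonal_transformation T"
  ultimately have "orthogonal_transformation (T \<circ> (\<lambda>(u, s). (u, - s)))"
    by (rule orthogonal_transformation_compose[rotated])
  then show ?thesis by (simp add: flip_def comp_def case_prod_unfold)
qed

lemma lift_flip: "lift (flip T) (\<lambda>u. - g u) = lift T g"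
  by (auto simp: lift_def flip_def)

lemma C1_gradient_uminus: "C1_gradient V g g' \<Longrightarrow> C1_gradient V (\<lambda>u. - g u) (\<lambda>u. - g' u)"
  by (auto simp: C1_gradient_def intro!: continuous_intros has_derivative_minus)

text \<open>The known height vanishes on the new graph, so the known normal is orthogonal to its
  tangent vectors. Together with \<open>T (0, 1)\<close> these span the space, so the normal has a
  nonzero component along \<open>T (0, 1)\<close>, whose sign selects \<open>T\<close> or
  \<open>flip T\<close>.\<close>

lemma graph_in_frontier:
  fixes T :: "'v::euclidean_space \<times> real \<Rightarrow> 'v \<times> real"
  assumes "hypograph_chart G y2 \<epsilon>2 T2 V2 g2 g2'"
    and T: "orthogonal_transformation T" and g: "C1_gradient V g g'"
    and S: "lift T g ` V \<subseteq> frontier G" and u0: "u0 \<in> V" and w: "lift T g u0 \<in> ball y2 \<epsilon>2"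
  shows "\<exists>\<epsilon>. hypograph_chart G (lift T g u0) \<epsilon> T V g g' \<or>
    hypograph_chart G (lift T g u0) \<epsilon> (flip T) V (\<lambda>u. - g u) (\<lambda>u. - g' u)"
proof -
  interpret c2: hypograph_chart G y2 \<epsilon>2 T2 V2 g2 g2' by fact
  let ?w = "lift T g u0"
  have lin: "linear T" using T by (rule orthogonal_transformation_linear)
  have tangent: "normal T2 g2' ?w \<bullet> T (a, g' u0 \<bullet> a) = 0" for a
  proof -
    let ?\<gamma> = "\<lambda>t. lift T g (u0 + t *\<^sub>R a)"
    have d: "(?\<gamma> has_vector_derivative T (a, g' u0 \<bullet> a)) (at 0)"
      by (rule lift_along[OF T g u0])
    then have "(?\<gamma> \<longlongrightarrow> ?w) (at 0)"
      using has_vector_derivative_continuous[OF d] by (simp add: isCont_def)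
    then have "eventually (\<lambda>t. ?\<gamma> t \<in> ball y2 \<epsilon>2) (at 0)"
      using topological_tendstoD w open_ball by blast
    moreover have "eventually (\<lambda>t. u0 + t *\<^sub>R a \<in> V) (at 0)"
    proof (rule topological_tendstoD)
      show "((\<lambda>t. u0 + t *\<^sub>R a) \<longlongrightarrow> u0 + 0 *\<^sub>R a) (at 0)" by (intro tendsto_intros)
    qed (use g u0 in \<open>auto simp: C1_gradient_def\<close>)
    ultimately have ev: "eventually (\<lambda>t. height T2 g2 (?\<gamma> t) = 0) (at 0)"
    proof eventually_elim
      case (elim t)
      have "lift T g (u0 + t *\<^sub>R a) \<in> frontier G" using S elim(2) by blast
      with c2.frontier_iff[OF elim(1)] show ?case by simp
    qed
    have "((\<lambda>t. height T2 g2 (?\<gamma> t)) has_derivative (\<lambda>h. normal T2 g2' ?w \<bullet> (h *\<^sub>R T (a, g' u0 \<bullet> a)))) (at 0)"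
      using d c2.base_in[OF w]
      by (intro has_derivative_compose[where f="?\<gamma>" and g="height T2 g2"])
        (auto simp: has_vector_derivative_def intro!: height_has_derivative[OF c2.T c2.g])
    moreover have "((\<lambda>t. height T2 g2 (?\<gamma> t)) has_derivative (\<lambda>h. 0)) (at 0)"
    proof (rule has_derivative_transform_eventually[where f="\<lambda>_. 0"])
      show "eventually (\<lambda>t. 0 = height T2 g2 (?\<gamma> t)) (at 0)" using ev by (rule eventually_mono) simp
      show "0 = height T2 g2 (?\<gamma> 0)" using S u0 c2.frontier_iff[OF w] by (simp add: image_subset_iff)
    qed auto
    ultimately have "(\<lambda>h. normal T2 g2' ?w \<bullet> (h *\<^sub>R T (a, g' u0 \<bullet> a))) = (\<lambda>h. 0)"
      by (rule has_derivative_unique)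
    from fun_cong[OF this, of 1] show ?thesis by simp
  qed
  have ne: "normal T2 g2' ?w \<bullet> T (0, 1) \<noteq> 0"
  proof
    assume 0: "normal T2 g2' ?w \<bullet> T (0, 1) = 0"
    have "normal T2 g2' ?w \<bullet> T (a, b) = 0" for a b
    proof -
      have "(a, b) = (a, g' u0 \<bullet> a) + (b - g' u0 \<bullet> a) *\<^sub>R (0, 1)" by simp
      then have "T (a, b) = T (a, g' u0 \<bullet> a) + (b - g' u0 \<bullet> a) *\<^sub>R T (0, 1)"
        by (metis linear_add[OF lin] linear_cmul[OF lin])
      then show ?thesis using tangent 0 by (simp add: inner_add_right)
    qed
    then have "normal T2 g2' ?w \<bullet> T (inv T (normal T2 g2' ?w)) = 0"
      by (metis prod.collapse)
    then show False using norm_normal_pos[OF c2.T, of g2' ?w] by (simp add: orthogonal_inv[OF T])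
  qed
  show ?thesis
  proof (cases "normal T2 g2' ?w \<bullet> T (0, 1) > 0")
    case True
    then show ?thesis using graph_in_frontier_oriented[OF assms] by blast
  next
    case False
    have "flip T (0, 1) = - T (0, 1)"
      using linear_neg[OF lin, of "(0, 1)"] by (simp add: flip_def)
    then have "normal T2 g2' (lift (flip T) (\<lambda>u. - g u) u0) \<bullet> flip T (0, 1) > 0"
      using False ne by (simp add: lift_flip)
    then have "\<exists>\<epsilon>. hypograph_chart G (lift (flip T) (\<lambda>u. - g u) u0) \<epsilon> (flip T) V (\<lambda>u. - g u) (\<lambda>u. - g' u)"
      by (intro graph_in_frontier_oriented[OF assms(1)])
        (use assms in \<open>auto simp: lift_flip intro: orthogonal_flip C1_gradient_uminus\<close>)
    then show ?thesis by (auto simp: lift_flip)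
  qed
qed

section \<open>Surface measure\<close>

text \<open>Outside \<open>V\<close> the functions \<open>g\<close> and \<open>g'\<close> may fail
  to be measurable. The indicators repair this: such points are all sent to 0, but with density
  0.\<close>

definition graph_measure :: "('v::euclidean_space \<times> real \<Rightarrow> 'v \<times> real) \<Rightarrow> 'v set \<Rightarrow> ('v \<Rightarrow> real) \<Rightarrow> ('v \<Rightarrow> 'v) \<Rightarrow>
    ('v \<times> real) measure" where
  "graph_measure T V g g' =
     distr (density lborel (\<lambda>u. ennreal (indicator V u * sqrt (1 + (norm (g' u))\<^sup>2)))) borel
       (\<lambda>u. indicator V u *\<^sub>R lift T g u)"

lemma sets_graph_measure [simp, measurable_cong]: "sets (graph_measure T V g g') = sets borel"
  by (simp add: graph_measure_def)

lemma
  fixes T :: "'v::euclidean_space \<times> real \<Rightarrow> 'v \<times> real"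
  assumes T: "orthogonal_transformation T" and g: "C1_gradient V g g'"
  shows measurable_graph_density: "(\<lambda>u. indicator V u * sqrt (1 + (norm (g' u))\<^sup>2)) \<in> borel_measurable borel"
    and measurable_graph_lift: "(\<lambda>u. indicator V u *\<^sub>R lift T g u) \<in> borel_measurable borel"
    and emeasure_graph_measure: "X \<in> sets borel \<Longrightarrow> emeasure (graph_measure T V g g') X =
      (\<integral>\<^sup>+ u\<in>{u\<in>V. lift T g u \<in> X}. ennreal (sqrt (1 + (norm (g' u))\<^sup>2)) \<partial>lborel)"
    and integral_graph_measure: "\<And>h :: 'v \<times> real \<Rightarrow> 'w::euclidean_space. h \<in> borel_measurable borel \<Longrightarrow>
      (\<integral>z. h z \<partial>graph_measure T V g g') = (\<integral>u. indicator V u *\<^sub>R (sqrt (1 + (norm (g' u))\<^sup>2) *\<^sub>R h (lift T g u)) \<partial>lborel)"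
    and integrable_graph_measure: "\<And>h :: 'v \<times> real \<Rightarrow> 'w::euclidean_space. h \<in> borel_measurable borel \<Longrightarrow>
      integrable (graph_measure T V g g') h \<longleftrightarrow>
      integrable lborel (\<lambda>u. indicator V u *\<^sub>R (sqrt (1 + (norm (g' u))\<^sup>2) *\<^sub>R h (lift T g u)))"
proof -
  have V: "V \<in> sets borel" and g'c: "continuous_on V g'" using g by (auto simp: C1_gradient_def)
  have "continuous_on V (\<lambda>u. sqrt (1 + (norm (g' u))\<^sup>2))"
    by (intro continuous_intros g'c)
  from borel_measurable_continuous_on_indicator[OF V this, unfolded real_scaleR_def]
  show d[measurable]: "(\<lambda>u. indicator V u * sqrt (1 + (norm (g' u))\<^sup>2)) \<in> borel_measurable borel" .
  show l[measurable]: "(\<lambda>u. indicator V u *\<^sub>R lift T g u) \<in> borel_measurable borel"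
    by (rule borel_measurable_continuous_on_indicator[OF V continuous_lift[OF T g]])
  show "emeasure (graph_measure T V g g') X =
      (\<integral>\<^sup>+ u\<in>{u\<in>V. lift T g u \<in> X}. ennreal (sqrt (1 + (norm (g' u))\<^sup>2)) \<partial>lborel)"
    if [measurable]: "X \<in> sets borel"
  proof -
    have "(\<lambda>u. indicator V u *\<^sub>R lift T g u) -` X \<in> sets borel"
      using measurable_sets[OF l that] by simp
    then have "emeasure (graph_measure T V g g') X =
      (\<integral>\<^sup>+ u. ennreal (indicator V u * sqrt (1 + (norm (g' u))\<^sup>2)) *
        indicator ((\<lambda>u. indicator V u *\<^sub>R lift T g u) -` X) u \<partial>lborel)"
      unfolding graph_measure_def by (subst emeasure_distr) (simp_all add: emeasure_density)
    also have "\<dots> = (\<integral>\<^sup>+ u\<in>{u\<in>V. lift T g u \<in> X}. ennreal (sqrt (1 + (norm (g' u))\<^sup>2)) \<partial>lborel)"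
      by (intro nn_integral_cong) (auto simp: indicator_def)
    finally show ?thesis .
  qed
  fix h :: "'v \<times> real \<Rightarrow> 'w" assume [measurable]: "h \<in> borel_measurable borel"
  have eq: "(\<lambda>u. (indicator V u * sqrt (1 + (norm (g' u))\<^sup>2)) *\<^sub>R h (indicator V u *\<^sub>R lift T g u)) =
    (\<lambda>u. indicator V u *\<^sub>R (sqrt (1 + (norm (g' u))\<^sup>2) *\<^sub>R h (lift T g u)))"
    by (auto simp: indicator_def)
  show "(\<integral>z. h z \<partial>graph_measure T V g g') = (\<integral>u. indicator V u *\<^sub>R (sqrt (1 + (norm (g' u))\<^sup>2) *\<^sub>R h (lift T g u)) \<partial>lborel)"
    unfolding graph_measure_def by (subst integral_distr) (simp_all add: integral_density eq)
  show "integrable (graph_measure T V g g') h \<longleftrightarrow>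
      integrable lborel (\<lambda>u. indicator V u *\<^sub>R (sqrt (1 + (norm (g' u))\<^sup>2) *\<^sub>R h (lift T g u)))"
    unfolding graph_measure_def by (subst integrable_distr_eq) (simp_all add: integrable_density eq)
qed

lemma graph_measure_flip:
  "graph_measure (flip T) V (\<lambda>u. - g u) (\<lambda>u. - g' u) = graph_measure T V g g'"
  by (simp add: graph_measure_def lift_flip)

context hypograph_chart
begin

abbreviation "chart_measure \<equiv> graph_measure T V g g'"

lemma unit_normal_continuous: "continuous_on (ball y \<epsilon>) (unit_normal T g')"
proof -
  have "continuous_on (ball y \<epsilon>) (normal T g')"
    by (rule continuous_on_subset[OF continuous_normal[OF T g]]) (use base_in in blast)
  then show ?thesis
    unfolding unit_normal_def[abs_def]
    by (intro continuous_intros) (use norm_normal_pos[OF T, of g'] in \<open>auto simp: less_le\<close>)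
qed

text \<open>The area factor \<open>sqrt (1 + (norm (g' u))\<^sup>2)\<close> is the norm of
  \<open>normal\<close> and cancels the normalisation in \<open>unit_normal\<close>.\<close>

lemma flux:
  fixes \<phi> :: "'v \<times> real \<Rightarrow> 'w::euclidean_space"
  assumes C1: "C1_on UNIV \<phi>" and K: "compact K" "\<And>z. z \<notin> K \<Longrightarrow> \<phi> z = 0" "K \<subseteq> ball y \<epsilon>"
  shows "integrable chart_measure (\<lambda>z. (unit_normal T g' z \<bullet> v) *\<^sub>R \<phi> z)"
    and "(\<integral>z. indicator G z *\<^sub>R frechet_derivative \<phi> (at z) v \<partial>lborel) =
         (\<integral>z. (unit_normal T g' z \<bullet> v) *\<^sub>R \<phi> z \<partial>chart_measure)"
proof -
  let ?h = "\<lambda>z. (unit_normal T g' z \<bullet> v) *\<^sub>R \<phi> z"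
  have c\<phi>: "continuous_on (ball y \<epsilon>) \<phi>"
    by (rule continuous_on_subset[OF C1_on_continuous[OF C1]]) simp
  have "continuous_on (ball y \<epsilon>) ?h"
    by (intro continuous_intros unit_normal_continuous c\<phi>)
  then have "(\<lambda>z. indicator (ball y \<epsilon>) z *\<^sub>R ?h z) \<in> borel_measurable borel"
    by (intro borel_measurable_continuous_on_indicator) auto
  moreover have "(\<lambda>z. indicator (ball y \<epsilon>) z *\<^sub>R ?h z) = ?h"
    using K(2,3) by (auto simp: indicator_def fun_eq_iff subset_iff)
  ultimately have hm: "?h \<in> borel_measurable borel" by simp
  have eq: "(\<lambda>u. indicator V u *\<^sub>R (sqrt (1 + (norm (g' u))\<^sup>2) *\<^sub>R ?h (lift T g u))) =
      (\<lambda>u. indicator V u *\<^sub>R ((T (- g' u, 1) \<bullet> v) *\<^sub>R \<phi> (T (u, g u))))"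
  proof
    fix u
    have "norm (normal T g' (lift T g u)) = sqrt (1 + (norm (g' u))\<^sup>2)"
      by (simp add: norm_normal[OF T] base_lift[OF T])
    then have "sqrt (1 + (norm (g' u))\<^sup>2) * (unit_normal T g' (lift T g u) \<bullet> v) = normal T g' (lift T g u) \<bullet> v"
      unfolding unit_normal_inner using norm_normal_pos[OF T, of g' "lift T g u"] by simp
    also have "normal T g' (lift T g u) = T (- g' u, 1)" by (simp add: normal_def base_lift[OF T])
    finally show "indicator V u *\<^sub>R (sqrt (1 + (norm (g' u))\<^sup>2) *\<^sub>R ?h (lift T g u)) =
      indicator V u *\<^sub>R ((T (- g' u, 1) \<bullet> v) *\<^sub>R \<phi> (T (u, g u)))"
      by (simp add: lift_def)
  qed
  have Gb: "G \<in> sets borel" using openG by simp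
  have inK: "u \<in> V \<and> (T (u, s) \<in> G \<longleftrightarrow> s < g u)" if "T (u, s) \<in> K" for u s
    using that K(3) in_chart by blast
  note res = rotated_hypograph_derivative_integral[OF C1 K(1,2) g T Gb inK, where v=v]
  show "integrable chart_measure ?h"
    unfolding integrable_graph_measure[OF T g hm] eq using res(1) by simp
  show "(\<integral>z. indicator G z *\<^sub>R frechet_derivative \<phi> (at z) v \<partial>lborel) = (\<integral>z. ?h z \<partial>chart_measure)"
    unfolding integral_graph_measure[OF T g hm] eq using res(2) by simp
qed

lemma emeasure_off_frontier:
  assumes "X \<in> sets borel" "X \<subseteq> ball y \<epsilon>" "X \<inter> frontier G = {}"
  shows "emeasure chart_measure X = 0"
proof -
  have "lift T g u \<notin> X" for u
    using assms(2,3) frontier_iff[of "lift T g u"] height_lift[OF T, of g u] by blast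
  then show ?thesis by (simp add: emeasure_graph_measure[OF T g assms(1)])
qed

text \<open>Only frontier points of \<open>C\<close> are charged; they project onto a compact subset
  of \<open>V\<close>, on which the area density is continuous and hence integrable.\<close>

lemma emeasure_compact_less_top:
  assumes C: "compact C" "C \<subseteq> ball y \<epsilon>"
  shows "emeasure chart_measure C < \<infinity>"
proof -
  let ?P = "base T ` (C \<inter> frontier G)"
  have P: "compact ?P"
    by (intro compact_continuous_image continuous_base[OF T] compact_Int_closed C) auto
  have PV: "?P \<subseteq> V" using C(2) base_in by blast
  have "continuous_on ?P (\<lambda>u. sqrt (1 + (norm (g' u))\<^sup>2))"
    using g PV by (intro continuous_intros) (auto simp: C1_gradient_def intro: continuous_on_subset)
  then have "integrable lborel (\<lambda>u. indicator ?P u *\<^sub>R sqrt (1 + (norm (g' u))\<^sup>2))"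
    by (rule borel_integrable_compact[OF P])
  then have "(\<integral>\<^sup>+ u. ennreal (indicator ?P u *\<^sub>R sqrt (1 + (norm (g' u))\<^sup>2)) \<partial>lborel) < \<infinity>"
    by (subst nn_integral_eq_integral) auto
  moreover have "emeasure chart_measure C \<le> (\<integral>\<^sup>+ u. ennreal (indicator ?P u *\<^sub>R sqrt (1 + (norm (g' u))\<^sup>2)) \<partial>lborel)"
  proof -
    have "u \<in> ?P" if "u \<in> V" "lift T g u \<in> C" for u
    proof -
      have "lift T g u \<in> frontier G"
        using that C(2) frontier_iff[of "lift T g u"] height_lift[OF T, of g u] by blast
      then show ?thesis using that base_lift[OF T, of g u] by (metis IntI image_eqI)
    qed
    then show ?thesis
      using C(1) by (subst emeasure_graph_measure[OF T g])
        (auto intro!: nn_integral_mono simp: indicator_def borel_compact)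
  qed
  ultimately show ?thesis by order
qed

end

text \<open>If \<open>m\<close> is a C1 function positive exactly on the box, then k m / (1 + k m)
  increases with k to the indicator of the box. Monotonicity allows monotone convergence for any
  measure.\<close>

lemma box_bump_functions:
  fixes a b :: "'v::euclidean_space"
  obtains \<psi> :: "nat \<Rightarrow> 'v \<Rightarrow> real" where
    "\<And>k. C1_on UNIV (\<psi> k)" "\<And>k z. \<psi> k z \<ge> 0" "\<And>k z. z \<notin> box a b \<Longrightarrow> \<psi> k z = 0"
    "\<And>z. incseq (\<lambda>k. \<psi> k z)" "\<And>z. (\<lambda>k. \<psi> k z) \<longlonglongrightarrow> indicator (box a b) z"
proof
  define m where "m z = (\<Prod>i\<in>Basis. pos_sq (z \<bullet> i - a \<bullet> i) * pos_sq (b \<bullet> i - z \<bullet> i))" for z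
  define \<psi> where "\<psi> k z = (real k * m z) / (1 + real k * m z)" for k z
  have m0: "m z \<ge> 0" for z unfolding m_def by (intro prod_nonneg mult_nonneg_nonneg pos_sq_nonneg ballI)
  have mpos: "m z > 0" if "z \<in> box a b" for z
    unfolding m_def by (rule prod_pos) (use that in \<open>auto simp: mem_box pos_sq_pos_iff\<close>)
  have moff: "m z = 0" if "z \<notin> box a b" for z
    using that unfolding m_def by (auto simp: mem_box pos_sq_zero_iff not_less)
  have den: "1 + real k * m z > 0" for k z using m0[of z] by (simp add: add_pos_nonneg)
  have C1m: "C1_on UNIV m"
    unfolding m_def
    by (intro C1_on_prod C1_on_mult C1_on_pos_sq C1_on_diff C1_on_const C1_on_linear bounded_linear_inner_left) auto
  show "C1_on UNIV (\<psi> k)" for k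
    unfolding \<psi>_def
  proof (rule C1_on_compose_real[OF C1m, where \<rho>="\<lambda>t. (real k * t) / (1 + real k * t)"])
    have nz: "1 + real k * t \<noteq> 0" if "t \<in> range m" for t
      using that den by (auto simp: less_le)
    show "((\<lambda>t. (real k * t) / (1 + real k * t)) has_real_derivative real k / (1 + real k * t)\<^sup>2) (at t)"
      if "t \<in> range m" for t
      using nz[OF that] by (auto intro!: derivative_eq_intros simp: field_simps power2_eq_square)
    show "continuous_on (range m) (\<lambda>t. real k / (1 + real k * t)\<^sup>2)"
      using nz by (intro continuous_intros) auto
  qed
  show "\<psi> k z \<ge> 0" for k z using m0[of z] by (simp add: \<psi>_def)
  show "\<psi> k z = 0" if "z \<notin> box a b" for k z using moff[OF that] by (simp add: \<psi>_def)
  have alt: "\<psi> k z = 1 - 1 / (1 + real k * m z)" for k z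
    using den[of k z] by (simp add: \<psi>_def field_simps)
  show "incseq (\<lambda>k. \<psi> k z)" for z
  proof (rule incseq_SucI)
    fix k
    have "1 / (1 + real (Suc k) * m z) \<le> 1 / (1 + real k * m z)"
      using den[of k z] m0[of z] by (intro divide_left_mono mult_pos_pos den) (auto intro: mult_right_mono)
    then show "\<psi> k z \<le> \<psi> (Suc k) z" by (simp add: alt)
  qed
  show "(\<lambda>k. \<psi> k z) \<longlonglongrightarrow> indicator (box a b) z" for z
  proof (cases "z \<in> box a b")
    case True
    have "filterlim (\<lambda>k. real k * m z) at_top sequentially"
      by (rule filterlim_at_top_mult_tendsto_pos[OF tendsto_const mpos[OF True] filterlim_real_sequentially])
    then have "filterlim (\<lambda>k. 1 + real k * m z) at_top sequentially"
      by (rule filterlim_tendsto_add_at_top[OF tendsto_const])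
    then have "(\<lambda>k. 1 - 1 / (1 + real k * m z)) \<longlonglongrightarrow> 1 - 0"
      by (intro tendsto_diff tendsto_const tendsto_divide_0[OF tendsto_const] filterlim_at_top_imp_at_infinity)
    then show ?thesis using True by (simp add: alt)
  qed (simp add: \<psi>_def moff)
qed

text \<open>The flux \<open>\<integral>\<^sub>G \<partial>\<^sub>v \<psi>\<close> does not mention the chart, so it determines the measure
  \<open>(n \<bullet> v) dS\<close>; near \<open>w\<close> the direction \<open>v = n w\<close> makes its density positive.\<close>

lemma chart_measures_agree:
  assumes c1: "hypograph_chart G y1 \<epsilon>1 T1 V1 g1 g1'" and c2: "hypograph_chart G y2 \<epsilon>2 T2 V2 g2 g2'"
    and w: "w \<in> ball y1 \<epsilon>1" "w \<in> ball y2 \<epsilon>2" "w \<in> frontier G"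
  shows "\<exists>W. open W \<and> w \<in> W \<and> (\<forall>X\<in>sets borel. X \<subseteq> W \<longrightarrow>
    emeasure (graph_measure T1 V1 g1 g1') X = emeasure (graph_measure T2 V2 g2 g2') X)"
proof -
  interpret c1: hypograph_chart G y1 \<epsilon>1 T1 V1 g1 g1' by fact
  interpret c2: hypograph_chart G y2 \<epsilon>2 T2 V2 g2 g2' by fact
  let ?N1 = "unit_normal T1 g1'" and ?N2 = "unit_normal T2 g2'"
  define v where "v = ?N1 w"
  have v2: "v = ?N2 w" unfolding v_def by (rule unit_normal_unique[OF c1 c2 w])
  have pos: "?N1 w \<bullet> v > 0" "?N2 w \<bullet> v > 0"
    using norm_unit_normal[OF c1.T, of g1' w] by (simp_all add: v2[symmetric] v_def[symmetric] dot_square_norm)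
  have "open (ball y1 \<epsilon>1 \<inter> (\<lambda>z. ?N1 z \<bullet> v) -` {0<..})"
    by (intro continuous_open_preimage continuous_intros c1.unit_normal_continuous) auto
  moreover have "open (ball y2 \<epsilon>2 \<inter> (\<lambda>z. ?N2 z \<bullet> v) -` {0<..})"
    by (intro continuous_open_preimage continuous_intros c2.unit_normal_continuous) auto
  ultimately have "open ((ball y1 \<epsilon>1 \<inter> (\<lambda>z. ?N1 z \<bullet> v) -` {0<..}) \<inter> (ball y2 \<epsilon>2 \<inter> (\<lambda>z. ?N2 z \<bullet> v) -` {0<..}))"
    by (rule open_Int)
  moreover have "w \<in> (ball y1 \<epsilon>1 \<inter> (\<lambda>z. ?N1 z \<bullet> v) -` {0<..}) \<inter> (ball y2 \<epsilon>2 \<inter> (\<lambda>z. ?N2 z \<bullet> v) -` {0<..})"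
    using w pos by simp
  \<comment> \<open>A closed box on which both charts are valid and both normals have positive
    component along \<open>v\<close>; its interior is the required \<open>W\<close>.\<close>
  ultimately obtain a b where ab:
    "cbox a b \<subseteq> (ball y1 \<epsilon>1 \<inter> (\<lambda>z. ?N1 z \<bullet> v) -` {0<..}) \<inter> (ball y2 \<epsilon>2 \<inter> (\<lambda>z. ?N2 z \<bullet> v) -` {0<..})"
    "w \<in> box a b"
    by (rule open_contains_cbox)
  define W where "W = box a b"
  have Wc: "W \<subseteq> cbox a b" by (simp add: W_def box_subset_cbox)
  have W1: "cbox a b \<subseteq> ball y1 \<epsilon>1" "\<And>z. z \<in> W \<Longrightarrow> ?N1 z \<bullet> v > 0"
    and W2: "cbox a b \<subseteq> ball y2 \<epsilon>2" "\<And>z. z \<in> W \<Longrightarrow> ?N2 z \<bullet> v > 0"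
    using ab(1) Wc by auto
  have Wm[measurable]: "W \<in> sets borel" by (simp add: W_def)
  let ?m1 = "graph_measure T1 V1 g1 g1'" and ?m2 = "graph_measure T2 V2 g2 g2'"
  \<comment> \<open>The measure \<open>(n \<bullet> v) dS\<close> on \<open>W\<close>, which the
    flux determines; without the positivity of the factor this would not be a density.\<close>
  define \<kappa> where "\<kappa> T V g g' = density (graph_measure T V g g') (\<lambda>z. ennreal (indicator W z * (unit_normal T g' z \<bullet> v)))"
    for T :: "'a \<times> real \<Rightarrow> 'a \<times> real" and V g g'
  have dens: "(\<lambda>z. indicator W z * (unit_normal T g' z \<bullet> v)) \<in> borel_measurable borel"
    if c: "hypograph_chart G y \<epsilon> T V g g'" and sub: "cbox a b \<subseteq> ball y \<epsilon>" for y \<epsilon> T V g g'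
    unfolding real_scaleR_def[symmetric]
    by (intro borel_measurable_continuous_on_indicator Wm continuous_intros
        continuous_on_subset[OF hypograph_chart.unit_normal_continuous[OF c]] subset_trans[OF Wc sub])
  \<comment> \<open>The limit of numbers that do not involve the chart is the mass that the chart
    assigns to a box: flux identity, then monotone convergence of the bumps.\<close>
  have lim: "(\<lambda>k. ennreal (\<integral>z. indicator G z *\<^sub>R frechet_derivative (\<psi> k) (at z) v \<partial>lborel)) \<longlonglongrightarrow> emeasure (\<kappa> T V g g') (box c d)"
    if c: "hypograph_chart G y \<epsilon> T V g g'" and sub: "cbox a b \<subseteq> ball y \<epsilon>" and p: "\<And>z. z \<in> W \<Longrightarrow> unit_normal T g' z \<bullet> v > 0"
      and cd: "box c d \<subseteq> W"
      and \<psi>: "\<And>k. C1_on UNIV (\<psi> k)" "\<And>k z. \<psi> k z \<ge> 0" "\<And>k z. z \<notin> box c d \<Longrightarrow> \<psi> k z = 0"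
    "\<And>z. incseq (\<lambda>k. \<psi> k z)" "\<And>z. (\<lambda>k. \<psi> k z) \<longlonglongrightarrow> indicator (box c d) z"
    for y \<epsilon> T V g g' c d and \<psi> :: "nat \<Rightarrow> 'a \<times> real \<Rightarrow> real"
  proof -
    note [measurable] = dens[OF c sub]
    have \<psi>m[measurable]: "\<psi> k \<in> borel_measurable borel" for k
      by (rule borel_measurable_continuous_onI[OF C1_on_continuous[OF \<psi>(1)]])
    have offW: "\<psi> k z = 0" if "z \<notin> W" for z k using \<psi>(3) that cd by blast
    let ?m = "graph_measure T V g g'" and ?N = "unit_normal T g'"
    have eq: "(\<integral>\<^sup>+z. ennreal (\<psi> k z) \<partial>\<kappa> T V g g') = ennreal (\<integral>z. indicator G z *\<^sub>R frechet_derivative (\<psi> k) (at z) v \<partial>lborel)" for k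
    proof -
      have off: "\<psi> k z = 0" if "z \<notin> cbox a b" for z using \<psi>(3) that cd Wc by blast
      have fl: "integrable ?m (\<lambda>z. (?N z \<bullet> v) *\<^sub>R \<psi> k z)"
        "(\<integral>z. indicator G z *\<^sub>R frechet_derivative (\<psi> k) (at z) v \<partial>lborel) = (\<integral>z. (?N z \<bullet> v) *\<^sub>R \<psi> k z \<partial>?m)"
        by (rule hypograph_chart.flux[OF c \<psi>(1) compact_cbox off sub], assumption)+
      have "(\<integral>\<^sup>+z. ennreal (\<psi> k z) \<partial>\<kappa> T V g g') = (\<integral>\<^sup>+z. ennreal (indicator W z * (?N z \<bullet> v)) * ennreal (\<psi> k z) \<partial>?m)"
        unfolding \<kappa>_def by (subst nn_integral_density) simp_all
      also have "\<dots> = (\<integral>\<^sup>+z. ennreal ((?N z \<bullet> v) *\<^sub>R \<psi> k z) \<partial>?m)"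
      proof (intro nn_integral_cong)
        fix z
        show "ennreal (indicator W z * (?N z \<bullet> v)) * ennreal (\<psi> k z) = ennreal ((?N z \<bullet> v) *\<^sub>R \<psi> k z)"
          using p[of z] \<psi>(2)[of k z] offW[of z k] by (cases "z \<in> W") (auto simp: ennreal_mult)
      qed
      also have "\<dots> = ennreal (\<integral>z. (?N z \<bullet> v) *\<^sub>R \<psi> k z \<partial>?m)"
      proof (rule nn_integral_eq_integral[OF fl(1)], rule AE_I2)
        fix z
        show "0 \<le> (?N z \<bullet> v) *\<^sub>R \<psi> k z"
          using p[of z] \<psi>(2)[of k z] offW[of z k] by (cases "z \<in> W") auto
      qed
      finally show ?thesis unfolding fl(2) .
    qed
    have "(\<lambda>k. \<integral>\<^sup>+z. ennreal (\<psi> k z) \<partial>\<kappa> T V g g') \<longlonglongrightarrow> (\<integral>\<^sup>+z. indicator (box c d) z \<partial>\<kappa> T V g g')"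
    proof (rule nn_integral_LIMSEQ)
      show "incseq (\<lambda>k z. ennreal (\<psi> k z))"
        using \<psi>(4) by (auto simp: incseq_def le_fun_def intro!: ennreal_leI)
      show "(\<lambda>z. ennreal (\<psi> k z)) \<in> borel_measurable (\<kappa> T V g g')" for k
        by (simp add: \<kappa>_def)
      show "(\<lambda>k. ennreal (\<psi> k z)) \<longlonglongrightarrow> indicator (box c d) z" for z
        using tendsto_ennrealI[OF \<psi>(5), of z] by (simp add: ennreal_indicator)
    qed
    moreover have "(\<integral>\<^sup>+z. indicator (box c d) z \<partial>\<kappa> T V g g') = emeasure (\<kappa> T V g g') (box c d)"
      by (rule nn_integral_indicator) (simp add: \<kappa>_def)
    ultimately show ?thesis by (simp only: eq)
  qed
  have \<kappa>_off: "emeasure (\<kappa> T V g g') X = emeasure (\<kappa> T V g g') (X \<inter> W)"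
    if c: "hypograph_chart G y \<epsilon> T V g g'" and sub: "cbox a b \<subseteq> ball y \<epsilon>" and [measurable]: "X \<in> sets borel" for y \<epsilon> T V g g' X
  proof -
    note [measurable] = dens[OF c sub]
    show ?thesis
      unfolding \<kappa>_def by (simp add: emeasure_density) (intro nn_integral_cong, auto simp: indicator_def)
  qed
  \<comment> \<open>Boxes form an intersection-stable generator, and a box cut down to
    \<open>W\<close> is again a box, so \<open>lim\<close> applies to both charts with the same
    bumps.\<close>
  have \<kappa>_eq: "\<kappa> T1 V1 g1 g1' = \<kappa> T2 V2 g2 g2'"
  proof (rule measure_eqI_generator_eq)
    let ?E = "range (\<lambda>(a, b). box a b :: ('a \<times> real) set)"
    show "Int_stable ?E"
      by (auto simp: Int_stable_def box_Int_box)
    show "?E \<subseteq> Pow UNIV" "sets (\<kappa> T1 V1 g1 g1') = sigma_sets UNIV ?E" "sets (\<kappa> T2 V2 g2 g2') = sigma_sets UNIV ?E"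
      by (simp_all add: borel_eq_box \<kappa>_def)
    let ?A = "\<lambda>n::nat. box (- (real n *\<^sub>R One)) (real n *\<^sub>R One) :: ('a \<times> real) set"
    show "range ?A \<subseteq> ?E" "(\<Union>i. ?A i) = UNIV"
      unfolding UN_box_eq_UNIV by auto
    show "emeasure (\<kappa> T1 V1 g1 g1') (?A i) \<noteq> \<infinity>" for i
    proof -
      note [measurable] = dens[OF c1 W1(1)]
      have "emeasure (\<kappa> T1 V1 g1 g1') (?A i) \<le> (\<integral>\<^sup>+z. indicator (cbox a b) z \<partial>?m1)"
        unfolding \<kappa>_def
      proof (subst emeasure_density, simp, simp, rule nn_integral_mono)
        fix z
        \<comment> \<open>Both are unit vectors. A density bounded by 1 and carried by a compact box
          inside the chart ball has finite total mass.\<close>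
        have "?N1 z \<bullet> v \<le> 1"
          using norm_cauchy_schwarz[of "?N1 z" v] by (simp add: v_def norm_unit_normal[OF c1.T])
        then show "ennreal (indicator W z * (?N1 z \<bullet> v)) * indicator (?A i) z \<le> indicator (cbox a b) z"
          using Wc by (auto simp: indicator_def ennreal_le_1)
      qed
      also have "\<dots> = emeasure ?m1 (cbox a b)" by simp
      also have "\<dots> < \<infinity>" by (rule c1.emeasure_compact_less_top[OF compact_cbox W1(1)])
      finally show ?thesis by simp
    qed
    fix X assume "X \<in> ?E"
    then obtain c d where X: "X = box c d" by auto
    obtain c' d' where XW: "X \<inter> W = box c' d'" unfolding X W_def box_Int_box by blast
    obtain \<psi> :: "nat \<Rightarrow> 'a \<times> real \<Rightarrow> real" where \<psi>: "\<And>k. C1_on UNIV (\<psi> k)" "\<And>k z. \<psi> k z \<ge> 0"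
      "\<And>k z. z \<notin> box c' d' \<Longrightarrow> \<psi> k z = 0"
      "\<And>z. incseq (\<lambda>k. \<psi> k z)" "\<And>z. (\<lambda>k. \<psi> k z) \<longlonglongrightarrow> indicator (box c' d') z"
      using box_bump_functions[of c' d'] by blast
    have sub: "box c' d' \<subseteq> W" using XW by blast
    have "emeasure (\<kappa> T1 V1 g1 g1') (box c' d') = emeasure (\<kappa> T2 V2 g2 g2') (box c' d')"
      using LIMSEQ_unique[OF lim[OF c1 W1 sub \<psi>] lim[OF c2 W2 sub \<psi>]] .
    moreover have "X \<in> sets borel" by (simp add: X)
    ultimately show "emeasure (\<kappa> T1 V1 g1 g1') X = emeasure (\<kappa> T2 V2 g2 g2') X"
      using \<kappa>_off[OF c1 W1(1), of X] \<kappa>_off[OF c2 W2(1), of X] by (simp add: XW)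
  qed
  let ?q = "\<lambda>z. ennreal (indicator W z / (?N1 z \<bullet> v))"
  have "(\<lambda>z. indicator W z *\<^sub>R (1 / (?N1 z \<bullet> v))) \<in> borel_measurable borel"
    by (intro borel_measurable_continuous_on_indicator Wm continuous_intros
        continuous_on_subset[OF c1.unit_normal_continuous] subset_trans[OF Wc W1(1)]) (use W1(2) in force)
  then have [measurable]: "(\<lambda>z. indicator W z / (?N1 z \<bullet> v)) \<in> borel_measurable borel" by simp
  \<comment> \<open>Dividing by the factor of the first chart recovers both measures: the chart
    measures charge only the frontier, and there the two unit normals coincide.\<close>
  have recover: "emeasure (graph_measure T V g g') X = (\<integral>\<^sup>+z. ?q z * indicator X z \<partial>\<kappa> T V g g')"
    if c: "hypograph_chart G y \<epsilon> T V g g'" and sub: "cbox a b \<subseteq> ball y \<epsilon>" and [measurable]: "X \<in> sets borel" and XW: "X \<subseteq> W"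
    for y \<epsilon> T V g g' X
  proof -
    let ?m = "graph_measure T V g g'"
    note [measurable] = dens[OF c sub]
    have Fm[measurable]: "frontier G \<in> sets borel" by simp
    have "emeasure ?m (X - frontier G) = 0"
      by (rule hypograph_chart.emeasure_off_frontier[OF c]) (use XW Wc sub in auto)
    then have ae: "AE z in ?m. z \<in> X \<longrightarrow> z \<in> frontier G"
      by (intro AE_I[where N="X - frontier G"]) auto
    have "(\<integral>\<^sup>+z. ?q z * indicator X z \<partial>\<kappa> T V g g') =
        (\<integral>\<^sup>+z. ennreal (indicator W z * (unit_normal T g' z \<bullet> v)) * (?q z * indicator X z) \<partial>?m)"
      unfolding \<kappa>_def by (subst nn_integral_density) simp_all
    also have "\<dots> = (\<integral>\<^sup>+z. indicator X z \<partial>?m)"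
      using ae
    proof (intro nn_integral_cong_AE, eventually_elim)
      fix z assume z: "z \<in> X \<longrightarrow> z \<in> frontier G"
      show "ennreal (indicator W z * (unit_normal T g' z \<bullet> v)) * (?q z * indicator X z) = indicator X z"
      proof (cases "z \<in> X")
        case True
        then have zW: "z \<in> W" "z \<in> frontier G" "z \<in> ball y1 \<epsilon>1" "z \<in> ball y \<epsilon>" using XW z Wc W1(1) sub by blast+
        have "unit_normal T g' z = ?N1 z" by (rule unit_normal_unique[OF c c1]) (use zW in auto)
        then show ?thesis
          using True zW(1) W1(2)[OF zW(1)] by (simp add: ennreal_mult[symmetric])
      qed simp
    qed
    finally show ?thesis by simp
  qed
  have "emeasure ?m1 X = emeasure ?m2 X" if "X \<in> sets borel" "X \<subseteq> W" for X
    using recover[OF c1 W1(1) that] recover[OF c2 W2(1) that] by (simp add: \<kappa>_eq)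
  then show ?thesis
    using ab(2) by (intro exI[of _ W]) (simp add: W_def open_box)
qed

text \<open>By Lindelof countably many of the neighbourhoods cover \<open>X\<close>; made disjoint,
  they cut \<open>X\<close> into Borel pieces on which the measures agree.\<close>

lemma emeasure_eq_local:
  fixes M N :: "'a::euclidean_space measure"
  assumes M: "sets M = sets borel" and N: "sets N = sets borel" and X: "X \<in> sets borel"
    and loc: "\<And>w. w \<in> X \<Longrightarrow> \<exists>W. open W \<and> w \<in> W \<and> (\<forall>Y\<in>sets borel. Y \<subseteq> W \<longrightarrow> Y \<subseteq> X \<longrightarrow> emeasure M Y = emeasure N Y)"
  shows "emeasure M X = emeasure N X"
proof -
  define F where "F = {W. open W \<and> (\<forall>Y\<in>sets borel. Y \<subseteq> W \<longrightarrow> Y \<subseteq> X \<longrightarrow> emeasure M Y = emeasure N Y)}"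
  obtain F' where F': "F' \<subseteq> F" "countable F'" "\<Union>F' = \<Union>F"
    by (rule Lindelof[of F]) (auto simp: F_def)
  have "X \<subseteq> \<Union>F" unfolding F_def using loc by blast
  then have XF: "X \<subseteq> \<Union>F'" using F'(3) by simp
  show ?thesis
  proof (cases "F' = {}")
    case True
    then show ?thesis using XF by simp
  next
    case False
    define A where "A n = X \<inter> from_nat_into F' n" for n
    have FI: "from_nat_into F' n \<in> F" for n using from_nat_into[OF False] F'(1) by blast
    have Ab: "A n \<in> sets borel" for n
      using FI[of n] X by (auto simp: A_def F_def)
    have UA: "(\<Union>n. A n) = X"
      using XF range_from_nat_into[OF False F'(2)] unfolding A_def by blast
    have D: "disjointed A n \<in> sets borel" for n
      using sets.range_disjointed_sets[of A borel] Ab by auto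
    have eq: "emeasure M (disjointed A n) = emeasure N (disjointed A n)" for n
    proof -
      have "disjointed A n \<subseteq> from_nat_into F' n" "disjointed A n \<subseteq> X"
        using disjointed_subset[of A n] by (auto simp: A_def)
      then show ?thesis using FI[of n] D[of n] by (simp add: F_def)
    qed
    have "emeasure M X = (\<Sum>n. emeasure M (disjointed A n))"
      using suminf_emeasure[of "disjointed A" M] D UA
      by (simp add: M image_subset_iff disjoint_family_disjointed UN_disjointed_eq)
    also have "\<dots> = (\<Sum>n. emeasure N (disjointed A n))" by (simp only: eq)
    also have "\<dots> = emeasure N X"
      using suminf_emeasure[of "disjointed A" N] D UA
      by (simp add: N image_subset_iff disjoint_family_disjointed UN_disjointed_eq)
    finally show ?thesis .
  qed
qed

lemma smooth_boundary_chart: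
  fixes G :: "('v::euclidean_space \<times> real) set"
  assumes "smooth_boundary G" "open G" "y \<in> frontier G"
  obtains \<epsilon> T V g g' where "hypograph_chart G y \<epsilon> T V g g'"
proof -
  from bspec[OF assms(1)[unfolded smooth_boundary_def] assms(3)]
  obtain \<epsilon> and T :: "'v \<times> real \<Rightarrow> 'v \<times> real" and V g g' where "\<epsilon> > 0" "orthogonal_transformation T" "C1_gradient V g g'"
    and "\<forall>u s. T (u, s) \<in> ball y \<epsilon> \<longrightarrow> u \<in> V \<and> (T (u, s) \<in> G \<longleftrightarrow> s < g u)"
    by (elim exE conjE) (rule that, assumption+)
  then have "hypograph_chart G y \<epsilon> T V g g'"
    using assms(2) by (simp add: hypograph_chart_def)
  then show ?thesis by (rule that)
qed

text \<open>Images of Borel sets need not be Borel in general. Here the image is described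
  explicitly, as the points of the graph whose base lies in \<open>A\<close>.\<close>

lemma lift_image_borel:
  fixes T :: "'v::euclidean_space \<times> real \<Rightarrow> 'v \<times> real"
  assumes T: "orthogonal_transformation T" and g: "C1_gradient V g g'" and A: "A \<in> sets borel" "A \<subseteq> V"
  shows "lift T g ` A \<in> sets borel"
proof -
  have V: "V \<in> sets borel" using g by (auto simp: C1_gradient_def)
  have [measurable]: "(\<lambda>u. indicator V u * g u) \<in> borel_measurable borel"
    using borel_measurable_continuous_on_indicator[OF V C1_gradient_continuous[OF g]] by simp
  have [measurable]: "base T \<in> borel \<rightarrow>\<^sub>M borel"
    by (rule borel_measurable_continuous_onI[OF continuous_base[OF T]])
  have "continuous_on UNIV (\<lambda>z. snd (inv T z))"
    by (intro continuous_intros linear_continuous_on orthogonal_inv(4)[OF T])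
  then have [measurable]: "(\<lambda>z. snd (inv T z)) \<in> borel_measurable borel"
    by (rule borel_measurable_continuous_onI)
  have "lift T g ` A = base T -` A \<inter> {z. snd (inv T z) = indicator V (base T z) * g (base T z)}"
  proof (intro equalityI subsetI)
    fix z assume "z \<in> lift T g ` A"
    then show "z \<in> base T -` A \<inter> {z. snd (inv T z) = indicator V (base T z) * g (base T z)}"
      using A(2) by (auto simp: base_lift[OF T] lift_def base_T[OF T] orthogonal_inv(2)[OF T])
  next
    fix z assume z: "z \<in> base T -` A \<inter> {z. snd (inv T z) = indicator V (base T z) * g (base T z)}"
    then have "height T g z = 0" using A(2) by (auto simp: height_def)
    from lift_base[OF T this] z show "z \<in> lift T g ` A"
      by (intro image_eqI[of _ _ "base T z"]) simp_all
  qed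
  moreover have "base T -` A \<in> sets borel"
    using measurable_sets[of "base T" borel borel A] A(1) by simp
  moreover have "{z. snd (inv T z) = indicator V (base T z) * g (base T z)} \<in> sets borel"
    by measurable
  ultimately show ?thesis by simp
qed

lemma emeasure_graph_measure_image:
  fixes T :: "'v::euclidean_space \<times> real \<Rightarrow> 'v \<times> real"
  assumes T: "orthogonal_transformation T" and g: "C1_gradient V g g'" and A: "A \<in> sets borel" "A \<subseteq> V"
  shows "emeasure (graph_measure T V g g') (lift T g ` A) =
    (\<integral>\<^sup>+ u\<in>A. ennreal (sqrt (1 + (norm (g' u))\<^sup>2)) \<partial>lborel)"
proof -
  have "{u\<in>V. lift T g u \<in> lift T g ` A} = A"
  proof (intro equalityI subsetI)
    fix u assume "u \<in> {u\<in>V. lift T g u \<in> lift T g ` A}"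
    then obtain u' where u': "u' \<in> A" "lift T g u = lift T g u'" by blast
    have "u = base T (lift T g u)" by (rule base_lift[OF T, symmetric])
    also have "\<dots> = u'" unfolding u'(2) by (rule base_lift[OF T])
    finally show "u \<in> A" using u'(1) by (rule ssubst)
  next
    fix u assume "u \<in> A"
    then show "u \<in> {u\<in>V. lift T g u \<in> lift T g ` A}" using A(2) by blast
  qed
  then show ?thesis
    by (simp only: emeasure_graph_measure[OF T g lift_image_borel[OF assms]])
qed

text \<open>Near each of its points the graph is itself a chart, up to \<open>flip\<close>, which
  leaves its measure unchanged; so the agreement of chart measures applies locally, and local
  agreement suffices.\<close>

lemma graph_measure_eq_chart_measure:
  fixes T :: "'v::euclidean_space \<times> real \<Rightarrow> 'v \<times> real"
  assumes c: "hypograph_chart G y \<epsilon> T2 V2 g2 g2'"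
    and T: "orthogonal_transformation T" and g: "C1_gradient V g g'" and S: "lift T g ` V \<subseteq> frontier G"
    and X: "X \<in> sets borel" "X \<subseteq> lift T g ` V" "X \<subseteq> ball y \<epsilon>"
  shows "emeasure (graph_measure T2 V2 g2 g2') X = emeasure (graph_measure T V g g') X"
proof (rule emeasure_eq_local[OF _ _ X(1)])
  fix w assume w: "w \<in> X"
  then obtain u0 where u0: "u0 \<in> V" "w = lift T g u0" using X(2) by blast
  have wb: "lift T g u0 \<in> ball y \<epsilon>" and wf: "w \<in> frontier G" using w X(3) u0 S by auto
  have "\<exists>W. open W \<and> w \<in> W \<and> (\<forall>Y\<in>sets borel. Y \<subseteq> W \<longrightarrow>
     emeasure (graph_measure T2 V2 g2 g2') Y = emeasure (graph_measure T V g g') Y)"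
  proof -
    consider e where "hypograph_chart G w e T V g g'"
      | e where "hypograph_chart G w e (flip T) V (\<lambda>u. - g u) (\<lambda>u. - g' u)"
      using graph_in_frontier[OF c T g S u0(1) wb] u0(2) by blast
    then show ?thesis
    proof cases
      case 1
      have "w \<in> ball w e" using hypograph_chart.\<epsilon>[OF 1] by simp
      from chart_measures_agree[OF c 1 _ this wf] show ?thesis using w X(3) by blast
    next
      case 2
      have "w \<in> ball w e" using hypograph_chart.\<epsilon>[OF 2] by simp
      from chart_measures_agree[OF c 2 _ this wf] show ?thesis
        using w X(3) unfolding graph_measure_flip by blast
    qed
  qed
  then show "\<exists>W. open W \<and> w \<in> W \<and> (\<forall>Y\<in>sets borel. Y \<subseteq> W \<longrightarrow> Y \<subseteq> X \<longrightarrow>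
     emeasure (graph_measure T2 V2 g2 g2') Y = emeasure (graph_measure T V g g') Y)" by blast
qed simp_all

lemma glued_measure:
  fixes m :: "nat \<Rightarrow> 'a::euclidean_space measure" and C :: "nat \<Rightarrow> 'a set"
  assumes m: "\<And>i. sets (m i) = sets borel" and C: "\<And>i. C i \<in> sets borel"
  shows "\<exists>\<mu>. sets \<mu> = sets borel \<and> (\<forall>X\<in>sets borel. emeasure \<mu> X = (\<Sum>i<n. emeasure (m i) (X \<inter> C i)))"
proof -
  let ?f = "\<lambda>X. \<Sum>i<n. emeasure (m i) (X \<inter> C i)"
  have sa: "sigma_algebra UNIV (sets (borel :: 'a measure))"
    using sets.sigma_algebra_axioms[of "borel :: 'a measure"] by simp
  have ca: "countably_additive (sets borel) ?f"
  proof (rule countably_additiveI)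
    fix A :: "nat \<Rightarrow> 'a set" assume A: "range A \<subseteq> sets borel" "disjoint_family A"
    have "(\<Sum>k. ?f (A k)) = (\<Sum>i<n. \<Sum>k. emeasure (m i) (A k \<inter> C i))"
      by (rule suminf_sum) simp
    also have "\<dots> = ?f (\<Union>k. A k)"
    proof (rule sum.cong[OF refl])
      fix i
      have "disjoint_family (\<lambda>k. A k \<inter> C i)" using A(2) by (auto simp: disjoint_family_on_def)
      moreover have "range (\<lambda>k. A k \<inter> C i) \<subseteq> sets (m i)" using A(1) C[of i] m[of i] by auto
      ultimately have "(\<Sum>k. emeasure (m i) (A k \<inter> C i)) = emeasure (m i) (\<Union>k. A k \<inter> C i)"
        by (intro suminf_emeasure)
      then show "(\<Sum>k. emeasure (m i) (A k \<inter> C i)) = emeasure (m i) ((\<Union>k. A k) \<inter> C i)"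
        by (simp add: Int_UN_distrib2)
    qed
    finally show "(\<Sum>k. ?f (A k)) = ?f (\<Union>k. A k)" .
  qed
  have pos: "positive (sets borel) ?f" by (simp add: positive_def)
  show ?thesis
  proof (intro exI[of _ "measure_of UNIV (sets borel) ?f"] conjI ballI)
    show "sets (measure_of UNIV (sets borel) ?f) = sets borel"
      using sigma_algebra.sets_measure_of_eq[OF sa] by simp
    show "emeasure (measure_of UNIV (sets borel) ?f) X = ?f X" if "X \<in> sets borel" for X
      by (rule emeasure_measure_of_sigma[OF sa pos ca that])
  qed
qed

lemma is_surface_measure_lift:
  "is_surface_measure S \<mu> \<longleftrightarrow> sets \<mu> = sets borel \<and> emeasure \<mu> (- S) = 0 \<and>
     (\<forall>T V g g'. orthogonal_transformation T \<and> C1_gradient V g g' \<and> lift T g ` V \<subseteq> S \<longrightarrow>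
       (\<forall>A\<in>sets borel. A \<subseteq> V \<longrightarrow>
         emeasure \<mu> (lift T g ` A) = (\<integral>\<^sup>+ u\<in>A. ennreal (sqrt (1 + (norm (g' u))\<^sup>2)) \<partial>lborel)))"
  unfolding is_surface_measure_def lift_def[abs_def] ..

text \<open>Finitely many chart balls cover the compact frontier. Their measures, restricted to
  disjoint pieces, are added up; on each piece the chart measure may be exchanged for that of any
  graph contained in the frontier, which is the defining property.\<close>

lemma surface_measure_exists:
  fixes G :: "('v::euclidean_space \<times> real) set"
  assumes sm: "smooth_boundary G" and G: "open G" "bounded G"
  shows "is_surface_measure (frontier G) (surface_measure (frontier G))"
proof -
  let ?S = "frontier G"
  have S: "compact ?S" using G(2) by (rule compact_frontier_bounded)
  have "\<forall>y\<in>?S. \<exists>p. case p of (\<epsilon>, T, V, g, g') \<Rightarrow> hypograph_chart G y \<epsilon> T V g g'"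
  proof
    fix y assume "y \<in> ?S"
    then obtain \<epsilon> T V g g' where "hypograph_chart G y \<epsilon> T V g g'"
      by (rule smooth_boundary_chart[OF sm G(1)])
    then show "\<exists>p. case p of (\<epsilon>, T, V, g, g') \<Rightarrow> hypograph_chart G y \<epsilon> T V g g'"
      by (intro exI[of _ "(\<epsilon>, T, V, g, g')"]) simp
  qed
  from bchoice[OF this] obtain p where
    p: "\<forall>y\<in>?S. case p y of (\<epsilon>, T, V, g, g') \<Rightarrow> hypograph_chart G y \<epsilon> T V g g'" ..
  define \<epsilon> T V g g' where "\<epsilon> y = fst (p y)" and "T y = fst (snd (p y))" and "V y = fst (snd (snd (p y)))"
    and "g y = fst (snd (snd (snd (p y))))" and "g' y = snd (snd (snd (snd (p y))))" for y
  have ch: "hypograph_chart G y (\<epsilon> y) (T y) (V y) (g y) (g' y)" if "y \<in> ?S" for y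
    using bspec[OF p that] by (simp add: case_prod_unfold \<epsilon>_def T_def V_def g_def g'_def)
  have \<epsilon>: "\<epsilon> y > 0" if "y \<in> ?S" for y using hypograph_chart.\<epsilon>[OF ch[OF that]] .
  obtain Y where Y: "finite Y" "Y \<subseteq> ?S" "?S \<subseteq> (\<Union>y\<in>Y. ball y (\<epsilon> y))"
  proof (rule compactE_image[OF S, of ?S "\<lambda>y. ball y (\<epsilon> y)"])
    show "?S \<subseteq> (\<Union>y\<in>?S. ball y (\<epsilon> y))" using \<epsilon> centre_in_ball by blast
  qed (simp, blast)
  obtain ys where ys: "set ys = Y" using finite_list[OF Y(1)] by blast
  define n where "n = length ys"
  define B where "B i = ball (ys ! i) (\<epsilon> (ys ! i))" for i
  \<comment> \<open>Each ball without the earlier ones, so that no part of the frontier is counted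
    twice.\<close>
  define C where "C i = B i - (\<Union>j<i. B j)" for i
  define m where "m i = graph_measure (T (ys ! i)) (V (ys ! i)) (g (ys ! i)) (g' (ys ! i))" for i
  have chi: "hypograph_chart G (ys ! i) (\<epsilon> (ys ! i)) (T (ys ! i)) (V (ys ! i)) (g (ys ! i)) (g' (ys ! i))" if "i < n" for i
    using that ys Y(2) by (intro ch) (auto simp: n_def)
  have Cb: "C i \<in> sets borel" for i by (auto simp: C_def B_def)
  have CB: "C i \<subseteq> B i" for i by (auto simp: C_def)
  have SC: "?S \<subseteq> (\<Union>i<n. C i)"
  proof
    fix z assume "z \<in> ?S"
    then obtain y where "y \<in> Y" "z \<in> ball y (\<epsilon> y)" using Y(3) by blast
    then have ex: "\<exists>i. i < n \<and> z \<in> B i" using ys by (auto simp: n_def B_def in_set_conv_nth)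
    define i where "i = (LEAST i. i < n \<and> z \<in> B i)"
    have "i < n \<and> z \<in> B i" unfolding i_def using ex by (rule LeastI_ex)
    moreover have "z \<notin> B j" if "j < i" for j
      using not_less_Least[of j "\<lambda>i. i < n \<and> z \<in> B i"] that calculation by (auto simp: i_def)
    ultimately show "z \<in> (\<Union>i<n. C i)" by (auto simp: C_def)
  qed
  have disj: "disjoint_family_on C {..<n}"
  proof -
    have "C i \<inter> C j = {}" if "i < j" for i j using that CB[of i] by (auto simp: C_def[of j])
    then show ?thesis unfolding disjoint_family_on_def by (metis Int_commute linorder_neqE_nat)
  qed
  obtain \<mu> where \<mu>: "sets \<mu> = sets borel" "\<And>X. X \<in> sets borel \<Longrightarrow> emeasure \<mu> X = (\<Sum>i<n. emeasure (m i) (X \<inter> C i))"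
    using glued_measure[of m C n] Cb by (auto simp: m_def)
  have "is_surface_measure ?S \<mu>"
    unfolding is_surface_measure_lift
  proof (intro conjI allI impI ballI)
    show "sets \<mu> = sets borel" by fact
    have "emeasure (m i) (- ?S \<inter> C i) = 0" if "i < n" for i
      unfolding m_def
      by (rule hypograph_chart.emeasure_off_frontier[OF chi[OF that]]) (use Cb CB in \<open>auto simp: B_def\<close>)
    then show "emeasure \<mu> (- ?S) = 0" by (subst \<mu>(2)) auto
  next
    fix T' :: "'v \<times> real \<Rightarrow> 'v \<times> real" and V' h h' A
    assume as: "orthogonal_transformation T' \<and> C1_gradient V' h h' \<and> lift T' h ` V' \<subseteq> ?S"
      and A: "A \<in> sets borel" "A \<subseteq> V'"
    let ?m = "graph_measure T' V' h h'" and ?X = "lift T' h ` A"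
    have X: "?X \<in> sets borel" using as A by (intro lift_image_borel) auto
    have XS: "?X \<subseteq> ?S" using as A(2) by blast
    have "emeasure \<mu> ?X = (\<Sum>i<n. emeasure (m i) (?X \<inter> C i))" by (rule \<mu>(2)[OF X])
    also have "\<dots> = (\<Sum>i<n. emeasure ?m (?X \<inter> C i))"
    proof (rule sum.cong[OF refl])
      fix i assume "i \<in> {..<n}"
      then have i: "i < n" by simp
      show "emeasure (m i) (?X \<inter> C i) = emeasure ?m (?X \<inter> C i)"
        unfolding m_def
      proof (rule graph_measure_eq_chart_measure[OF chi[OF i]])
        show "?X \<inter> C i \<in> sets borel" using X Cb by simp
        show "?X \<inter> C i \<subseteq> lift T' h ` V'" using A(2) by blast
        show "?X \<inter> C i \<subseteq> ball (ys ! i) (\<epsilon> (ys ! i))" using CB[of i] by (auto simp: B_def)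
      qed (use as in auto)
    qed
    also have "\<dots> = emeasure ?m (\<Union>i\<in>{..<n}. ?X \<inter> C i)"
    proof (rule sum_emeasure)
      show "(\<lambda>i. ?X \<inter> C i) ` {..<n} \<subseteq> sets ?m" using X Cb by auto
      show "disjoint_family_on (\<lambda>i. ?X \<inter> C i) {..<n}" using disj by (auto simp: disjoint_family_on_def)
    qed simp
    also have "(\<Union>i\<in>{..<n}. ?X \<inter> C i) = ?X" using SC XS by blast
    also have "emeasure ?m ?X = (\<integral>\<^sup>+ u\<in>A. ennreal (sqrt (1 + (norm (h' u))\<^sup>2)) \<partial>lborel)"
      using as A by (intro emeasure_graph_measure_image) auto
    finally show "emeasure \<mu> ?X = (\<integral>\<^sup>+ u\<in>A. ennreal (sqrt (1 + (norm (h' u))\<^sup>2)) \<partial>lborel)" .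
  qed
  then show ?thesis unfolding surface_measure_def by (rule someI)
qed

text \<open>Off the frontier both measures vanish. The frontier part of \<open>X\<close> is a lifted
  set, where the defining property of a surface measure gives the same area integral.\<close>

lemma emeasure_surface_measure:
  assumes \<mu>: "is_surface_measure (frontier G) \<mu>" and c: "hypograph_chart G y \<epsilon> T V g g'"
    and X: "X \<in> sets borel" "X \<subseteq> ball y \<epsilon>"
  shows "emeasure \<mu> X = emeasure (graph_measure T V g g') X"
proof -
  interpret hypograph_chart G y \<epsilon> T V g g' by fact
  let ?S = "frontier G"
  have s\<mu>: "sets \<mu> = sets borel" and off: "emeasure \<mu> (- ?S) = 0"
    using \<mu> by (auto simp: is_surface_measure_def)
  \<comment> \<open>The whole graph over \<open>V\<close> may leave the frontier outside the chart
    ball, so the base is restricted to the part lifted into the ball.\<close>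
  define V' where "V' = V \<inter> lift T g -` ball y \<epsilon>"
  define A where "A = V \<inter> lift T g -` (X \<inter> ?S)"
  have V': "open V'" unfolding V'_def
    by (rule continuous_open_preimage[OF continuous_lift[OF T g] openV]) simp
  have g': "C1_gradient V' g g'"
    using g V' by (auto simp: C1_gradient_def V'_def intro: continuous_on_subset)
  have S': "lift T g ` V' \<subseteq> ?S"
  proof (rule image_subsetI)
    fix u assume "u \<in> V'"
    then have "lift T g u \<in> ball y \<epsilon>" by (simp add: V'_def)
    from frontier_iff[OF this] show "lift T g u \<in> ?S" by (simp add: height_lift[OF T])
  qed
  have AV': "A \<subseteq> V'" using X(2) by (auto simp: A_def V'_def)
  have Ab: "A \<in> sets borel"
  proof -
    have "(\<lambda>u. indicator V u *\<^sub>R lift T g u) -` (X \<inter> ?S) \<in> sets borel"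
      using measurable_sets[OF measurable_graph_lift[OF T g], of "X \<inter> ?S"] X(1) by simp
    then have "V \<inter> (\<lambda>u. indicator V u *\<^sub>R lift T g u) -` (X \<inter> ?S) \<in> sets borel"
      using openV by simp
    moreover have "V \<inter> (\<lambda>u. indicator V u *\<^sub>R lift T g u) -` (X \<inter> ?S) = A"
      by (auto simp: A_def)
    ultimately show ?thesis by simp
  qed
  have im: "lift T g ` A = X \<inter> ?S"
  proof (intro equalityI subsetI)
    fix z assume z: "z \<in> X \<inter> ?S"
    then have "z \<in> ball y \<epsilon>" "z \<in> ?S" using X(2) by auto
    then have b: "lift T g (base T z) = z" "base T z \<in> V"
      using frontier_iff lift_base[OF T] base_in by auto
    then have "base T z \<in> A" using z by (simp add: A_def)
    then show "z \<in> lift T g ` A" using b(1) by (metis image_eqI)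
  qed (auto simp: A_def)
  have Xm: "X \<in> sets \<mu>" "X \<inter> ?S \<in> sets \<mu>" "X - ?S \<in> sets \<mu>" using X(1) s\<mu> by auto
  have "emeasure \<mu> X = emeasure \<mu> (X \<inter> ?S) + emeasure \<mu> (X - ?S)"
    using Xm by (subst plus_emeasure) (auto intro!: arg_cong[where f="emeasure \<mu>"])
  also have "emeasure \<mu> (X - ?S) = 0"
    using emeasure_mono[of "X - ?S" "- ?S" \<mu>] off s\<mu> by auto
  also have "emeasure \<mu> (X \<inter> ?S) = (\<integral>\<^sup>+ u\<in>A. ennreal (sqrt (1 + (norm (g' u))\<^sup>2)) \<partial>lborel)"
    using \<mu> T g' S' Ab AV' unfolding is_surface_measure_lift im[symmetric] by blast
  also have "\<dots> = emeasure (graph_measure T V g g') (X \<inter> ?S)"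
    unfolding im[symmetric] by (rule emeasure_graph_measure_image[OF T g Ab, symmetric]) (simp add: A_def)
  also have "\<dots> = emeasure (graph_measure T V g g') (X \<inter> ?S) + emeasure (graph_measure T V g g') (X - ?S)"
    using emeasure_off_frontier[of "X - ?S"] X by auto
  also have "\<dots> = emeasure (graph_measure T V g g') X"
    using X(1) by (subst plus_emeasure) (auto intro!: arg_cong[where f="emeasure _"])
  finally show ?thesis by simp
qed

lemma integral_surface_measure:
  fixes h :: "'v::euclidean_space \<times> real \<Rightarrow> 'w::euclidean_space"
  assumes \<mu>: "is_surface_measure (frontier G) \<mu>" and c: "hypograph_chart G y \<epsilon> T V g g'"
    and h: "h \<in> borel_measurable borel" "\<And>z. z \<notin> ball y \<epsilon> \<Longrightarrow> h z = 0"
  shows "(\<integral>z. h z \<partial>\<mu>) = (\<integral>z. h z \<partial>graph_measure T V g g')"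
    and "integrable \<mu> h \<longleftrightarrow> integrable (graph_measure T V g g') h"
proof -
  let ?m = "graph_measure T V g g'" and ?B = "ball y \<epsilon>"
  have s\<mu>: "sets \<mu> = sets borel" using \<mu> by (auto simp: is_surface_measure_def)
  \<comment> \<open>Weighting with the indicator of the ball makes the two measures equal and does
    not affect integrals of \<open>h\<close>, which vanishes off the ball.\<close>
  have eq: "density \<mu> (\<lambda>z. ennreal (indicator ?B z)) = density ?m (\<lambda>z. ennreal (indicator ?B z))"
  proof (rule measure_eqI)
    fix X assume "X \<in> sets (density \<mu> (\<lambda>z. ennreal (indicator ?B z)))"
    then have X: "X \<in> sets borel" using s\<mu> by simp
    have dens: "emeasure (density M (\<lambda>z. ennreal (indicator ?B z))) X = emeasure M (?B \<inter> X)"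
      if [measurable_cong]: "sets M = sets borel" for M :: "('v \<times> real) measure"
    proof -
      note X[measurable]
      have [measurable]: "?B \<in> sets borel" by simp
      have "emeasure (density M (\<lambda>z. ennreal (indicator ?B z))) X = (\<integral>\<^sup>+z. indicator (?B \<inter> X) z \<partial>M)"
        by (subst emeasure_density) (measurable, intro nn_integral_cong, simp add: indicator_def)
      also have "\<dots> = emeasure M (?B \<inter> X)" by (rule nn_integral_indicator) measurable
      finally show ?thesis .
    qed
    have "emeasure (density \<mu> (\<lambda>z. ennreal (indicator ?B z))) X = emeasure \<mu> (?B \<inter> X)"
      by (rule dens[OF s\<mu>])
    also have "\<dots> = emeasure ?m (?B \<inter> X)"
      using X by (intro emeasure_surface_measure[OF \<mu> c]) auto
    also have "\<dots> = emeasure (density ?m (\<lambda>z. ennreal (indicator ?B z))) X"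
      by (rule dens[symmetric]) simp
    finally show "emeasure (density \<mu> (\<lambda>z. ennreal (indicator ?B z))) X = emeasure (density ?m (\<lambda>z. ennreal (indicator ?B z))) X" .
  qed (simp add: s\<mu>)
  have hB: "(\<lambda>z. indicator ?B z *\<^sub>R h z) = h" using h(2) by (auto simp: indicator_def)
  have hm: "h \<in> borel_measurable \<mu>" "h \<in> borel_measurable ?m" using h(1) s\<mu> by (auto cong: measurable_cong_sets)
  have im: "(indicator ?B :: _ \<Rightarrow> real) \<in> borel_measurable \<mu>" "(indicator ?B :: _ \<Rightarrow> real) \<in> borel_measurable ?m"
    by (intro borel_measurable_indicator; simp add: s\<mu>)+
  show "(\<integral>z. h z \<partial>\<mu>) = (\<integral>z. h z \<partial>?m)"
    using integral_density[OF hm(1) im(1)] integral_density[OF hm(2) im(2)] eq by (simp add: hB)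
  show "integrable \<mu> h \<longleftrightarrow> integrable ?m h"
    using integrable_density[OF hm(1) im(1)] integrable_density[OF hm(2) im(2)] eq by (simp add: hB)
qed

lemma surface_measure_finite:
  assumes \<mu>: "is_surface_measure (frontier G) \<mu>" and sm: "smooth_boundary G" and G: "open G" "bounded G"
  shows "emeasure \<mu> UNIV < \<infinity>"
proof -
  let ?S = "frontier G"
  have s\<mu>: "sets \<mu> = sets borel" and off: "emeasure \<mu> (- ?S) = 0" using \<mu> by (auto simp: is_surface_measure_def)
  have ex: "\<exists>r>0. emeasure \<mu> (cball y r) < \<infinity>" if y: "y \<in> ?S" for y
  proof -
    obtain \<epsilon> T V g g' where c: "hypograph_chart G y \<epsilon> T V g g'" by (rule smooth_boundary_chart[OF sm G(1) y])
    have \<epsilon>: "\<epsilon> > 0" by (rule hypograph_chart.\<epsilon>[OF c])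
    then have sub: "cball y (\<epsilon> / 2) \<subseteq> ball y \<epsilon>" by (simp add: cball_subset_ball_iff)
    have "emeasure \<mu> (cball y (\<epsilon> / 2)) < \<infinity>"
      using emeasure_surface_measure[OF \<mu> c _ sub] hypograph_chart.emeasure_compact_less_top[OF c compact_cball sub] by simp
    then show ?thesis using \<epsilon> by (intro exI[of _ "\<epsilon> / 2"]) simp
  qed
  then obtain r where r: "\<And>y. y \<in> ?S \<Longrightarrow> r y > 0 \<and> emeasure \<mu> (cball y (r y)) < \<infinity>" by metis
  obtain Y where Y: "finite Y" "Y \<subseteq> ?S" "?S \<subseteq> (\<Union>y\<in>Y. ball y (r y))"
  proof (rule compactE_image[OF compact_frontier_bounded[OF G(2)], of ?S "\<lambda>y. ball y (r y)"])
    show "?S \<subseteq> (\<Union>y\<in>?S. ball y (r y))" using r centre_in_ball by blast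
  qed (simp, blast)
  have "(\<Union>y\<in>Y. ball y (r y)) \<subseteq> (\<Union>y\<in>Y. cball y (r y))" by (intro UN_mono ball_subset_cball) simp
  with Y(3) have "UNIV = (\<Union>y\<in>Y. cball y (r y)) \<union> - ?S" by blast
  then have "emeasure \<mu> UNIV \<le> emeasure \<mu> (\<Union>y\<in>Y. cball y (r y)) + emeasure \<mu> (- ?S)"
  proof -
    have "(\<Union>y\<in>Y. cball y (r y)) \<in> sets \<mu>" unfolding s\<mu> using Y(1) by (intro sets.finite_UN) auto
    moreover have "- ?S \<in> sets \<mu>" unfolding s\<mu> by auto
    ultimately have "emeasure \<mu> ((\<Union>y\<in>Y. cball y (r y)) \<union> - ?S) \<le> emeasure \<mu> (\<Union>y\<in>Y. cball y (r y)) + emeasure \<mu> (- ?S)"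
      by (rule emeasure_subadditive)
    then show ?thesis by (simp only: \<open>UNIV = (\<Union>y\<in>Y. cball y (r y)) \<union> - ?S\<close>[symmetric])
  qed
  also have "\<dots> \<le> (\<Sum>y\<in>Y. emeasure \<mu> (cball y (r y)))"
  proof -
    have "emeasure \<mu> (\<Union>y\<in>Y. cball y (r y)) \<le> (\<Sum>y\<in>Y. emeasure \<mu> (cball y (r y)))"
      by (rule emeasure_subadditive_finite[OF Y(1)]) (auto simp: s\<mu>)
    then show ?thesis by (simp only: off add_0_right)
  qed
  also have "\<dots> < \<infinity>"
  proof -
    have "emeasure \<mu> (cball y (r y)) \<noteq> top" if "y \<in> Y" for y using r[of y] that Y(2) by auto
    then show ?thesis using Y(1) by (simp add: less_top)
  qed
  finally show ?thesis .
qed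

section \<open>The divergence theorem\<close>

text \<open>\<open>n\<close> is given only pointwise. Near each frontier point it equals the unit
  normal of one chart, which is continuous; integrability of the boundary terms rests on
  this.\<close>

lemma exterior_normal_continuous:
  fixes G :: "('v::euclidean_space \<times> real) set"
  assumes sm: "smooth_boundary G" and G: "open G" and n: "\<forall>z\<in>frontier G. unit_exterior_normal G z (n z)"
  shows "continuous_on (frontier G) n"
  unfolding continuous_on_eq_continuous_within
proof
  fix y assume y: "y \<in> frontier G"
  obtain \<epsilon> T V g g' where c: "hypograph_chart G y \<epsilon> T V g g'" by (rule smooth_boundary_chart[OF sm G y])
  interpret hypograph_chart G y \<epsilon> T V g g' by fact
  have "continuous (at y) (unit_normal T g')"
    using unit_normal_continuous \<epsilon> by (simp add: continuous_on_eq_continuous_at)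
  then have "continuous (at y within frontier G) (unit_normal T g')"
    by (rule continuous_at_imp_continuous_within)
  then show "continuous (at y within frontier G) n"
  proof (rule continuous_transform_within[OF _ \<epsilon> y])
    fix z assume z: "z \<in> frontier G" "dist z y < \<epsilon>"
    then have "z \<in> ball y \<epsilon>" by (simp add: dist_commute)
    from exterior_normal_eq[OF this z(1)] n z(1) show "unit_normal T g' z = n z" by metis
  qed
qed

lemma set_integrable_surface_measure:
  fixes h :: "'v::euclidean_space \<times> real \<Rightarrow> 'w::euclidean_space"
  assumes \<mu>: "is_surface_measure (frontier G) \<mu>" and sm: "smooth_boundary G" and G: "open G" "bounded G"
    and h: "continuous_on (frontier G) h"
  shows "set_integrable \<mu> (frontier G) h"
proof -
  have s\<mu>: "sets \<mu> = sets borel" using \<mu> by (simp add: is_surface_measure_def)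
  then have sp: "space \<mu> = UNIV" using sets_eq_imp_space_eq by force
  interpret finite_measure \<mu>
    by (rule finite_measureI) (use surface_measure_finite[OF \<mu> sm G] in \<open>simp add: sp\<close>)
  have "bounded (h ` frontier G)"
    by (intro compact_imp_bounded compact_continuous_image h compact_frontier_bounded G)
  then obtain C where C: "\<And>z. z \<in> frontier G \<Longrightarrow> norm (h z) \<le> C" "C > 0"
    unfolding bounded_pos by auto
  have "(\<lambda>z. indicator (frontier G) z *\<^sub>R h z) \<in> borel_measurable borel"
    by (rule borel_measurable_continuous_on_indicator[OF _ h]) simp
  then have "(\<lambda>z. indicator (frontier G) z *\<^sub>R h z) \<in> borel_measurable \<mu>"
    using s\<mu> measurable_cong_sets by blast
  then show ?thesis
    unfolding set_integrable_def
    by (rule integrable_const_bound[rotated, where B=C]) (auto simp: indicator_def C less_imp_le)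
qed

lemma positive_lower_bound_compact:
  fixes b :: "'a::topological_space \<Rightarrow> real"
  assumes "compact S" "continuous_on S b" "\<And>z. z \<in> S \<Longrightarrow> b z > 0"
  shows "\<exists>m>0. \<forall>z\<in>S. m < b z"
proof (cases "S = {}")
  case True
  then show ?thesis by (intro exI[of _ 1]) simp
next
  case False
  from continuous_attains_inf[OF assms(1) False assms(2)]
  obtain z0 where z0: "z0 \<in> S" "\<And>z. z \<in> S \<Longrightarrow> b z0 \<le> b z" by blast
  show ?thesis
  proof (intro exI[of _ "b z0 / 2"] conjI ballI)
    show "b z0 / 2 > 0" using assms(3)[OF z0(1)] by simp
    show "b z0 / 2 < b z" if "z \<in> S" for z using assms(3)[OF z0(1)] z0(2)[OF that] by simp
  qed
qed

text \<open>The measure is carried by the frontier, where \<open>n\<close> is the unit normal of the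
  chart; so the flux formula of the chart turns into an integral with respect to
  \<open>\<mu>\<close>.\<close>

lemma boundary_flux:
  fixes \<phi> :: "'v::euclidean_space \<times> real \<Rightarrow> 'w::euclidean_space"
  assumes \<mu>: "is_surface_measure (frontier G) \<mu>" and c: "hypograph_chart G y \<epsilon> T V g g'"
    and n: "\<forall>z\<in>frontier G. unit_exterior_normal G z (n z)"
    and C1: "C1_on UNIV \<phi>" and K: "compact K" "\<And>z. z \<notin> K \<Longrightarrow> \<phi> z = 0" "K \<subseteq> ball y \<epsilon>"
    and int: "set_integrable \<mu> (frontier G) (\<lambda>z. (n z \<bullet> v) *\<^sub>R \<phi> z)"
  shows "(\<integral>z. indicator G z *\<^sub>R frechet_derivative \<phi> (at z) v \<partial>lborel) =
    (LINT z:frontier G|\<mu>. (n z \<bullet> v) *\<^sub>R \<phi> z)"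
proof -
  interpret hypograph_chart G y \<epsilon> T V g g' by fact
  let ?h = "\<lambda>z. (unit_normal T g' z \<bullet> v) *\<^sub>R \<phi> z"
  have s\<mu>: "sets \<mu> = sets borel" and off: "emeasure \<mu> (- frontier G) = 0"
    using \<mu> by (auto simp: is_surface_measure_def)
  have fl: "integrable chart_measure ?h"
    "(\<integral>z. indicator G z *\<^sub>R frechet_derivative \<phi> (at z) v \<partial>lborel) = (\<integral>z. ?h z \<partial>chart_measure)"
    by (rule flux[OF C1 K], assumption)+
  have hm: "?h \<in> borel_measurable borel"
    using borel_measurable_integrable[OF fl(1)] measurable_cong_sets[OF sets_graph_measure refl] by blast
  have h0: "?h z = 0" if "z \<notin> ball y \<epsilon>" for z
  proof -
    have "z \<notin> K" using K(3) that by blast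
    then show ?thesis by (simp add: K(2))
  qed
  have "(\<integral>z. ?h z \<partial>chart_measure) = (\<integral>z. ?h z \<partial>\<mu>)"
    by (rule integral_surface_measure(1)[OF \<mu> c hm h0, symmetric])
  also have "\<dots> = (\<integral>z. indicator (frontier G) z *\<^sub>R ((n z \<bullet> v) *\<^sub>R \<phi> z) \<partial>\<mu>)"
  proof (rule integral_cong_AE)
    show "?h \<in> borel_measurable \<mu>" using hm s\<mu> measurable_cong_sets by blast
    show "(\<lambda>z. indicator (frontier G) z *\<^sub>R ((n z \<bullet> v) *\<^sub>R \<phi> z)) \<in> borel_measurable \<mu>"
      using int unfolding set_integrable_def by (rule borel_measurable_integrable)
    have "AE z in \<mu>. z \<in> frontier G"
      by (rule AE_I[OF _ off]) (auto simp: s\<mu>)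
    then show "AE z in \<mu>. ?h z = indicator (frontier G) z *\<^sub>R ((n z \<bullet> v) *\<^sub>R \<phi> z)"
    proof eventually_elim
      case (elim z)
      show ?case
      proof (cases "z \<in> ball y \<epsilon>")
        case True
        have "n z = unit_normal T g' z"
          by (rule exterior_normal_eq[OF True elim]) (use n elim in blast)
        then show ?thesis using elim by simp
      next
        case False
        then have "z \<notin> K" using K(3) by blast
        then have "\<phi> z = 0" by (rule K(2))
        then show ?thesis by simp
      qed
    qed
  qed
  finally show ?thesis using fl(2) by (simp add: set_lebesgue_integral_def)
qed

text \<open>\<open>\<phi>\<close> is split by functions supported in chart balls, treated by
  \<open>boundary_flux\<close>, and a remainder that vanishes near the frontier, whose derivative
  integrates to 0.\<close>

theorem divergence_theorem:
  fixes G :: "('v::euclidean_space \<times> real) set" and \<phi> :: "'v \<times> real \<Rightarrow> 'w::euclidean_space"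
  assumes \<mu>: "is_surface_measure (frontier G) \<mu>" and sm: "smooth_boundary G" and G: "open G" "bounded G"
    and n: "\<forall>z\<in>frontier G. unit_exterior_normal G z (n z)"
    and D: "open D" "closure G \<subseteq> D" and C1: "C1_on D \<phi>"
  shows "(LINT z:G|lborel. frechet_derivative \<phi> (at z) v) = (LINT z:frontier G|\<mu>. (n z \<bullet> v) *\<^sub>R \<phi> z)"
proof -
  let ?S = "frontier G"
  have SD: "?S \<subseteq> D" using D(2) by (auto simp: frontier_def)
  have cS: "compact ?S" by (rule compact_frontier_bounded[OF G(2)])
  have nc: "continuous_on ?S n" by (rule exterior_normal_continuous[OF sm G(1) n])
  have "\<forall>y\<in>?S. \<exists>\<epsilon>. ball y \<epsilon> \<subseteq> D \<and> \<epsilon> > 0 \<and> (\<exists>T V g g'. hypograph_chart G y \<epsilon> T V g g')"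
  proof
    fix y assume y: "y \<in> ?S"
    obtain \<epsilon> T V g g' where c: "hypograph_chart G y \<epsilon> T V g g'" by (rule smooth_boundary_chart[OF sm G(1) y])
    obtain d where d: "d > 0" "ball y d \<subseteq> D" using D(1) SD y open_contains_ball by blast
    have e: "\<epsilon> > 0" by (rule hypograph_chart.\<epsilon>[OF c])
    have "hypograph_chart G y (min \<epsilon> d) T V g g'"
      by (rule hypograph_chart.subchart[OF c]) (use d e in \<open>auto intro: subset_ball\<close>)
    moreover have "ball y (min \<epsilon> d) \<subseteq> D" using d(2) subset_ball[of "min \<epsilon> d" d y] by simp
    ultimately show "\<exists>\<epsilon>. ball y \<epsilon> \<subseteq> D \<and> \<epsilon> > 0 \<and> (\<exists>T V g g'. hypograph_chart G y \<epsilon> T V g g')"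
      using d(1) e by (intro exI[of _ "min \<epsilon> d"]) auto
  qed
  from bchoice[OF this] obtain \<epsilon> where \<epsilon>: "\<forall>y\<in>?S. ball y (\<epsilon> y) \<subseteq> D \<and> \<epsilon> y > 0 \<and> (\<exists>T V g g'. hypograph_chart G y (\<epsilon> y) T V g g')" ..
  \<comment> \<open>Half the radii, so that the closed balls supporting the partition functions are
    compact subsets of the chart balls.\<close>
  obtain Y where Y: "finite Y" "Y \<subseteq> ?S" "?S \<subseteq> (\<Union>y\<in>Y. ball y (\<epsilon> y / 2))"
  proof (rule compactE_image[OF cS, of ?S "\<lambda>y. ball y (\<epsilon> y / 2)"])
    have "y \<in> ball y (\<epsilon> y / 2)" if "y \<in> ?S" for y using \<epsilon> that by simp
    then show "?S \<subseteq> (\<Union>y\<in>?S. ball y (\<epsilon> y / 2))" by blast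
  qed (simp, blast)

  \<comment> \<open>The partition of unity\<close>
  define \<beta> where "\<beta> y z = pos_sq ((\<epsilon> y / 2)\<^sup>2 - (z - y) \<bullet> (z - y))" for y z
  define b where "b z = (\<Sum>y\<in>Y. \<beta> y z)" for z
  have \<epsilon>Y: "\<epsilon> y > 0" "ball y (\<epsilon> y) \<subseteq> D" if "y \<in> Y" for y using \<epsilon> Y(2) that by blast+
  have \<beta>0: "\<beta> y z \<ge> 0" for y z by (simp add: \<beta>_def pos_sq_nonneg)
  have \<beta>pos: "\<beta> y z > 0 \<longleftrightarrow> z \<in> ball y (\<epsilon> y / 2)" if "y \<in> Y" for y z
  proof -
    have "\<beta> y z > 0 \<longleftrightarrow> (norm (z - y))\<^sup>2 < (\<epsilon> y / 2)\<^sup>2"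
      by (simp add: \<beta>_def pos_sq_pos_iff dot_square_norm)
    also have "\<dots> \<longleftrightarrow> norm (z - y) < \<epsilon> y / 2"
      using \<epsilon>Y(1)[OF that] power_mono_iff[of "\<epsilon> y / 2" "norm (z - y)" 2] by (simp add: not_le[symmetric] del: power_mono_iff)
    finally show ?thesis by (simp add: dist_norm norm_minus_commute)
  qed
  have C1\<beta>: "C1_on UNIV (\<beta> y)" for y
    unfolding \<beta>_def[abs_def]
    by (intro C1_on_pos_sq C1_on_diff C1_on_const C1_on_inner C1_on_linear[OF bounded_linear_ident])
  have C1b: "C1_on UNIV b" unfolding b_def[abs_def] by (rule C1_on_sum[OF Y(1) C1\<beta>])
  have b0: "b z \<ge> 0" for z unfolding b_def by (rule sum_nonneg) (rule \<beta>0)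
  have bpos: "b z > 0" if "z \<in> ?S" for z
  proof -
    from subsetD[OF Y(3) that] obtain y where y: "y \<in> Y" "z \<in> ball y (\<epsilon> y / 2)" by blast
    have "0 < \<beta> y z" using \<beta>pos[OF y(1)] y(2) by blast
    also have "\<beta> y z \<le> b z" unfolding b_def by (rule member_le_sum[OF y(1) \<beta>0 Y(1)])
    finally show ?thesis .
  qed
  have bc: "continuous_on X b" for X
    by (rule continuous_on_subset[OF C1_on_continuous[OF C1b]]) simp
  obtain m where m: "m > 0" "\<And>z. z \<in> ?S \<Longrightarrow> m < b z"
    using positive_lower_bound_compact[OF cS bc] bpos by blast
  \<comment> \<open>Positive exactly where \<open>b < m\<close>. So \<open>b + b1\<close> is
    positive everywhere, while \<open>b1\<close> vanishes on the neighbourhood of the frontier where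
    \<open>b\<close> exceeds \<open>m\<close>.\<close>
  define b1 where "b1 z = pos_sq (m - b z)" for z
  define \<tau> where "\<tau> z = b z + b1 z" for z
  have \<tau>: "\<tau> z > 0" for z
  proof (cases "b z < m")
    case True
    then have "b1 z > 0" by (simp add: b1_def pos_sq_pos_iff)
    then show ?thesis using b0[of z] by (simp add: \<tau>_def)
  next
    case False
    then show ?thesis using m(1) pos_sq_nonneg[of "m - b z"] by (simp add: \<tau>_def b1_def)
  qed
  have C1b1: "C1_on UNIV b1" unfolding b1_def[abs_def] by (intro C1_on_pos_sq C1_on_diff C1_on_const C1b)
  have C1\<tau>: "C1_on UNIV \<tau>" unfolding \<tau>_def[abs_def] by (intro C1_on_add C1b C1b1)
  have C1inv: "C1_on UNIV (\<lambda>z. inverse (\<tau> z))"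
  proof (rule C1_on_compose_real[OF C1\<tau>, where \<rho>'="\<lambda>t. - inverse (t\<^sup>2)"])
    have nz: "t \<noteq> 0" if "t \<in> range \<tau>" for t using \<tau> that by (auto simp: less_le)
    show "(inverse has_real_derivative - inverse (t\<^sup>2)) (at t)" if "t \<in> range \<tau>" for t
      using DERIV_inverse[OF nz[OF that]] by (simp add: power2_eq_square)
    show "continuous_on (range \<tau>) (\<lambda>t. - inverse (t\<^sup>2))"
      using nz by (intro continuous_intros) simp
  qed
  define \<theta> where "\<theta> y z = \<beta> y z * inverse (\<tau> z)" for y z
  define \<theta>1 where "\<theta>1 z = b1 z * inverse (\<tau> z)" for z
  have C1\<theta>: "C1_on UNIV (\<theta> y)" for y unfolding \<theta>_def[abs_def] by (intro C1_on_mult C1\<beta> C1inv)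
  have C1\<theta>1: "C1_on UNIV \<theta>1" unfolding \<theta>1_def[abs_def] by (intro C1_on_mult C1b1 C1inv)
  have one: "(\<Sum>y\<in>Y. \<theta> y z) + \<theta>1 z = 1" for z
    using \<tau>[of z] by (simp add: \<theta>_def \<theta>1_def sum_distrib_right[symmetric] b_def[symmetric] distrib_right[symmetric] \<tau>_def[symmetric])
  have \<theta>1S: "\<theta>1 z = 0" if "m \<le> b z" for z using that by (simp add: \<theta>1_def b1_def pos_sq_zero_iff)
  have \<theta>off: "\<theta> y z = 0" if "y \<in> Y" "z \<notin> cball y (\<epsilon> y / 2)" for y z
  proof -
    have "\<not> \<beta> y z > 0" using \<beta>pos[OF that(1), of z] that(2) ball_subset_cball by blast
    then show ?thesis using \<beta>0[of y z] by (simp add: \<theta>_def)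
  qed

  \<comment> \<open>The boundary pieces and the interior piece of the field\<close>
  define \<phi>b where "\<phi>b y z = (if z \<in> D then \<theta> y z *\<^sub>R \<phi> z else 0)" for y z
  define \<phi>i where "\<phi>i z = (if z \<in> G then \<theta>1 z *\<^sub>R \<phi> z else 0)" for z
  have GD: "G \<subseteq> D" using D(2) closure_subset by blast
  let ?K = "\<lambda>y. cball y (\<epsilon> y / 2)"
  have Kb: "?K y \<subseteq> ball y (\<epsilon> y)" if "y \<in> Y" for y
    using \<epsilon>Y(1)[OF that] by (simp add: cball_subset_ball_iff)
  have C1\<phi>b: "C1_on UNIV (\<phi>b y)" if "y \<in> Y" for y
    unfolding \<phi>b_def[abs_def]
  proof (rule C1_on_extend_zero[OF _ D(1), of _ "?K y"])
    show "C1_on D (\<lambda>z. \<theta> y z *\<^sub>R \<phi> z)"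
      by (intro C1_on_scaleR C1 C1_on_subset[OF C1\<theta>]) simp
    show "?K y \<subseteq> D" using Kb[OF that] \<epsilon>Y(2)[OF that] by (rule subset_trans)
    show "\<theta> y z *\<^sub>R \<phi> z = 0" if "z \<notin> ?K y" for z using \<theta>off[OF \<open>y \<in> Y\<close> that] by simp
  qed simp
  have \<phi>b0: "\<phi>b y z = 0" if "y \<in> Y" "z \<notin> ?K y" for y z
    using \<theta>off[OF that] by (simp add: \<phi>b_def)
  \<comment> \<open>On the frontier \<open>b\<close> is strictly larger than \<open>m\<close>, so
    this compact set lies in the open set \<open>G\<close> and the interior piece extends by
    zero.\<close>
  let ?Ki = "closure G \<inter> {z. b z \<le> m}"
  have "closed {z. b z \<le> m}" by (intro closed_Collect_le continuous_intros bc)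
  then have Ki: "compact ?Ki" using G(2) by (intro compact_Int_closed) (auto simp: compact_closure)
  have KiG: "?Ki \<subseteq> G"
  proof
    fix z assume z: "z \<in> ?Ki"
    then have "z \<notin> ?S" using m(2)[of z] by (auto simp: not_le)
    then show "z \<in> G" using z G(1) by (auto simp: frontier_def interior_open)
  qed
  have C1\<phi>i: "C1_on UNIV \<phi>i"
    unfolding \<phi>i_def[abs_def]
  proof (rule C1_on_extend_zero[OF _ G(1), of _ ?Ki])
    show "C1_on G (\<lambda>z. \<theta>1 z *\<^sub>R \<phi> z)"
      by (intro C1_on_scaleR C1_on_subset[OF C1] C1_on_subset[OF C1\<theta>1] GD) simp
    show "\<theta>1 z *\<^sub>R \<phi> z = 0" if "z \<in> G" "z \<notin> ?Ki" for z
      using that \<theta>1S[of z] closure_subset[of G] by auto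
  qed (use KiG compact_imp_closed[OF Ki] in simp_all)
  have \<phi>i0: "\<phi>i z = 0" if "z \<notin> ?Ki" for z
    using that \<theta>1S[of z] closure_subset[of G] by (auto simp: \<phi>i_def)
  have split: "frechet_derivative \<phi> (at z) v = (\<Sum>y\<in>Y. frechet_derivative (\<phi>b y) (at z) v) + frechet_derivative \<phi>i (at z) v"
    if z: "z \<in> G" for z
  proof -
    have "((\<lambda>z. (\<Sum>y\<in>Y. \<phi>b y z) + \<phi>i z) has_derivative
      (\<lambda>v. (\<Sum>y\<in>Y. frechet_derivative (\<phi>b y) (at z) v) + frechet_derivative \<phi>i (at z) v)) (at z)"
      by (intro has_derivative_add has_derivative_sum C1_on_has_derivative[OF C1\<phi>b] C1_on_has_derivative[OF C1\<phi>i]) auto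
    from frechet_derivative_at[OF this]
    have "frechet_derivative (\<lambda>z. (\<Sum>y\<in>Y. \<phi>b y z) + \<phi>i z) (at z) v =
      (\<Sum>y\<in>Y. frechet_derivative (\<phi>b y) (at z) v) + frechet_derivative \<phi>i (at z) v"
      by (rule fun_cong[symmetric])
    moreover have "frechet_derivative \<phi> (at z) = frechet_derivative (\<lambda>z. (\<Sum>y\<in>Y. \<phi>b y z) + \<phi>i z) (at z)"
    proof (rule frechet_derivative_eq_on_open[OF G(1) z])
      fix z assume z: "z \<in> G"
      have "(\<Sum>y\<in>Y. \<phi>b y z) + \<phi>i z = ((\<Sum>y\<in>Y. \<theta> y z) + \<theta>1 z) *\<^sub>R \<phi> z"
        using z GD by (auto simp: \<phi>b_def \<phi>i_def scaleR_left_distrib scaleR_left.sum)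
      then show "\<phi> z = (\<Sum>y\<in>Y. \<phi>b y z) + \<phi>i z" by (simp add: one)
    qed
    ultimately show ?thesis by simp
  qed
  have intb: "integrable lborel (\<lambda>z. indicator G z *\<^sub>R frechet_derivative (\<phi>b y) (at z) v)" if "y \<in> Y" for y
  proof (rule integrable_mult_indicator)
    show "integrable lborel (\<lambda>z. frechet_derivative (\<phi>b y) (at z) v)"
      by (rule C1_compact_support(2)[OF C1\<phi>b[OF that] compact_cball \<phi>b0[OF that]])
  qed (use G(1) in auto)
  have inti: "integrable lborel (\<lambda>z. indicator G z *\<^sub>R frechet_derivative \<phi>i (at z) v)"
  proof (rule integrable_mult_indicator)
    show "integrable lborel (\<lambda>z. frechet_derivative \<phi>i (at z) v)"
      by (rule C1_compact_support(2)[OF C1\<phi>i Ki \<phi>i0])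
  qed (use G(1) in auto)
  \<comment> \<open>The interior piece is supported in \<open>G\<close>, so the integral may be
    taken over the whole space.\<close>
  have zero: "(\<integral>z. indicator G z *\<^sub>R frechet_derivative \<phi>i (at z) v \<partial>lborel) = 0"
  proof -
    have "indicator G z *\<^sub>R frechet_derivative \<phi>i (at z) v = indicator UNIV z *\<^sub>R frechet_derivative \<phi>i (at z) v" for z
    proof (cases "z \<in> ?Ki")
      case True
      then show ?thesis using KiG by auto
    next
      case False
      have "frechet_derivative \<phi>i (at z) v = 0" by (rule C1_compact_support(4)[OF C1\<phi>i Ki \<phi>i0 False])
      then show ?thesis by simp
    qed
    then show ?thesis using integral_derivative_zero[OF C1\<phi>i Ki \<phi>i0, of UNIV v] by simp
  qed
  have setb: "set_integrable \<mu> ?S (\<lambda>z. (n z \<bullet> v) *\<^sub>R \<phi>b y z)" if "y \<in> Y" for y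
    by (intro set_integrable_surface_measure[OF \<mu> sm G] continuous_intros nc
        continuous_on_subset[OF C1_on_continuous[OF C1\<phi>b[OF that]]]) simp
  have fl: "(\<integral>z. indicator G z *\<^sub>R frechet_derivative (\<phi>b y) (at z) v \<partial>lborel) = (LINT z:?S|\<mu>. (n z \<bullet> v) *\<^sub>R \<phi>b y z)" if y: "y \<in> Y" for y
  proof -
    have "y \<in> ?S" using y Y(2) by blast
    then obtain T V g g' where c: "hypograph_chart G y (\<epsilon> y) T V g g'" using \<epsilon> by blast
    show ?thesis
      by (rule boundary_flux[OF \<mu> c n C1\<phi>b[OF y] compact_cball \<phi>b0[OF y] Kb[OF y] setb[OF y]])
  qed
  have "(LINT z:G|lborel. frechet_derivative \<phi> (at z) v) =
      (\<integral>z. (\<Sum>y\<in>Y. indicator G z *\<^sub>R frechet_derivative (\<phi>b y) (at z) v) + indicator G z *\<^sub>R frechet_derivative \<phi>i (at z) v \<partial>lborel)"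
    unfolding set_lebesgue_integral_def
  proof (rule Bochner_Integration.integral_cong[OF refl])
    fix z
    show "indicator G z *\<^sub>R frechet_derivative \<phi> (at z) v =
      (\<Sum>y\<in>Y. indicator G z *\<^sub>R frechet_derivative (\<phi>b y) (at z) v) + indicator G z *\<^sub>R frechet_derivative \<phi>i (at z) v"
      by (cases "z \<in> G") (simp_all add: split)
  qed
  also have "\<dots> = (\<integral>z. (\<Sum>y\<in>Y. indicator G z *\<^sub>R frechet_derivative (\<phi>b y) (at z) v) \<partial>lborel) +
      (\<integral>z. indicator G z *\<^sub>R frechet_derivative \<phi>i (at z) v \<partial>lborel)"
    by (intro Bochner_Integration.integral_add Bochner_Integration.integrable_sum intb inti)
  also have "\<dots> = (\<Sum>y\<in>Y. \<integral>z. indicator G z *\<^sub>R frechet_derivative (\<phi>b y) (at z) v \<partial>lborel)"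
    unfolding zero add_0_right by (rule Bochner_Integration.integral_sum[OF intb])
  also have "\<dots> = (\<Sum>y\<in>Y. LINT z:?S|\<mu>. (n z \<bullet> v) *\<^sub>R \<phi>b y z)"
    by (intro sum.cong refl fl)
  also have "\<dots> = (\<integral>z. (\<Sum>y\<in>Y. indicator ?S z *\<^sub>R ((n z \<bullet> v) *\<^sub>R \<phi>b y z)) \<partial>\<mu>)"
    unfolding set_lebesgue_integral_def
    by (rule Bochner_Integration.integral_sum[symmetric]) (rule setb[unfolded set_integrable_def])
  also have "\<dots> = (LINT z:?S|\<mu>. (n z \<bullet> v) *\<^sub>R \<phi> z)"
    unfolding set_lebesgue_integral_def
  proof (rule Bochner_Integration.integral_cong[OF refl])
    fix z
    show "(\<Sum>y\<in>Y. indicator ?S z *\<^sub>R ((n z \<bullet> v) *\<^sub>R \<phi>b y z)) = indicator ?S z *\<^sub>R ((n z \<bullet> v) *\<^sub>R \<phi> z)"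
    proof (cases "z \<in> ?S")
      case True
      have "(\<Sum>y\<in>Y. \<theta> y z) = 1" using one[of z] \<theta>1S[of z] m(2)[OF True] by simp
      then have "(\<Sum>y\<in>Y. \<phi>b y z) = \<phi> z"
        using True SD by (auto simp: \<phi>b_def scaleR_left.sum[symmetric])
      then show ?thesis by (simp add: scaleR_right.sum[symmetric])
    qed simp
  qed
  finally show ?thesis .
qed

section \<open>The regularised Cauchy kernel\<close>

text \<open>A substitute for polar coordinates: a radial function is written as an integral over
  \<open>s\<close> from \<open>norm z\<close> to \<open>R\<close>, and exchanging the integrals
  leaves the volumes of balls of radius \<open>s\<close>.\<close>

lemma nn_integral_radial:
  fixes k :: "real \<Rightarrow> ennreal"
  assumes [measurable]: "k \<in> borel_measurable borel"
  shows "(\<integral>\<^sup>+z. (\<integral>\<^sup>+s. (if norm (z::'e::euclidean_space) \<le> s \<and> s \<le> R then k s else 0) \<partial>lborel) \<partial>lborel) =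
    (\<integral>\<^sup>+s. (if 0 \<le> s \<and> s \<le> R then k s * ennreal (unit_ball_vol (DIM('e)) * s ^ DIM('e)) else 0) \<partial>lborel)"
proof -
  have "(\<integral>\<^sup>+z. (\<integral>\<^sup>+s. (if norm (z::'e) \<le> s \<and> s \<le> R then k s else 0) \<partial>lborel) \<partial>lborel) =
    (\<integral>\<^sup>+s. (\<integral>\<^sup>+z. (if norm (z::'e) \<le> s \<and> s \<le> R then k s else 0) \<partial>lborel) \<partial>lborel)"
    by (rule lborel_pair.Fubini'[symmetric]) measurable
  also have "\<dots> = (\<integral>\<^sup>+s. (if 0 \<le> s \<and> s \<le> R then k s * ennreal (unit_ball_vol (DIM('e)) * s ^ DIM('e)) else 0) \<partial>lborel)"
  proof (rule nn_integral_cong)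
    fix s :: real
    show "(\<integral>\<^sup>+z. (if norm (z::'e) \<le> s \<and> s \<le> R then k s else 0) \<partial>lborel) =
      (if 0 \<le> s \<and> s \<le> R then k s * ennreal (unit_ball_vol (DIM('e)) * s ^ DIM('e)) else 0)"
    proof (cases "0 \<le> s \<and> s \<le> R")
      case True
      then have "(\<integral>\<^sup>+z. (if norm (z::'e) \<le> s \<and> s \<le> R then k s else 0) \<partial>lborel) =
          (\<integral>\<^sup>+z. k s * indicator (cball (0::'e) s) z \<partial>lborel)"
        by (intro nn_integral_cong) (auto simp: indicator_def)
      also have "\<dots> = k s * emeasure lborel (cball (0::'e) s)"
        by (rule nn_integral_cmult_indicator) simp
      also have "\<dots> = k s * ennreal (unit_ball_vol (DIM('e)) * s ^ DIM('e))"
        using True by (simp add: emeasure_cball)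
      finally show ?thesis using True by simp
    next
      case False
      have "\<not> (norm z \<le> s \<and> s \<le> R)" for z :: 'e
        using False norm_ge_zero[of z] by linarith
      then show ?thesis using False by (simp only: if_False nn_integral_const mult_zero_left)
    qed
  qed
  finally show ?thesis .
qed

lemma nn_integral_Icc_FTC:
  fixes f F :: "real \<Rightarrow> real"
  assumes "f \<in> borel_measurable borel" "a \<le> b"
    "\<And>s. a \<le> s \<Longrightarrow> s \<le> b \<Longrightarrow> (F has_real_derivative f s) (at s)" "\<And>s. a \<le> s \<Longrightarrow> s \<le> b \<Longrightarrow> 0 \<le> f s"
  shows "(\<integral>\<^sup>+s. (if a \<le> s \<and> s \<le> b then ennreal (f s) else 0) \<partial>lborel) = ennreal (F b - F a)"
proof -
  have "(\<integral>\<^sup>+s. (if a \<le> s \<and> s \<le> b then ennreal (f s) else 0) \<partial>lborel) =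
      (\<integral>\<^sup>+s. ennreal (f s) * indicator {a..b} s \<partial>lborel)"
    by (intro nn_integral_cong) (auto simp: indicator_def)
  also have "\<dots> = ennreal (F b - F a)"
    by (rule nn_integral_FTC_Icc[OF assms(1)])
      (use assms in \<open>auto intro: has_vector_derivative_at_within simp: has_real_derivative_iff_has_vector_derivative\<close>)
  finally show ?thesis .
qed

text \<open>The integrand is the integral of 2 s / d^2 from \<open>norm z\<close> to
  \<open>d\<close>, so \<open>nn_integral_radial\<close> leaves a power of \<open>s\<close> to
  integrate.\<close>

lemma nn_integral_paraboloid:
  fixes d :: real
  assumes d: "d > 0"
  shows "(\<integral>\<^sup>+z. ennreal (if norm (z::'e::euclidean_space) \<le> d then 1 - (norm z)\<^sup>2 / d\<^sup>2 else 0) \<partial>lborel) =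
    ennreal (2 * unit_ball_vol (DIM('e)) * d ^ DIM('e) / (real DIM('e) + 2))"
proof -
  let ?N = "DIM('e)" and ?V = "unit_ball_vol (DIM('e))"
  have V: "?V > 0" by simp
  have "ennreal (if norm z \<le> d then 1 - (norm z)\<^sup>2 / d\<^sup>2 else 0) =
      (\<integral>\<^sup>+s. (if norm z \<le> s \<and> s \<le> d then ennreal (2 * s / d\<^sup>2) else 0) \<partial>lborel)" for z :: 'e
  proof (cases "norm z \<le> d")
    case True
    have "(\<integral>\<^sup>+s. (if norm z \<le> s \<and> s \<le> d then ennreal (2 * s / d\<^sup>2) else 0) \<partial>lborel) =
        ennreal (d\<^sup>2 / d\<^sup>2 - (norm z)\<^sup>2 / d\<^sup>2)"
    proof (rule nn_integral_Icc_FTC[OF _ True, where F="\<lambda>s. s\<^sup>2 / d\<^sup>2"])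
      show "((\<lambda>s. s\<^sup>2 / d\<^sup>2) has_real_derivative 2 * s / d\<^sup>2) (at s)" for s
        by (rule DERIV_cdivide) (auto intro!: derivative_eq_intros)
      show "0 \<le> 2 * s / d\<^sup>2" if "norm z \<le> s" for s
        using order_trans[OF norm_ge_zero that] by simp
    qed measurable
    then show ?thesis using True d by simp
  next
    case False
    then have "\<not> (norm z \<le> s \<and> s \<le> d)" for s by linarith
    then show ?thesis using False by (simp only: if_False nn_integral_const mult_zero_left ennreal_0)
  qed
  then have "(\<integral>\<^sup>+z. ennreal (if norm (z::'e) \<le> d then 1 - (norm z)\<^sup>2 / d\<^sup>2 else 0) \<partial>lborel) =
      (\<integral>\<^sup>+s. (if 0 \<le> s \<and> s \<le> d then ennreal (2 * s / d\<^sup>2) * ennreal (?V * s ^ ?N) else 0) \<partial>lborel)"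
    by (simp only:) (rule nn_integral_radial, measurable)
  also have "\<dots> = (\<integral>\<^sup>+s. (if 0 \<le> s \<and> s \<le> d then ennreal (2 * ?V * s ^ (?N + 1) / d\<^sup>2) else 0) \<partial>lborel)"
    using V by (intro nn_integral_cong) (auto simp: ennreal_mult[symmetric])
  also have "\<dots> = ennreal (2 * ?V * d ^ (?N + 2) / ((real ?N + 2) * d\<^sup>2) - 2 * ?V * 0 ^ (?N + 2) / ((real ?N + 2) * d\<^sup>2))"
  proof (rule nn_integral_Icc_FTC[where F="\<lambda>s. 2 * ?V * s ^ (?N + 2) / ((real ?N + 2) * d\<^sup>2)"])
    show "((\<lambda>s. 2 * ?V * s ^ (?N + 2) / ((real ?N + 2) * d\<^sup>2)) has_real_derivative 2 * ?V * s ^ (?N + 1) / d\<^sup>2) (at s)" for s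
    proof -
      have "((\<lambda>s. s ^ (?N + 2)) has_real_derivative (real ?N + 2) * s ^ (?N + 1)) (at s)"
        using DERIV_pow[of "?N + 2" s] by (simp add: add.commute)
      then have "((\<lambda>s. (2 * ?V / ((real ?N + 2) * d\<^sup>2)) * s ^ (?N + 2)) has_real_derivative
          (2 * ?V / ((real ?N + 2) * d\<^sup>2)) * ((real ?N + 2) * s ^ (?N + 1))) (at s)"
        by (rule DERIV_cmult)
      moreover have "(2 * v / (K * d\<^sup>2)) * (K * x) = 2 * v * x / d\<^sup>2" if "K \<noteq> 0" for K v x :: real
        using that d by (simp add: field_simps)
      ultimately show ?thesis by (simp add: mult.assoc)
    qed
  qed (use d V in auto)
  also have "2 * ?V * d ^ (?N + 2) / ((real ?N + 2) * d\<^sup>2) - 2 * ?V * 0 ^ (?N + 2) / ((real ?N + 2) * d\<^sup>2) =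
      2 * ?V * d ^ ?N / (real ?N + 2)"
    using d by (simp add: power_add power2_eq_square)
  finally show ?thesis .
qed

text \<open>Up to the constant 1 / R^M the function is the integral of M / s^(M+1) from
  \<open>norm z\<close> to \<open>R\<close>. In dimension M + 1 the volume of the ball of radius
  \<open>s\<close> cancels the singularity and leaves a constant.\<close>

lemma integrable_inverse_norm_power:
  assumes "DIM('e::euclidean_space) = Suc M" and M: "M > 0" and R: "R > 0"
  shows "integrable lborel (\<lambda>z::'e. indicator (cball 0 R) z * (1 / norm z ^ M))"
proof (rule integrableI_nonneg)
  let ?V = "unit_ball_vol (DIM('e))"
  show "(\<lambda>z::'e. indicator (cball 0 R) z * (1 / norm z ^ M)) \<in> borel_measurable lborel"
    by (intro borel_measurable_times borel_measurable_indicator borel_measurable_divide borel_measurable_const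
        borel_measurable_power borel_measurable_norm) simp_all
  define I where "I z = (\<integral>\<^sup>+s. (if norm (z::'e) \<le> s \<and> s \<le> R then ennreal (M / s ^ Suc M) else 0) \<partial>lborel)" for z
  have I: "I z = ennreal (1 / norm z ^ M - 1 / R ^ M)" if z: "z \<noteq> 0" "norm z \<le> R" for z
  proof -
    have "I z = ennreal ((- 1 / R ^ M) - (- 1 / norm z ^ M))"
      unfolding I_def
    proof (rule nn_integral_Icc_FTC[OF _ z(2), where F="\<lambda>s. - 1 / s ^ M"])
      fix s assume s: "norm z \<le> s"
      then have s0: "s > 0" using z(1) by (meson less_le_trans zero_less_norm_iff)
      obtain m where m: "M = Suc m" using M by (cases M) auto
      have "((\<lambda>s. s ^ M) has_real_derivative M * s ^ m) (at s)"
        using DERIV_pow[of M s] by (simp add: m)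
      then have "((\<lambda>s. - inverse (s ^ M)) has_real_derivative - (- (inverse (s ^ M) * (M * s ^ m) * inverse (s ^ M)))) (at s)"
        using s0 by (intro DERIV_minus DERIV_inverse') auto
      moreover have "inverse (s ^ M) * (M * s ^ m) * inverse (s ^ M) = M / s ^ Suc M"
        using s0 by (simp add: m field_simps)
      ultimately show "((\<lambda>s. - 1 / s ^ M) has_real_derivative M / s ^ Suc M) (at s)"
        by (simp add: divide_inverse)
      show "0 \<le> real M / s ^ Suc M" using s0 by simp
    qed measurable
    then show ?thesis by simp
  qed
  have Im[measurable]: "I \<in> borel_measurable borel" unfolding I_def by measurable
  have "(\<integral>\<^sup>+z. I z \<partial>lborel) = (\<integral>\<^sup>+s. (if 0 \<le> s \<and> s \<le> R then ennreal (M / s ^ Suc M) * ennreal (?V * s ^ DIM('e)) else 0) \<partial>lborel)"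
    unfolding I_def by (rule nn_integral_radial) measurable
  also have "\<dots> \<le> (\<integral>\<^sup>+s. ennreal (M * ?V) * indicator {0..R} s \<partial>lborel)"
  proof (rule nn_integral_mono)
    fix s :: real
    show "(if 0 \<le> s \<and> s \<le> R then ennreal (M / s ^ Suc M) * ennreal (?V * s ^ DIM('e)) else 0) \<le> ennreal (M * ?V) * indicator {0..R} s"
    proof (cases "0 < s \<and> s \<le> R")
      case True
      then show ?thesis by (simp add: ennreal_mult[symmetric] assms(1))
    next
      case False
      then show ?thesis by (auto simp: indicator_def assms(1))
    qed
  qed
  also have "\<dots> = ennreal (M * ?V) * emeasure lborel {0..R}" by (simp add: nn_integral_cmult_indicator)
  also have "\<dots> < \<infinity>" using R by (simp add: ennreal_mult_less_top)
  finally have J: "(\<integral>\<^sup>+z. I z \<partial>lborel) < \<infinity>" .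
  have "(\<integral>\<^sup>+z. ennreal (indicator (cball 0 R) z * (1 / norm (z::'e) ^ M)) \<partial>lborel)
      \<le> (\<integral>\<^sup>+z. I z + ennreal (1 / R ^ M) * indicator (cball 0 R) z \<partial>lborel)"
  proof (rule nn_integral_mono)
    fix z :: 'e
    show "ennreal (indicator (cball 0 R) z * (1 / norm z ^ M)) \<le> I z + ennreal (1 / R ^ M) * indicator (cball 0 R) z"
    proof (cases "z \<noteq> 0 \<and> norm z \<le> R")
      case True
      have "ennreal (1 / norm z ^ M) = ennreal (1 / norm z ^ M - 1 / R ^ M) + ennreal (1 / R ^ M)"
        using True R by (subst ennreal_plus[symmetric]) (auto simp: frac_le power_mono)
      then show ?thesis using True by (simp add: I)
    next
      case False
      \<comment> \<open>At the origin the function has the default value 0, since division by zero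
        yields 0 and \<open>M > 0\<close>.\<close>
      then show ?thesis using M by (auto simp: indicator_def zero_power)
    qed
  qed
  also have "\<dots> = (\<integral>\<^sup>+z. I z \<partial>lborel) + ennreal (1 / R ^ M) * emeasure lborel (cball (0::'e) R)"
  proof (subst nn_integral_add)
    show "I \<in> borel_measurable lborel" using Im by simp
    show "(\<lambda>z. ennreal (1 / R ^ M) * indicator (cball 0 R) z) \<in> borel_measurable lborel"
      by (intro borel_measurable_times_ennreal borel_measurable_const borel_measurable_indicator) simp
  qed (simp add: nn_integral_cmult_indicator)
  also have "\<dots> < \<infinity>" using J by (simp add: emeasure_cball less_imp_le[OF R] ennreal_mult_less_top)
  finally show "(\<integral>\<^sup>+z. ennreal (indicator (cball 0 R) z * (1 / norm (z::'e) ^ M)) \<partial>lborel) < \<infinity>" .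
qed simp

text \<open>The function \<open>q = regularized_power N d\<close> is \<open>t powr (- N / 2)\<close> for \<open>t \<ge> d\<^sup>2\<close>, continued to the left by its
  tangent line at \<open>d\<^sup>2\<close>; the divergence of \<open>q ((norm w)\<^sup>2) w\<close> is then a paraboloid supported in the ball of
  radius \<open>d\<close>, an approximation of the point mass at the origin.\<close>

definition regularized_power :: "nat \<Rightarrow> real \<Rightarrow> real \<Rightarrow> real" where
  "regularized_power N d t = (let m = max t (d\<^sup>2) in m powr (- (real N / 2)) + N / 2 * m powr (- (real N / 2) - 1) * (m - t))"

definition regularized_power_deriv :: "nat \<Rightarrow> real \<Rightarrow> real \<Rightarrow> real" where
  "regularized_power_deriv N d t = - (real N / 2) * max t (d\<^sup>2) powr (- (real N / 2) - 1)"

text \<open>The leading constant is the reciprocal of the integral computed in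
  \<open>nn_integral_paraboloid\<close>, so the bump has mass 1 when \<open>N\<close> is the
  dimension.\<close>

definition paraboloid_bump :: "nat \<Rightarrow> real \<Rightarrow> 'e::euclidean_space \<Rightarrow> real" where
  "paraboloid_bump N d w = (real N + 2) / (2 * unit_ball_vol N * d ^ N) * (if norm w \<le> d then 1 - (norm w)\<^sup>2 / d\<^sup>2 else 0)"

lemma regularized_power_has_derivative:
  assumes d: "d > 0"
  shows "(regularized_power N d has_real_derivative regularized_power_deriv N d t) (at t)"
proof -
  let ?f = "\<lambda>t. (d\<^sup>2) powr (- (real N / 2)) + N / 2 * (d\<^sup>2) powr (- (real N / 2) - 1) * (d\<^sup>2 - t)"
  let ?g = "\<lambda>t. t powr (- (real N / 2))"
  have eq: "regularized_power N d = (\<lambda>t. if t \<le> d\<^sup>2 then ?f t else ?g t)"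
  proof
    fix t show "regularized_power N d t = (if t \<le> d\<^sup>2 then ?f t else ?g t)"
      by (cases "t \<le> d\<^sup>2") (simp_all add: regularized_power_def Let_def max_def)
  qed
  have eq': "regularized_power_deriv N d t = (if t \<le> d\<^sup>2 then - (real N / 2) * (d\<^sup>2) powr (- (real N / 2) - 1) else - (real N / 2) * t powr (- (real N / 2) - 1))"
    by (cases "t \<le> d\<^sup>2") (simp_all add: regularized_power_deriv_def max_def)
  have lin: "((\<lambda>t. A + B * (c - t)) has_real_derivative - B) (at t)" for A B c t :: real
    by (auto intro!: derivative_eq_intros)
  show ?thesis
    unfolding eq eq'
  proof (rule real_glue_derivative)
    show "(?f has_real_derivative - (real N / 2) * (d\<^sup>2) powr (- (real N / 2) - 1)) (at t)" for t
      using lin[of "(d\<^sup>2) powr (- (real N / 2))" "N / 2 * (d\<^sup>2) powr (- (real N / 2) - 1)" "d\<^sup>2" t]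
      by (simp only: minus_mult_left minus_divide_left)
    show "(?g has_real_derivative - (real N / 2) * t powr (- (real N / 2) - 1)) (at t)" if "d\<^sup>2 \<le> t" for t
    proof -
      have "t > 0" using d that by (meson less_le_trans zero_less_power)
      then show ?thesis by (rule has_real_derivative_powr)
    qed
    show "?f (d\<^sup>2) = ?g (d\<^sup>2)" by (simp only: diff_self mult_zero_right add_0_right)
  qed (rule refl)
qed

lemma regularized_power_deriv_continuous: "d > 0 \<Longrightarrow> continuous_on X (regularized_power_deriv N d)"
  unfolding regularized_power_deriv_def[abs_def] by (intro continuous_intros) (auto simp: max_def)

lemma powr_half_of_square: "r > 0 \<Longrightarrow> (r\<^sup>2) powr (- (real N / 2)) = 1 / r ^ N"
proof -
  assume r: "r > 0"
  have "(r\<^sup>2) powr (- (real N / 2)) = (r powr 2) powr (- (real N / 2))" using r by simp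
  also have "\<dots> = r powr (- real N)" by (simp add: powr_powr)
  also have "\<dots> = 1 / r ^ N" using r by (simp add: powr_minus_divide powr_realpow)
  finally show ?thesis .
qed

lemma regularized_power_outside: "0 < d \<Longrightarrow> d \<le> r \<Longrightarrow> regularized_power N d (r\<^sup>2) = 1 / r ^ N"
proof -
  assume d: "0 < d" "d \<le> r"
  then have "max (r\<^sup>2) (d\<^sup>2) = r\<^sup>2" by (simp add: max_def power_mono)
  then show ?thesis using d by (simp add: regularized_power_def powr_half_of_square)
qed

text \<open>With \<open>m = max (r\<^sup>2) (d\<^sup>2)\<close> the tangent term adds at most N/2
  times m^(-N/2), whence the factor 1 + N/2. The bound is uniform in \<open>d\<close>, as dominated
  convergence requires.\<close>

lemma regularized_power_bounds:
  assumes d: "d > 0" and r: "r > 0"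
  shows "0 \<le> regularized_power N d (r\<^sup>2)" "regularized_power N d (r\<^sup>2) \<le> (1 + N / 2) / r ^ N"
proof -
  define m where "m = max (r\<^sup>2) (d\<^sup>2)"
  have m: "m > 0" "m \<ge> r\<^sup>2" using r by (auto simp: m_def less_max_iff_disj)
  have e: "regularized_power N d (r\<^sup>2) = m powr (- (real N / 2)) + N / 2 * m powr (- (real N / 2) - 1) * (m - r\<^sup>2)"
    by (simp add: regularized_power_def m_def Let_def)
  show "0 \<le> regularized_power N d (r\<^sup>2)" unfolding e using m by simp
  have "m powr (- (real N / 2) - 1) * (m - r\<^sup>2) \<le> m powr (- (real N / 2) - 1) * m"
    by (intro mult_left_mono) auto
  also have "\<dots> = m powr (- (real N / 2))" using m(1) by (simp add: powr_diff)
  finally have "N / 2 * (m powr (- (real N / 2) - 1) * (m - r\<^sup>2)) \<le> N / 2 * m powr (- (real N / 2))"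
    by (intro mult_left_mono) auto
  then have "regularized_power N d (r\<^sup>2) \<le> (1 + N / 2) * m powr (- (real N / 2))"
    unfolding e by (simp add: algebra_simps)
  also have "\<dots> \<le> (1 + N / 2) * (r\<^sup>2) powr (- (real N / 2))"
    using m r by (intro mult_left_mono powr_mono2') auto
  also have "\<dots> = (1 + N / 2) / r ^ N" using powr_half_of_square[OF r] by simp
  finally show "regularized_power N d (r\<^sup>2) \<le> (1 + N / 2) / r ^ N" .
qed

text \<open>The divergence of q(|w|^2) w is N q + 2 |w|^2 q'. With t = |w|^2, m = max(t, d^2) and p
  = m^(-N/2-1) it collapses to N (N + 2) / 2 times p (m - t), which vanishes for t at least
  d^2.\<close>

lemma regularized_power_divergence:
  assumes d: "d > 0" and N: "N > 0"
  shows "1 / (N * unit_ball_vol N) * (N * regularized_power N d ((norm w)\<^sup>2) +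
    2 * (norm w)\<^sup>2 * regularized_power_deriv N d ((norm w)\<^sup>2)) = paraboloid_bump N d w"
proof -
  define t where "t = (norm w)\<^sup>2"
  define m where "m = max t (d\<^sup>2)"
  have m: "m > 0" using d by (simp add: m_def less_max_iff_disj)
  define p where "p = m powr (- (real N / 2) - 1)"
  have "m powr (- (real N / 2)) = m * p" using m by (simp add: p_def powr_diff)
  then have "N * regularized_power N d t + 2 * t * regularized_power_deriv N d t
      = N * (m * p + N / 2 * p * (m - t)) + 2 * t * (- (real N / 2) * p)"
    by (simp add: regularized_power_def regularized_power_deriv_def m_def[symmetric] p_def[symmetric] Let_def)
  also have "\<dots> = N * (real N + 2) / 2 * (p * (m - t))" by (simp add: field_simps)
  also have "p * (m - t) = (if norm w \<le> d then 1 - (norm w)\<^sup>2 / d\<^sup>2 else 0) / d ^ N"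
  proof (cases "norm w \<le> d")
    case True
    then have "m = d\<^sup>2" by (simp add: m_def t_def max_def power_mono)
    then have "p * d\<^sup>2 = 1 / d ^ N"
      using \<open>m powr (- (real N / 2)) = m * p\<close> powr_half_of_square[OF d, of N] by (simp add: mult.commute)
    then have p: "p = 1 / d ^ N / d\<^sup>2" using d by (simp add: eq_divide_eq ac_simps)
    show ?thesis using True d unfolding p \<open>m = d\<^sup>2\<close> t_def by (simp add: field_simps)
  next
    case False
    then have "m = t" using d by (simp add: m_def t_def max_def power2_le_iff_abs_le)
    then show ?thesis using False by simp
  qed
  finally have e: "N * regularized_power N d t + 2 * t * regularized_power_deriv N d t =
    N * (real N + 2) / 2 * ((if norm w \<le> d then 1 - (norm w)\<^sup>2 / d\<^sup>2 else 0) / d ^ N)" .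
  have "1 / (n * v) * (n * K / 2 * (B / x)) = K / (2 * v * x) * B" if "n \<noteq> 0" for n v x K B :: real
    using that by simp
  from this[of N "unit_ball_vol N" "real N + 2" _ "d ^ N"] N
  show ?thesis unfolding t_def[symmetric] e paraboloid_bump_def by simp
qed

lemma paraboloid_bump_nonneg: "d > 0 \<Longrightarrow> paraboloid_bump N d w \<ge> 0"
  by (auto simp: paraboloid_bump_def divide_le_eq_1 power_mono intro!: mult_nonneg_nonneg divide_nonneg_nonneg)

lemma paraboloid_bump_off: "norm w > d \<Longrightarrow> paraboloid_bump N d w = 0"
  by (simp add: paraboloid_bump_def)

lemma paraboloid_bump_mass:
  assumes d: "d > 0"
  shows "integrable lborel (paraboloid_bump (DIM('e)) d :: 'e::euclidean_space \<Rightarrow> real)"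
    and "(\<integral>w. paraboloid_bump (DIM('e)) d (w::'e) \<partial>lborel) = 1"
proof -
  let ?N = "DIM('e)" and ?V = "unit_ball_vol (DIM('e))"
  let ?c = "(real ?N + 2) / (2 * ?V * d ^ ?N)"
  let ?B = "\<lambda>w::'e. if norm w \<le> d then 1 - (norm w)\<^sup>2 / d\<^sup>2 else 0"
  have V: "?V > 0" by simp
  then have c: "?c > 0" using d by (intro divide_pos_pos mult_pos_pos) auto
  have Bm[measurable]: "?B \<in> borel_measurable borel" by measurable
  have "(\<integral>\<^sup>+w. ennreal (paraboloid_bump ?N d (w::'e)) \<partial>lborel) = (\<integral>\<^sup>+w. ennreal ?c * ennreal (?B w) \<partial>lborel)"
    unfolding paraboloid_bump_def using c d
    by (intro nn_integral_cong) (subst ennreal_mult[symmetric], auto simp: divide_le_eq_1 power_mono)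
  also have "\<dots> = ennreal ?c * (\<integral>\<^sup>+w. ennreal (?B w) \<partial>lborel)"
    by (rule nn_integral_cmult) measurable
  also have "\<dots> = ennreal ?c * ennreal (2 * ?V * d ^ ?N / (real ?N + 2))"
    by (simp only: nn_integral_paraboloid[OF d])
  also have "\<dots> = ennreal (?c * (2 * ?V * d ^ ?N / (real ?N + 2)))"
    using c V d by (intro ennreal_mult[symmetric]) (auto intro!: divide_nonneg_nonneg mult_nonneg_nonneg simp: less_imp_le)
  also have "?c * (2 * ?V * d ^ ?N / (real ?N + 2)) = 1"
  proof -
    have "K / x * (x / K) = 1" if "K \<noteq> 0" "x \<noteq> 0" for K x :: real using that by simp
    moreover have "?V \<noteq> 0" using V by (rule less_imp_neq[THEN not_sym])
    ultimately show ?thesis using d by simp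
  qed
  finally have nn: "(\<integral>\<^sup>+w. ennreal (paraboloid_bump ?N d (w::'e)) \<partial>lborel) = ennreal 1" by simp
  have "has_bochner_integral lborel (paraboloid_bump ?N d :: 'e \<Rightarrow> real) 1"
  proof (rule has_bochner_integral_nn_integral[OF _ _ _ nn])
    show "paraboloid_bump ?N d \<in> borel_measurable (lborel :: 'e measure)"
      unfolding paraboloid_bump_def[abs_def] by measurable
  qed (auto intro!: AE_I2 paraboloid_bump_nonneg d)
  then show "integrable lborel (paraboloid_bump ?N d :: 'e \<Rightarrow> real)" "(\<integral>w. paraboloid_bump ?N d (w::'e) \<partial>lborel) = 1"
    by (auto simp: has_bochner_integral_iff)
qed

lemma set_integrable_interior:
  fixes f :: "'e::euclidean_space \<Rightarrow> 'w::euclidean_space"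
  assumes "open G" "bounded G" "closure G \<subseteq> D" "continuous_on D f"
  shows "set_integrable lborel G f"
proof (rule set_integrable_subset)
  show "set_integrable lborel (closure G) f"
    unfolding set_integrable_def
    by (rule borel_integrable_compact) (use assms in \<open>auto intro: continuous_on_subset simp: compact_closure\<close>)
qed (use assms(1) closure_subset in auto)

section \<open>The Cauchy-Pompeiu formula\<close>

interpretation clifford: bounded_bilinear "(\<odot>) :: ('a::{finite,linorder}, 'b::{finite,linorder}) clifford \<Rightarrow> _"
  by (rule bounded_bilinear_clifford_mult)

text \<open>\<open>L\<close> and \<open>Lc\<close> stand for the embedding of the slice into the
  Clifford algebra and its conjugate; \<open>LcL\<close> is their only algebraic property used. The
  formula is the limit of the divergence theorem for the regularised kernel.\<close>

theorem cauchy_pompeiu: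
  fixes G :: "('v::euclidean_space \<times> real) set"
    and L Lc :: "'v \<times> real \<Rightarrow> ('a::{finite,linorder}, 'b::{finite,linorder}) clifford"
    and h :: "'v \<times> real \<Rightarrow> ('a, 'b) clifford"
  defines "N \<equiv> DIM('v \<times> real)"
  defines "E \<equiv> \<lambda>w. (1 / (N * unit_ball_vol N)) *\<^sub>R (1 / norm w ^ N) *\<^sub>R Lc w"
  assumes L: "bounded_linear L" and Lc: "bounded_linear Lc"
    and LcL: "\<And>w. Lc w \<odot> L w = (w \<bullet> w) *\<^sub>R clifford_one"
    and \<mu>: "is_surface_measure (frontier G) \<mu>" and sm: "smooth_boundary G" and G: "open G" "bounded G"
    and n: "\<forall>z\<in>frontier G. unit_exterior_normal G z (n z)"
    and D: "open D" "closure G \<subseteq> D" and h: "C1_on D h" and a: "a \<in> G"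
  shows "set_integrable \<mu> (frontier G) (\<lambda>z. E (z - a) \<odot> L (n z) \<odot> h z)"
    and "set_integrable lborel G (\<lambda>z. E (z - a) \<odot> (\<Sum>k\<in>Basis. L k \<odot> frechet_derivative h (at z) k))"
    and "h a = (LINT z:frontier G|\<mu>. E (z - a) \<odot> L (n z) \<odot> h z) -
      (LINT z:G|lborel. E (z - a) \<odot> (\<Sum>k\<in>Basis. L k \<odot> frechet_derivative h (at z) k))"
proof -
  let ?S = "frontier G"
  define c where "c = 1 / (real N * unit_ball_vol N)"
  define Dh where "Dh z = (\<Sum>k\<in>Basis. L k \<odot> frechet_derivative h (at z) k)" for z
  define Ed where "Ed d w = c *\<^sub>R regularized_power N d (w \<bullet> w) *\<^sub>R Lc w" for d w
  have N: "N > 0" "N = Suc DIM('v)" by (simp_all add: N_def)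
  have c: "c > 0" using N(1) by (simp add: c_def)
  have E: "E w = c *\<^sub>R (1 / norm w ^ N) *\<^sub>R Lc w" for w by (simp add: E_def c_def)
  have linL: "linear L" and linLc: "linear Lc" using L Lc bounded_linear.linear by blast+
  have SD: "?S \<subseteq> D" and GD: "G \<subseteq> D" using D(2) closure_subset[of G] by (auto simp: frontier_def)
  have hc: "continuous_on D h" by (rule C1_on_continuous[OF h])
  have h'c: "continuous_on D (\<lambda>z. frechet_derivative h (at z) k)" for k by (rule C1_on_continuous_deriv[OF h])
  have Dhc: "continuous_on D Dh"
    unfolding Dh_def[abs_def] by (intro continuous_on_sum clifford.continuous_on continuous_on_const h'c)
  have nc: "continuous_on ?S n" by (rule exterior_normal_continuous[OF sm G(1) n])
  have Lnc: "continuous_on ?S (\<lambda>z. L (n z))"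
    by (rule continuous_on_compose2[OF linear_continuous_on[OF L, of UNIV] nc]) simp
  have Lexp: "L w = (\<Sum>k\<in>Basis. (w \<bullet> k) *\<^sub>R L k)" for w
  proof -
    have "L w = L (\<Sum>k\<in>Basis. (w \<bullet> k) *\<^sub>R k)" by (simp only: euclidean_representation)
    also have "\<dots> = (\<Sum>k\<in>Basis. (w \<bullet> k) *\<^sub>R L k)"
      by (simp only: linear_sum[OF linL] linear_cmul[OF linL])
    finally show ?thesis .
  qed
  \<comment> \<open>This is the source of the term N q in the divergence of the radial
    field.\<close>
  have trace: "(\<Sum>k\<in>Basis. Lc k \<odot> L k) = real N *\<^sub>R clifford_one"
  proof -
    have "(\<Sum>k\<in>(Basis :: ('v \<times> real) set). k \<bullet> k) = (\<Sum>k\<in>(Basis :: ('v \<times> real) set). 1 :: real)"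
      by (rule sum.cong[OF refl]) (rule inner_same_Basis)
    also have "\<dots> = real N" by (simp only: N_def sum_constant mult_1_right)
    finally have "(\<Sum>k\<in>(Basis :: ('v \<times> real) set). k \<bullet> k) = real N" .
    then show ?thesis by (simp only: LcL scaleR_left.sum[symmetric])
  qed
  \<comment> \<open>Since \<open>Lc 0 = 0\<close>, kernel and regularised kernels are all 0 at the
    pole, so the pointwise convergence below holds there too.\<close>
  have Ed0: "Ed d 0 = 0" and E0: "E 0 = 0" for d
    by (simp_all add: Ed_def E linear_0[OF linLc])
  have Ed_eq: "Ed d w = E w" if "0 < d" "d \<le> norm w" for d w
    using regularized_power_outside[OF that, of N] by (simp add: Ed_def E dot_square_norm)

  \<comment> \<open>Derivative and divergence of the regularised fields\<close>
  have Ed_deriv: "(Ed d has_derivative (\<lambda>k. c *\<^sub>R (regularized_power N d (w \<bullet> w) *\<^sub>R Lc k +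
      (regularized_power_deriv N d (w \<bullet> w) * (2 * (w \<bullet> k))) *\<^sub>R Lc w))) (at w)" if d: "d > 0" for d w
  proof -
    have "((\<lambda>w. w \<bullet> w) has_derivative (\<lambda>k. 2 * (w \<bullet> k))) (at w)"
      by (auto intro!: derivative_eq_intros simp: inner_commute)
    from has_derivative_compose[OF this, of "regularized_power N d",
        OF regularized_power_has_derivative[OF d, unfolded has_field_derivative_def]]
    have "((\<lambda>w. regularized_power N d (w \<bullet> w)) has_derivative
        (\<lambda>k. regularized_power_deriv N d (w \<bullet> w) * (2 * (w \<bullet> k)))) (at w)" .
    from has_derivative_scaleR_right[OF has_derivative_scaleR[OF this bounded_linear_imp_has_derivative[OF Lc]], of c]
    show ?thesis unfolding Ed_def[abs_def] .
  qed
  have Ed_C1: "C1_on X (\<lambda>z. Ed d (z - a))" if d: "d > 0" for d X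
  proof (rule C1_onI)
    show "((\<lambda>z. Ed d (z - a)) has_derivative (\<lambda>k. c *\<^sub>R (regularized_power N d ((z - a) \<bullet> (z - a)) *\<^sub>R Lc k +
      (regularized_power_deriv N d ((z - a) \<bullet> (z - a)) * (2 * ((z - a) \<bullet> k))) *\<^sub>R Lc (z - a)))) (at z)" for z
      by (rule has_derivative_compose[where f="\<lambda>z. z - a" and g="Ed d", OF _ Ed_deriv[OF d]])
        (auto intro!: derivative_eq_intros)
    have rc: "continuous_on UNIV (regularized_power N d)"
      by (intro continuous_at_imp_continuous_on ballI DERIV_isCont[OF regularized_power_has_derivative[OF d]])
    have za: "continuous_on X (\<lambda>z. (z - a) \<bullet> (z - a))" by (intro continuous_intros)
    have 1: "continuous_on X (\<lambda>z. regularized_power N d ((z - a) \<bullet> (z - a)))"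
      by (rule continuous_on_compose2[OF rc za]) simp
    have 2: "continuous_on X (\<lambda>z. regularized_power_deriv N d ((z - a) \<bullet> (z - a)))"
      by (rule continuous_on_compose2[OF regularized_power_deriv_continuous[OF d, of UNIV] za]) simp
    have 3: "continuous_on X (\<lambda>z. Lc (z - a))"
      by (rule continuous_on_compose2[OF linear_continuous_on[OF Lc, of UNIV]]) (auto intro!: continuous_intros)
    show "continuous_on X (\<lambda>z. c *\<^sub>R (regularized_power N d ((z - a) \<bullet> (z - a)) *\<^sub>R Lc k +
      (regularized_power_deriv N d ((z - a) \<bullet> (z - a)) * (2 * ((z - a) \<bullet> k))) *\<^sub>R Lc (z - a)))" for k
      by (intro continuous_intros 1 2 3)
  qed
  have Edc: "continuous_on X (\<lambda>z. Ed d (z - a))" if "d > 0" for d X by (rule C1_on_continuous[OF Ed_C1[OF that]])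

  \<comment> \<open>Direction \<open>k\<close> is paired with the field carrying \<open>L k\<close>
    between kernel and \<open>h\<close>. The product rule then separates the divergence of the
    kernel from the operator acting on \<open>h\<close>, without any commutation.\<close>
  have div: "(\<Sum>k\<in>Basis. frechet_derivative (\<lambda>z. (Ed d (z - a) \<odot> L k) \<odot> h z) (at z) k) =
      paraboloid_bump N d (z - a) *\<^sub>R h z + Ed d (z - a) \<odot> Dh z" if d: "d > 0" and z: "z \<in> D" for d z
  proof -
    let ?w = "z - a"
    let ?q = "regularized_power N d (?w \<bullet> ?w)" and ?q' = "regularized_power_deriv N d (?w \<bullet> ?w)"
    define E' where "E' k = c *\<^sub>R (?q *\<^sub>R Lc k + (?q' * (2 * (?w \<bullet> k))) *\<^sub>R Lc ?w)" for k
    have dE: "((\<lambda>z. Ed d (z - a)) has_derivative E') (at z)"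
      unfolding E'_def[abs_def]
      by (rule has_derivative_compose[where f="\<lambda>z. z - a" and g="Ed d", OF _ Ed_deriv[OF d]])
        (auto intro!: derivative_eq_intros)
    have dk: "((\<lambda>z. (Ed d (z - a) \<odot> L k) \<odot> h z) has_derivative
        (\<lambda>v. (Ed d ?w \<odot> L k) \<odot> frechet_derivative h (at z) v + (E' v \<odot> L k) \<odot> h z)) (at z)" for k
      by (rule clifford.FDERIV[OF bounded_linear.has_derivative[OF clifford.bounded_linear_left dE] C1_on_has_derivative[OF h z]])
    have distr: "(s *\<^sub>R (q *\<^sub>R x + (q' * (2 * t)) *\<^sub>R y)) \<odot> l = (s * q) *\<^sub>R (x \<odot> l) + (s * q' * 2) *\<^sub>R (y \<odot> (t *\<^sub>R l))"
      for s q q' t :: real and x y l :: "('a, 'b) clifford"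
      by (simp add: clifford.add_left clifford.scaleR_left clifford.scaleR_right algebra_simps)
    \<comment> \<open>The derivative of the radial factor contributes (w . k) L k, which sums to L
      w; \<open>LcL\<close> at w and \<open>trace\<close> make the total a multiple of the
      unit.\<close>
    have "(\<Sum>k\<in>Basis. E' k \<odot> L k) = (\<Sum>k\<in>Basis. (c * ?q) *\<^sub>R (Lc k \<odot> L k) + (c * ?q' * 2) *\<^sub>R (Lc ?w \<odot> ((?w \<bullet> k) *\<^sub>R L k)))"
      unfolding E'_def
      by (intro sum.cong refl) (rule distr)
    also have "\<dots> = (c * ?q) *\<^sub>R (\<Sum>k\<in>Basis. Lc k \<odot> L k) + (c * ?q' * 2) *\<^sub>R (Lc ?w \<odot> L ?w)"
      by (simp only: sum.distrib scaleR_right.sum[symmetric] clifford.sum_right[symmetric] Lexp[symmetric])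
    also have "\<dots> = (c * (N * ?q + 2 * (norm ?w)\<^sup>2 * ?q')) *\<^sub>R clifford_one"
      unfolding trace unfolding LcL by (simp add: dot_square_norm algebra_simps)
    also have "c * (N * ?q + 2 * (norm ?w)\<^sup>2 * ?q') = paraboloid_bump N d ?w"
      unfolding c_def dot_square_norm by (rule regularized_power_divergence[OF d N(1)])
    finally have bump: "(\<Sum>k\<in>Basis. E' k \<odot> L k) = paraboloid_bump N d ?w *\<^sub>R clifford_one" .
    have "(\<Sum>k\<in>Basis. frechet_derivative (\<lambda>z. (Ed d (z - a) \<odot> L k) \<odot> h z) (at z) k) =
      (\<Sum>k\<in>Basis. (Ed d ?w \<odot> L k) \<odot> frechet_derivative h (at z) k + (E' k \<odot> L k) \<odot> h z)"
      by (intro sum.cong refl fun_cong[OF frechet_derivative_at[OF dk, symmetric]])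
    also have "\<dots> = Ed d ?w \<odot> Dh z + (\<Sum>k\<in>Basis. E' k \<odot> L k) \<odot> h z"
      by (simp only: sum.distrib clifford_mult_assoc Dh_def clifford.sum_right clifford.sum_left)
    also have "\<dots> = paraboloid_bump N d ?w *\<^sub>R h z + Ed d ?w \<odot> Dh z"
      unfolding bump by (simp add: clifford.scaleR_left clifford_one_left)
    finally show ?thesis .
  qed

  have bumpc: "continuous_on X (\<lambda>z. paraboloid_bump N d (z - a))" if "d > 0" for d X
  proof -
    have "continuous_on UNIV (\<lambda>w::'v \<times> real. (real N + 2) / (2 * unit_ball_vol N * d ^ N) * max 0 (1 - (norm w)\<^sup>2 / d\<^sup>2))"
      using that by (intro continuous_intros) auto
    moreover have "(if norm w \<le> d then 1 - (norm w)\<^sup>2 / d\<^sup>2 else 0) = max 0 (1 - (norm w)\<^sup>2 / d\<^sup>2)" for w :: "'v \<times> real"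
    proof (cases "norm w \<le> d")
      case True
      then have "(norm w)\<^sup>2 \<le> d\<^sup>2" by (intro power_mono) auto
      then show ?thesis using True that by (simp add: divide_le_eq_1)
    next
      case False
      then have "d\<^sup>2 \<le> (norm w)\<^sup>2" using that by (intro power_mono) auto
      then show ?thesis using False that by (simp add: le_divide_eq_1)
    qed
    ultimately have "continuous_on UNIV (paraboloid_bump N d :: 'v \<times> real \<Rightarrow> real)"
      by (simp add: paraboloid_bump_def[abs_def])
    then show ?thesis by (rule continuous_on_compose2) (auto intro!: continuous_intros)
  qed

  have intG: "set_integrable lborel G f" if "continuous_on D f" for f :: "'v \<times> real \<Rightarrow> ('a, 'b) clifford"
    by (rule set_integrable_interior[OF G D(2) that])
  have intS: "set_integrable \<mu> ?S f" if "continuous_on ?S f" for f :: "'v \<times> real \<Rightarrow> ('a, 'b) clifford"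
    by (rule set_integrable_surface_measure[OF \<mu> sm G that])
  have hS: "continuous_on ?S h" by (rule continuous_on_subset[OF hc SD])

  have smoothed: "(LINT z:?S|\<mu>. Ed d (z - a) \<odot> L (n z) \<odot> h z) =
      (LINT z:G|lborel. paraboloid_bump N d (z - a) *\<^sub>R h z) + (LINT z:G|lborel. Ed d (z - a) \<odot> Dh z)" if d: "d > 0" for d
  proof -
    let ?\<phi> = "\<lambda>k z. (Ed d (z - a) \<odot> L k) \<odot> h z"
    have C1: "C1_on D (?\<phi> k)" for k
      by (intro C1_on_bilinear[OF bounded_bilinear_clifford_mult] Ed_C1[OF d] C1_on_const h)
    have div_k: "(LINT z:G|lborel. frechet_derivative (?\<phi> k) (at z) k) = (LINT z:?S|\<mu>. (n z \<bullet> k) *\<^sub>R ?\<phi> k z)" for k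
      by (rule divergence_theorem[OF \<mu> sm G n D C1])
    have Sk: "set_integrable \<mu> ?S (\<lambda>z. (n z \<bullet> k) *\<^sub>R ?\<phi> k z)" for k
      by (intro intS continuous_intros nc continuous_on_subset[OF C1_on_continuous[OF C1] SD])
    have Gk: "set_integrable lborel G (\<lambda>z. frechet_derivative (?\<phi> k) (at z) k)" for k
      by (rule intG[OF C1_on_continuous_deriv[OF C1]])
    have "(LINT z:?S|\<mu>. Ed d (z - a) \<odot> L (n z) \<odot> h z) = (LINT z:?S|\<mu>. \<Sum>k\<in>Basis. (n z \<bullet> k) *\<^sub>R ?\<phi> k z)"
    proof -
      have "Ed d (z - a) \<odot> L (n z) \<odot> h z = (\<Sum>k\<in>Basis. (n z \<bullet> k) *\<^sub>R ?\<phi> k z)" for z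
        by (subst Lexp) (simp only: clifford.sum_right clifford.sum_left clifford.scaleR_right clifford.scaleR_left)
      then show ?thesis by simp
    qed
    also have "\<dots> = (\<Sum>k\<in>Basis. LINT z:?S|\<mu>. (n z \<bullet> k) *\<^sub>R ?\<phi> k z)"
      unfolding set_lebesgue_integral_def scaleR_right.sum
      by (rule Bochner_Integration.integral_sum) (rule Sk[unfolded set_integrable_def])
    also have "\<dots> = (\<Sum>k\<in>Basis. LINT z:G|lborel. frechet_derivative (?\<phi> k) (at z) k)"
      by (simp only: div_k)
    also have "\<dots> = (LINT z:G|lborel. \<Sum>k\<in>Basis. frechet_derivative (?\<phi> k) (at z) k)"
      unfolding set_lebesgue_integral_def scaleR_right.sum
      by (rule Bochner_Integration.integral_sum[symmetric]) (rule Gk[unfolded set_integrable_def])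
    also have "\<dots> = (LINT z:G|lborel. paraboloid_bump N d (z - a) *\<^sub>R h z + Ed d (z - a) \<odot> Dh z)"
      using G(1) GD by (intro set_lebesgue_integral_cong) (auto simp: div[OF d])
    also have "\<dots> = (LINT z:G|lborel. paraboloid_bump N d (z - a) *\<^sub>R h z) + (LINT z:G|lborel. Ed d (z - a) \<odot> Dh z)"
      by (intro set_integral_add intG continuous_on_scaleR bumpc[OF d] hc clifford.continuous_on Edc[OF d] Dhc)
    finally show ?thesis .
  qed

  \<comment> \<open>For radii up to \<open>r\<close> the bump stays inside \<open>G\<close>, and on
    the frontier the regularised kernel is already the true one.\<close>
  obtain r where r: "r > 0" "cball a r \<subseteq> G" using G(1) a open_contains_cball by blast
  define \<delta> where "\<delta> j = r / real (Suc j)" for j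
  have \<delta>: "\<delta> j > 0" "\<delta> j \<le> r" for j using r(1) by (simp_all add: \<delta>_def divide_le_eq)
  have \<delta>0: "\<delta> \<longlonglongrightarrow> 0"
    unfolding \<delta>_def[abs_def] using LIMSEQ_inverse_real_of_nat[THEN tendsto_mult_right_zero, of r]
    by (simp add: divide_inverse)
  have far: "r \<le> norm (z - a)" if "z \<in> ?S" for z
  proof -
    have "z \<notin> G" using that G(1) by (auto simp: frontier_def interior_open)
    then have "z \<notin> cball a r" using r(2) by blast
    then show ?thesis by (simp add: dist_norm norm_minus_commute)
  qed
  have EdS: "Ed (\<delta> j) (z - a) = E (z - a)" if "z \<in> ?S" for j z
    by (rule Ed_eq[OF \<delta>(1)]) (use far[OF that] \<delta>(2)[of j] in simp)

  have "continuous_on ?S (\<lambda>z. Ed (\<delta> 0) (z - a) \<odot> L (n z) \<odot> h z)"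
    by (intro clifford.continuous_on Edc \<delta>(1) Lnc hS)
  then have "continuous_on ?S (\<lambda>z. E (z - a) \<odot> L (n z) \<odot> h z)"
    by (subst continuous_on_cong[OF refl, of _ _ "\<lambda>z. Ed (\<delta> 0) (z - a) \<odot> L (n z) \<odot> h z"]) (simp_all add: EdS)
  then show "set_integrable \<mu> ?S (\<lambda>z. E (z - a) \<odot> L (n z) \<odot> h z)" by (rule intS)
  \<comment> \<open>The boundary integral does not depend on \<open>j\<close>, so only the two
    volume integrals have limits to be found.\<close>
  have LHS: "(LINT z:?S|\<mu>. Ed (\<delta> j) (z - a) \<odot> L (n z) \<odot> h z) = (LINT z:?S|\<mu>. E (z - a) \<odot> L (n z) \<odot> h z)" for j
    unfolding set_lebesgue_integral_def
    by (intro Bochner_Integration.integral_cong refl) (auto simp: indicator_def EdS)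

  \<comment> \<open>Approximate identity: the bumps are nonnegative, of mass 1, and shrink to
    \<open>a\<close>, where \<open>h\<close> is continuous.\<close>
  have lim1: "(\<lambda>j. LINT z:G|lborel. paraboloid_bump N (\<delta> j) (z - a) *\<^sub>R h z) \<longlonglongrightarrow> h a"
  proof (rule LIMSEQ_I)
    fix e :: real assume e: "e > 0"
    have "a \<in> D" using a GD by blast
    then have "isCont h a" using hc D(1) continuous_on_eq_continuous_at by blast
    then obtain s where s: "s > 0" "\<And>z. dist z a < s \<Longrightarrow> dist (h z) (h a) < e / 2"
      using e unfolding continuous_at_eps_delta by (meson half_gt_zero)
    obtain j0 where j0: "\<And>j. j \<ge> j0 \<Longrightarrow> \<delta> j < s"
      using order_tendstoD(2)[OF \<delta>0 s(1)] by (auto simp: eventually_sequentially)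
    show "\<exists>j0. \<forall>j\<ge>j0. norm ((LINT z:G|lborel. paraboloid_bump N (\<delta> j) (z - a) *\<^sub>R h z) - h a) < e"
    proof (intro exI[of _ j0] allI impI)
      fix j assume "j \<ge> j0"
      then have js: "\<delta> j < s" by (rule j0)
      let ?k = "\<lambda>z. paraboloid_bump N (\<delta> j) (z - a)"
      note mass = paraboloid_bump_mass[OF \<delta>(1)[of j], where 'e="'v \<times> real", folded N_def]
      have km: "paraboloid_bump N (\<delta> j) \<in> borel_measurable (borel :: ('v \<times> real) measure)"
        using borel_measurable_integrable[OF mass(1)] by simp
      have ki: "integrable lborel ?k"
        using lborel_integrable_translate[OF mass(1), of "- a"] by simp
      have k1: "(\<integral>z. ?k z \<partial>lborel) = 1"
        using lborel_integral_translate[OF km, of "- a"] mass(2) by simp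
      have koff: "?k z = 0" if "z \<notin> G" for z
      proof (rule paraboloid_bump_off)
        have "z \<notin> cball a r" using that r(2) by blast
        then show "\<delta> j < norm (z - a)" using \<delta>(2)[of j] by (simp add: dist_norm norm_minus_commute)
      qed
      have hi: "set_integrable lborel G (\<lambda>z. ?k z *\<^sub>R h z)"
        by (intro intG continuous_on_scaleR bumpc \<delta>(1) hc)
      have kha: "integrable lborel (\<lambda>z. ?k z *\<^sub>R h a)" using ki by (intro integrable_scaleR_left)
      have "(LINT z:G|lborel. ?k z *\<^sub>R h z) - h a = (LINT z:G|lborel. ?k z *\<^sub>R h z) - (\<integral>z. ?k z *\<^sub>R h a \<partial>lborel)"
        using k1 ki by simp
      also have "\<dots> = (\<integral>z. indicator G z *\<^sub>R (?k z *\<^sub>R h z) - ?k z *\<^sub>R h a \<partial>lborel)"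
        unfolding set_lebesgue_integral_def
        by (rule Bochner_Integration.integral_diff[symmetric, OF hi[unfolded set_integrable_def] kha])
      finally have "norm ((LINT z:G|lborel. ?k z *\<^sub>R h z) - h a) = norm (\<integral>z. indicator G z *\<^sub>R (?k z *\<^sub>R h z) - ?k z *\<^sub>R h a \<partial>lborel)"
        by simp
      also have "\<dots> \<le> (\<integral>z. e / 2 * ?k z \<partial>lborel)"
      proof (rule Bochner_Integration.integral_norm_bound_integral)
        show "integrable lborel (\<lambda>z. indicator G z *\<^sub>R (?k z *\<^sub>R h z) - ?k z *\<^sub>R h a)"
          by (rule Bochner_Integration.integrable_diff[OF hi[unfolded set_integrable_def] kha])
        show "integrable lborel (\<lambda>z. e / 2 * ?k z)" using ki by (rule integrable_mult_right)
        fix z :: "'v \<times> real"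
        show "norm (indicator G z *\<^sub>R (?k z *\<^sub>R h z) - ?k z *\<^sub>R h a) \<le> e / 2 * ?k z"
        proof (cases "?k z = 0")
          case True
          then show ?thesis by simp
        next
          case False
          then have zG: "z \<in> G" using koff by blast
          have "norm (z - a) \<le> \<delta> j" using False paraboloid_bump_off[of "\<delta> j" "z - a" N] by force
          then have "dist (h z) (h a) < e / 2" using js by (intro s(2)) (simp add: dist_norm)
          then have "norm (?k z *\<^sub>R (h z - h a)) \<le> ?k z * (e / 2)"
            using mult_left_mono[of "dist (h z) (h a)" "e / 2" "?k z"] paraboloid_bump_nonneg[OF \<delta>(1), of N j "z - a"]
            by (simp add: dist_norm)
          then show ?thesis using zG by (simp add: scaleR_diff_right mult.commute)
        qed
      qed
      also have "\<dots> = e / 2" using k1 by simp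
      also have "\<dots> < e" using e by simp
      finally show "norm ((LINT z:G|lborel. ?k z *\<^sub>R h z) - h a) < e" .
    qed
  qed

  \<comment> \<open>Dominated convergence of the singular volume integral\<close>
  obtain R where R: "R > 0" "G \<subseteq> ball a R" using bounded_subset_ballD[OF G(2)] by blast
  obtain M0 where M0: "M0 > 0" "\<And>w. norm (Lc w) \<le> norm w * M0"
    using bounded_linear.pos_bounded[OF Lc] by blast
  obtain M1 where M1: "M1 > 0" "\<And>x y :: ('a, 'b) clifford. norm (x \<odot> y) \<le> norm x * norm y * M1"
    using clifford.pos_bounded by blast
  have "bounded (Dh ` closure G)"
    by (intro compact_imp_bounded compact_continuous_image continuous_on_subset[OF Dhc D(2)]) (simp add: compact_closure G(2))
  then obtain M2 where M2: "M2 > 0" "\<forall>z\<in>closure G. norm (Dh z) \<le> M2"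
    unfolding bounded_pos by auto
  have GcG: "z \<in> closure G" if "z \<in> G" for z using that closure_subset by blast
  define B where "B = c * (1 + real N / 2) * M0 * M2 * M1"
  let ?f = "\<lambda>z. indicator G z *\<^sub>R (E (z - a) \<odot> Dh z)"
  let ?s = "\<lambda>j z. indicator G z *\<^sub>R (Ed (\<delta> j) (z - a) \<odot> Dh z)"
  \<comment> \<open>The factor \<open>Lc\<close> is of order |w| and lowers the singularity |w|^(-N)
    to |w|^(1-N), with N - 1 = \<open>DIM('v)\<close>; this is integrable on bounded sets.\<close>
  let ?w = "\<lambda>z. B * (indicator (cball 0 R) (z - a) * (1 / norm (z - a) ^ DIM('v)))"
  have sm: "?s j \<in> borel_measurable lborel" for j
    using intG[OF clifford.continuous_on[OF Edc[OF \<delta>(1)] Dhc]] unfolding set_integrable_def by (rule borel_measurable_integrable)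
  have lim: "(\<lambda>j. ?s j z) \<longlonglongrightarrow> ?f z" for z
  proof (cases "z = a")
    case True
    then show ?thesis by (simp add: Ed0 E0)
  next
    case False
    then have "norm (z - a) > 0" by simp
    from order_tendstoD(2)[OF \<delta>0 this] have "eventually (\<lambda>j. ?s j z = ?f z) sequentially"
      by eventually_elim (simp add: Ed_eq \<delta>(1))
    then show ?thesis by (rule tendsto_eventually)
  qed
  have wi: "integrable lborel ?w"
  proof -
    have "integrable lborel (\<lambda>w::'v \<times> real. indicator (cball 0 R) w * (1 / norm w ^ DIM('v)))"
      by (rule integrable_inverse_norm_power[OF _ _ R(1)]) simp_all
    from lborel_integrable_translate[OF this, of "- a"] show ?thesis
      by (intro integrable_mult_right) simp
  qed
  have bound: "norm (?s j z) \<le> ?w z" for j z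
  proof (cases "z \<in> G \<and> z \<noteq> a")
    case True
    let ?r = "norm (z - a)"
    have r0: "?r > 0" using True by simp
    have "norm (Ed (\<delta> j) (z - a)) = c * regularized_power N (\<delta> j) (?r\<^sup>2) * norm (Lc (z - a))"
      using c regularized_power_bounds(1)[OF \<delta>(1) r0, of N j] by (simp add: Ed_def dot_square_norm)
    also have "\<dots> \<le> c * ((1 + real N / 2) / ?r ^ N) * (?r * M0)"
      using c M0 regularized_power_bounds[OF \<delta>(1) r0, of N j]
      by (intro mult_mono mult_left_mono mult_nonneg_nonneg) auto
    also have "\<dots> = c * (1 + real N / 2) * M0 * (1 / ?r ^ DIM('v))"
      using r0 by (simp add: N(2))
    finally have 1: "norm (Ed (\<delta> j) (z - a)) \<le> c * (1 + real N / 2) * M0 * (1 / ?r ^ DIM('v))" .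
    have "norm (Ed (\<delta> j) (z - a) \<odot> Dh z) \<le> norm (Ed (\<delta> j) (z - a)) * norm (Dh z) * M1" by (rule M1(2))
    also have "\<dots> \<le> (c * (1 + real N / 2) * M0 * (1 / ?r ^ DIM('v))) * M2 * M1"
      using 1 M2 True GcG c M0(1) M1(1) by (intro mult_right_mono mult_mono) auto
    also have "\<dots> = ?w z"
    proof -
      have "z - a \<in> cball 0 R" using True R(2) by (force simp: dist_norm norm_minus_commute)
      then show ?thesis by (simp add: B_def)
    qed
    finally show ?thesis using True by simp
  next
    case False
    then have "norm (?s j z) = 0" by (auto simp: Ed0 clifford.zero_left)
    also have "0 \<le> ?w z" using c M0(1) M1(1) M2(1) by (simp add: B_def)
    finally show ?thesis .
  qed
  have fm: "?f \<in> borel_measurable lborel"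
    by (rule borel_measurable_LIMSEQ_metric[OF sm lim])
  have fint: "integrable lborel ?f"
    by (rule integrable_dominated_convergence[OF fm sm wi AE_I2[OF lim] AE_I2[OF bound]])
  then show "set_integrable lborel G (\<lambda>z. E (z - a) \<odot> (\<Sum>k\<in>Basis. L k \<odot> frechet_derivative h (at z) k))"
    by (simp add: set_integrable_def Dh_def)
  have lim2: "(\<lambda>j. LINT z:G|lborel. Ed (\<delta> j) (z - a) \<odot> Dh z) \<longlonglongrightarrow> (LINT z:G|lborel. E (z - a) \<odot> Dh z)"
    unfolding set_lebesgue_integral_def
    by (rule integral_dominated_convergence[OF fm sm wi AE_I2[OF lim] AE_I2[OF bound]])
  have "(\<lambda>j. LINT z:?S|\<mu>. Ed (\<delta> j) (z - a) \<odot> L (n z) \<odot> h z) \<longlonglongrightarrow> h a + (LINT z:G|lborel. E (z - a) \<odot> Dh z)"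
    unfolding smoothed[OF \<delta>(1)] by (rule tendsto_add[OF lim1 lim2])
  then have "(LINT z:?S|\<mu>. E (z - a) \<odot> L (n z) \<odot> h z) = h a + (LINT z:G|lborel. E (z - a) \<odot> Dh z)"
    unfolding LHS by (simp only: LIMSEQ_const_iff)
  then show "h a = (LINT z:?S|\<mu>. E (z - a) \<odot> L (n z) \<odot> h z) -
      (LINT z:G|lborel. E (z - a) \<odot> (\<Sum>k\<in>Basis. L k \<odot> frechet_derivative h (at z) k))"
    unfolding Dh_def[symmetric] by simp
qed

section \<open>Partial-slice functions\<close>

text \<open>Merges the two index types, so that a paravector is a single sum over generators and the
  anticommutation relations apply to all pairs alike.\<close>

definition coord :: "('a::finite, 'b::finite) point \<Rightarrow> 'a + 'b \<Rightarrow> real" where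
  "coord x g = (case g of Inl i \<Rightarrow> fst x $ i | Inr j \<Rightarrow> snd x $ j)"

lemma sum_UNIV_sum_type:
  fixes f :: "'a::finite + 'b::finite \<Rightarrow> 'c::comm_monoid_add"
  shows "(\<Sum>g\<in>UNIV. f g) = (\<Sum>i\<in>UNIV. f (Inl i)) + (\<Sum>j\<in>UNIV. f (Inr j))"
proof -
  have "(\<Sum>g\<in>UNIV. f g) = (\<Sum>g\<in>UNIV <+> UNIV. f g)" by (simp only: UNIV_Plus_UNIV)
  also have "\<dots> = (\<Sum>i\<in>UNIV. f (Inl i)) + (\<Sum>j\<in>UNIV. f (Inr j))" by (subst sum.Plus) simp_all
  finally show ?thesis .
qed

lemma paravector_coord: "paravector x = (\<Sum>g\<in>UNIV. coord x g *\<^sub>R clifford_unit g)"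
  by (simp add: paravector_def sum_UNIV_sum_type coord_def)

lemma linear_paravector: "linear (paravector :: ('a::{finite,linorder}, 'b::{finite,linorder}) point \<Rightarrow> _)"
  by (rule linearI) (simp_all add: paravector_def algebra_simps sum.distrib scaleR_right.sum)

text \<open>With x = x0 + v and conjugate x0 - v the mixed terms cancel, leaving x0^2 - v v, where v
  v is minus the sum of the squared coordinates.\<close>

lemma conjugate_mult_paravector:
  fixes x :: "('a::{finite,linorder}, 'b::{finite,linorder}) point"
  shows "paravector (conjugate x) \<odot> paravector x = (norm x)\<^sup>2 *\<^sub>R clifford_one"
proof -
  let ?g0 = "Inl idx0 :: 'a + 'b" and ?one = "clifford_one :: ('a, 'b) clifford"
  let ?I = "UNIV - {?g0}"
  define x0 where "x0 = coord x ?g0"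
  define v where "v = (\<Sum>g\<in>?I. coord x g *\<^sub>R (clifford_unit g :: ('a, 'b) clifford))"
  have px: "paravector x = x0 *\<^sub>R ?one + v"
    unfolding paravector_coord v_def x0_def
    by (subst sum.remove[of _ ?g0]) (simp_all add: clifford_unit_0)
  have cc: "coord (conjugate x) g = (if g = ?g0 then coord x g else - coord x g)" for g
    by (cases g) (auto simp: coord_def conjugate_def)
  have pc: "paravector (conjugate x) = x0 *\<^sub>R ?one - v"
    unfolding paravector_coord v_def x0_def
    by (subst sum.remove[of _ ?g0]) (simp_all add: clifford_unit_0 cc sum_negf)
  \<comment> \<open>Adding the double sum to its transpose produces anticommutators, which vanish
    off the diagonal.\<close>
  have "v \<odot> v + v \<odot> v = (\<Sum>g\<in>?I. \<Sum>k\<in>?I. (coord x g * coord x k) *\<^sub>R (clifford_unit g \<odot> clifford_unit k + clifford_unit k \<odot> clifford_unit g))"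
  proof -
    have 2: "v \<odot> v = (\<Sum>g\<in>?I. \<Sum>k\<in>?I. (coord x g * coord x k) *\<^sub>R (clifford_unit k \<odot> clifford_unit g))"
      unfolding v_def clifford.sum_left clifford.sum_right clifford.scaleR_left clifford.scaleR_right scaleR_right.sum scaleR_scaleR ..
    have 1: "v \<odot> v = (\<Sum>g\<in>?I. \<Sum>k\<in>?I. (coord x g * coord x k) *\<^sub>R (clifford_unit g \<odot> clifford_unit k))"
    proof -
      have "v \<odot> v = (\<Sum>k\<in>?I. \<Sum>g\<in>?I. (coord x g * coord x k) *\<^sub>R (clifford_unit k \<odot> clifford_unit g))"
        unfolding 2 by (rule sum.swap)
      also have "\<dots> = (\<Sum>g\<in>?I. \<Sum>k\<in>?I. (coord x g * coord x k) *\<^sub>R (clifford_unit g \<odot> clifford_unit k))"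
        by (intro sum.cong refl arg_cong2[where f=scaleR]) (rule mult.commute)
      finally show ?thesis .
    qed
    show ?thesis
      unfolding scaleR_right_distrib sum.distrib by (rule arg_cong2[where f="(+)", OF 1 2])
  qed
  also have "\<dots> = (\<Sum>g\<in>?I. \<Sum>k\<in>?I. if g = k then (- 2 * (coord x g)\<^sup>2) *\<^sub>R ?one else 0)"
    by (intro sum.cong refl) (auto simp: clifford_unit_relations power2_eq_square)
  also have "\<dots> = (\<Sum>g\<in>?I. (- 2 * (coord x g)\<^sup>2) *\<^sub>R ?one)"
    by (intro sum.cong refl) simp
  also have "\<dots> = (- 2 * (\<Sum>g\<in>?I. (coord x g)\<^sup>2)) *\<^sub>R ?one"
    by (simp only: scaleR_left.sum[symmetric] sum_distrib_left)
  finally have two: "v \<odot> v + v \<odot> v = (- 2 * (\<Sum>g\<in>?I. (coord x g)\<^sup>2)) *\<^sub>R ?one" .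
  have "v \<odot> v = (1 / 2) *\<^sub>R (v \<odot> v + v \<odot> v)" by (simp flip: scaleR_2)
  then have vv: "v \<odot> v = - (\<Sum>g\<in>?I. (coord x g)\<^sup>2) *\<^sub>R ?one" unfolding two by simp
  have "(norm x)\<^sup>2 = (\<Sum>g\<in>UNIV. (coord x g)\<^sup>2)"
    by (simp add: norm_prod_def norm_vec_def L2_set_def sum_UNIV_sum_type coord_def sum_nonneg)
  also have "\<dots> = x0\<^sup>2 + (\<Sum>g\<in>?I. (coord x g)\<^sup>2)"
    unfolding x0_def by (subst sum.remove[of _ ?g0]) simp_all
  finally have nx: "(norm x)\<^sup>2 = x0\<^sup>2 + (\<Sum>g\<in>?I. (coord x g)\<^sup>2)" .
  have "paravector (conjugate x) \<odot> paravector x = x0\<^sup>2 *\<^sub>R ?one - v \<odot> v"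
    unfolding px pc
    by (simp only: clifford.diff_left clifford.add_right clifford.scaleR_left clifford.scaleR_right
        clifford_one_left clifford_one_right) (simp add: power2_eq_square scaleR_right_distrib scaleR_right_diff_distrib)
  also have "\<dots> = (norm x)\<^sup>2 *\<^sub>R ?one"
    unfolding vv nx by (simp add: scaleR_left_distrib)
  finally show ?thesis .
qed

section \<open>Slices, imaginary units and stem functions\<close>

lemma linear_slice_embed: "linear (slice_embed \<eta>)"
  by (rule linearI) (simp_all add: slice_embed_def algebra_simps)

lemma linear_conjugate: "linear (conjugate :: ('a::{finite,linorder}, 'b::{finite,linorder}) point \<Rightarrow> _)"
  by (rule linearI) (auto simp: conjugate_def vec_eq_iff)

lemma norm_slice_embed: "\<eta> \<in> sphere 0 1 \<Longrightarrow> norm (slice_embed \<eta> z) = norm z"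
  by (cases z) (simp add: slice_embed_def norm_prod_def)

text \<open>\<open>\<eta>\<close> has no real part, so its conjugate is its negative and the norm
  identity gives the square.\<close>

lemma imag_unit_square:
  fixes \<eta> :: "real^'b::{finite,linorder}"
  assumes "\<eta> \<in> sphere 0 1"
  shows "(imag \<eta> :: ('a::{finite,linorder}, 'b::{finite,linorder}) clifford) \<odot> imag \<eta> = - clifford_one"
proof -
  define p :: "('a, 'b) point" where "p = (0, \<eta>)"
  have i: "paravector p = (imag \<eta> :: ('a, 'b) clifford)" by (simp add: imag_def p_def)
  have c: "conjugate p = - p" by (simp add: p_def conjugate_def vec_eq_iff)
  have "paravector (- p) = - (imag \<eta> :: ('a, 'b) clifford)"
    unfolding i[symmetric] by (rule linear_neg[OF linear_paravector])
  then have "- ((imag \<eta> :: ('a, 'b) clifford) \<odot> imag \<eta>) = (norm p)\<^sup>2 *\<^sub>R clifford_one"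
    using conjugate_mult_paravector[of p] unfolding c i by (simp add: clifford.minus_left)
  also have "\<dots> = clifford_one" using assms by (simp add: p_def norm_prod_def)
  finally show ?thesis by (metis minus_equation_iff)
qed

lemma imag_minus: "imag (- w) = - imag w"
  using linear_neg[OF linear_paravector, of "(0, w)"] by (simp add: imag_def)

text \<open>From Gamma(1/2)^2 = pi and Gamma(N/2 + 1) = N/2 Gamma(N/2). It matches the constant of
  \<open>cauchy_E\<close> with the one that normalises the bump.\<close>

lemma sphere_surface_area:
  assumes "N > 0"
  shows "2 * Gamma (1/2) ^ N / Gamma (real N / 2) = real N * unit_ball_vol (real N)"
proof -
  have G: "Gamma (real N / 2 + 1) = real N / 2 * Gamma (real N / 2)"
    by (rule Gamma_plus1) (use assms in \<open>auto elim!: nonpos_Ints_cases\<close>)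
  have "Gamma (1/2 :: real) ^ N = pi powr (real N / 2)"
    by (simp add: Gamma_one_half_real powr_half_sqrt[symmetric] powr_realpow[symmetric] powr_powr)
  moreover have "Gamma (real N / 2) > 0" using assms by (intro Gamma_real_pos) simp
  moreover have "unit_ball_vol (real N) = pi powr (real N / 2) / (real N / 2 * Gamma (real N / 2))"
    unfolding unit_ball_vol_def G ..
  ultimately show ?thesis using assms by simp
qed

lemma sum_Basis_slice:
  fixes f :: "'a::finite slice_point \<Rightarrow> 'c::real_vector"
  shows "(\<Sum>k\<in>Basis. f k) = (\<Sum>i\<in>UNIV. f (axis i 1, 0)) + f (0, 1)"
proof -
  have "Basis = range (\<lambda>i::'a. axis i (1::real))" by (auto simp: Basis_vec_def)
  then have "(\<Sum>k\<in>Basis. f (k, 0)) = (\<Sum>k\<in>range (\<lambda>i::'a. axis i (1::real)). f (k, 0))" by (rule arg_cong)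
  also have "\<dots> = (\<Sum>i\<in>UNIV. f (axis i 1, 0))"
    by (subst sum.reindex) (auto simp: inj_on_def axis_eq_axis)
  finally have "(\<Sum>k\<in>Basis. f (k, 0)) = (\<Sum>i\<in>UNIV. f (axis i 1, 0))" .
  moreover have "(\<Sum>k\<in>Basis. f k) = (\<Sum>k\<in>Basis. f (k, 0)) + (\<Sum>t\<in>Basis. f (0, t))"
    unfolding Basis_prod_def
    by (subst sum.union_disjoint) (auto simp: sum.reindex inj_on_def)
  ultimately show ?thesis by simp
qed

lemma direction_in_sphere:
  fixes v :: "real^'b::finite"
  shows "direction v \<in> sphere 0 1"
proof -
  have "\<exists>w :: real^'b. w \<in> sphere 0 1" by (rule exI[of _ "axis undefined 1"]) simp
  from someI_ex[OF this] show ?thesis by (auto simp: direction_def)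
qed

lemma norm_scaleR_direction: "norm v *\<^sub>R direction v = v"
  by (simp add: direction_def)

text \<open>\<open>p_completion\<close> uses only nonnegative radii. A point with negative
  \<open>r\<close> is reached as \<open>- r\<close> times the unit vector \<open>- \<eta>\<close>,
  which is why \<open>D\<close> has to be reflection invariant.\<close>

lemma p_completion_slice:
  fixes \<eta> :: "real^'b::finite" and z :: "'a::finite slice_point"
  assumes "reflection_invariant D" "\<eta> \<in> sphere 0 1"
  shows "slice_embed \<eta> z \<in> p_completion D \<longleftrightarrow> z \<in> D"
proof -
  have refl: "(xp, - r) \<in> D" if "(xp, r) \<in> D" for xp r using assms(1) that by (simp add: reflection_invariant_def)
  obtain xp r where z: "z = (xp, r)" by (cases z)
  show ?thesis
  proof
    assume "slice_embed \<eta> z \<in> p_completion D"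
    then obtain \<omega> r' where \<omega>: "\<omega> \<in> sphere 0 1" "r *\<^sub>R \<eta> = r' *\<^sub>R \<omega>" "(xp, r') \<in> D" "r' \<ge> 0"
      unfolding p_completion_def slice_embed_def z fst_conv snd_conv by blast
    have "norm (r *\<^sub>R \<eta>) = norm (r' *\<^sub>R \<omega>)" using \<omega>(2) by simp
    then have "\<bar>r\<bar> = r'" using \<omega>(1,4) assms(2) by simp
    then have "r = r' \<or> r = - r'" by auto
    then show "z \<in> D" using \<omega>(3) refl z by auto
  next
    assume zD: "z \<in> D"
    show "slice_embed \<eta> z \<in> p_completion D"
    proof (cases "r \<ge> 0")
      case True
      then show ?thesis using zD assms(2) unfolding p_completion_def slice_embed_def z by auto
    next
      case False
      have "(xp, r *\<^sub>R \<eta>) = (xp, (- r) *\<^sub>R (- \<eta>))" by simp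
      moreover have "- \<eta> \<in> sphere 0 1" using assms(2) by simp
      moreover have "(xp, - r) \<in> D" using refl zD z by simp
      ultimately show ?thesis using False unfolding p_completion_def slice_embed_def z
        by (intro UN_I[of "- \<eta>"]) (auto intro!: exI[of _ xp] exI[of _ "- r"])
    qed
  qed
qed

text \<open>For negative \<open>r\<close> the direction is \<open>- \<eta>\<close>, and the sign is
  absorbed by the odd second component. At \<open>r = 0\<close> the arbitrary direction is harmless,
  because an odd component vanishes there.\<close>

lemma induced_slice_embed:
  fixes F :: "'a::{finite,linorder} slice_point \<Rightarrow> complex^('a, 'b::{finite,linorder}) blade"
  assumes F: "stem_function D F" and D: "reflection_invariant D" and \<eta>: "\<eta> \<in> sphere 0 1" and z: "z \<in> D"
  shows "induced F (slice_embed \<eta> z) = part1 (F z) + imag \<eta> \<odot> part2 (F z)"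
proof -
  obtain xp r where zr: "z = (xp, r)" by (cases z)
  have st: "part1 (F (xp, - r)) = part1 (F (xp, r))" "part2 (F (xp, - r)) = - part2 (F (xp, r))"
    using F z by (auto simp: stem_function_def zr)
  have n: "norm (r *\<^sub>R \<eta>) = \<bar>r\<bar>" and \<eta>1: "norm \<eta> = 1" using \<eta> by auto
  have ind: "induced F (slice_embed \<eta> z) = part1 (F (xp, \<bar>r\<bar>)) + imag (direction (r *\<^sub>R \<eta>)) \<odot> part2 (F (xp, \<bar>r\<bar>))"
    by (simp only: induced_def slice_embed_def zr fst_conv snd_conv n Let_def)
  consider "r > 0" | "r < 0" | "r = 0" by linarith
  then show ?thesis
  proof cases
    case 1
    then have "direction (r *\<^sub>R \<eta>) = \<eta>" using \<eta>1 by (auto simp: direction_def)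
    then show ?thesis using ind 1 zr by simp
  next
    case 2
    then have "direction (r *\<^sub>R \<eta>) = - \<eta>" using \<eta>1 by (auto simp: direction_def)
    then show ?thesis using ind 2 zr st by (simp add: imag_minus clifford.minus_left clifford.minus_right)
  next
    case 3
    have "part2 (F (xp, 0)) = - part2 (F (xp, 0))" using st(2) 3 by simp
    then have "part2 (F (xp, 0)) = 0" by (simp add: vec_eq_iff)
    then show ?thesis using ind 3 zr by (simp add: clifford.zero_right)
  qed
qed

lemma bounded_linear_part1: "bounded_linear (part1 :: complex^'n \<Rightarrow> real^'n)"
  and bounded_linear_part2: "bounded_linear (part2 :: complex^'n \<Rightarrow> real^'n)"
  by (auto simp: linear_conv_bounded_linear[symmetric] part1_def part2_def vec_eq_iff intro!: linearI)

lemma C1_on_slice_function: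
  fixes F :: "'a::{finite,linorder} slice_point \<Rightarrow> complex^('a, 'b::{finite,linorder}) blade"
  assumes "C1_closure D F"
  shows "C1_on D (\<lambda>z. part1 (F z) + imag \<eta> \<odot> part2 (F z))"
proof -
  from assms obtain H :: "_ \<Rightarrow> complex^('a, 'b) blade"
      and F' :: "'a slice_point \<Rightarrow> 'a slice_point \<Rightarrow>\<^sub>L (complex^('a, 'b) blade)"
    where F': "continuous_on (closure D) F'" "\<forall>z\<in>D. F z = H z \<and> (F has_derivative blinfun_apply (F' z)) (at z)"
    unfolding C1_closure_def by blast
  have F'c: "continuous_on D F'" by (rule continuous_on_subset[OF F'(1) closure_subset])
  show ?thesis
  proof (rule C1_onI)
    fix z assume "z \<in> D"
    then have d: "(F has_derivative blinfun_apply (F' z)) (at z)" using F'(2) by blast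
    show "((\<lambda>z. part1 (F z) + imag \<eta> \<odot> part2 (F z)) has_derivative
      (\<lambda>v. part1 (F' z v) + imag \<eta> \<odot> part2 (F' z v))) (at z)"
      by (intro has_derivative_add bounded_linear.has_derivative[OF bounded_linear_part1 d]
          bounded_linear.has_derivative[OF clifford.bounded_linear_right] bounded_linear.has_derivative[OF bounded_linear_part2 d])
  next
    fix v
    have Fv: "continuous_on D (\<lambda>z. F' z v)" by (intro continuous_intros F'c)
    have "continuous_on D (\<lambda>z. part1 (F' z v))"
      by (rule continuous_on_compose2[OF linear_continuous_on[OF bounded_linear_part1, of UNIV] Fv]) simp
    moreover have "continuous_on D (\<lambda>z. part2 (F' z v))"
      by (rule continuous_on_compose2[OF linear_continuous_on[OF bounded_linear_part2, of UNIV] Fv]) simp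
    ultimately show "continuous_on D (\<lambda>z. part1 (F' z v) + imag \<eta> \<odot> part2 (F' z v))"
      by (intro continuous_on_add clifford.continuous_on continuous_on_const)
  qed
qed

text \<open>The form that \<open>cauchy_pompeiu\<close> works with: the embedding carries the basis
  of the slice to the units \<open>e\<^sub>0\<close>, ..., \<open>e\<^sub>p\<close> and
  \<open>\<eta>\<close>.\<close>

lemma slice_dirac_eq:
  fixes f :: "('a::{finite,linorder}, 'b::{finite,linorder}) point \<Rightarrow> ('a, 'b) clifford"
  assumes "C1_on D (\<lambda>z. f (slice_embed \<eta> z))" "z \<in> D"
  shows "slice_dirac \<eta> f z =
    (\<Sum>k\<in>Basis. paravector (slice_embed \<eta> k) \<odot> frechet_derivative (\<lambda>z. f (slice_embed \<eta> z)) (at z) k)"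
proof -
  let ?h = "\<lambda>z. f (slice_embed \<eta> z)"
  have pd: "partial_deriv ?h v z = frechet_derivative ?h (at z) v" for v
    unfolding partial_deriv_def
    using vector_derivative_at[OF has_vector_derivative_along[OF assms(1), of z 0 v UNIV]] assms(2) by simp
  have L1: "paravector (slice_embed \<eta> (axis i 1, 0)) = (clifford_unit (Inl i) :: ('a, 'b) clifford)" for i
  proof -
    have "paravector (slice_embed \<eta> (axis i 1, 0)) = (\<Sum>j\<in>UNIV. (if j = i then clifford_unit (Inl j) else 0) :: ('a, 'b) clifford)"
      unfolding paravector_def slice_embed_def by (simp add: axis_def if_distrib[of "\<lambda>t. t *\<^sub>R _"] cong: if_cong)
    then show ?thesis by simp
  qed
  have L2: "paravector (slice_embed \<eta> (0, 1)) = imag \<eta>"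
    by (simp add: slice_embed_def imag_def)
  show ?thesis
    unfolding slice_dirac_def Let_def pd sum_Basis_slice L1 L2 ..
qed

lemma set_integral_clifford_mult:
  fixes f :: "'m \<Rightarrow> ('a::{finite,linorder}, 'b::{finite,linorder}) clifford"
  assumes "set_integrable M S f"
  shows "set_integrable M S (\<lambda>z. c \<odot> f z)" "(LINT z:S|M. c \<odot> f z) = c \<odot> (LINT z:S|M. f z)"
proof -
  have i: "integrable M (\<lambda>z. indicator S z *\<^sub>R f z)" using assms by (simp add: set_integrable_def)
  show "set_integrable M S (\<lambda>z. c \<odot> f z)"
    using integrable_bounded_linear[OF clifford.bounded_linear_right i, of c]
    by (simp add: set_integrable_def clifford.scaleR_right)
  show "(LINT z:S|M. c \<odot> f z) = c \<odot> (LINT z:S|M. f z)"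
    using integral_bounded_linear[OF clifford.bounded_linear_right i, of c]
    by (simp add: set_lebesgue_integral_def clifford.scaleR_right)
qed

lemma cauchy_E_slice_embed:
  fixes \<eta> :: "real^'b::{finite,linorder}" and z a :: "'a::{finite,linorder} slice_point"
  assumes \<eta>: "\<eta> \<in> sphere 0 1"
  shows "cauchy_E (slice_embed \<eta> z - slice_embed \<eta> a) =
    (1 / (DIM('a slice_point) * unit_ball_vol (DIM('a slice_point)))) *\<^sub>R
      (1 / norm (z - a) ^ DIM('a slice_point)) *\<^sub>R paravector (conjugate (slice_embed \<eta> (z - a)))"
proof -
  have N: "CARD('a) + 1 = DIM('a slice_point)" by simp
  show ?thesis
    unfolding linear_diff[OF linear_slice_embed, symmetric] cauchy_E_def Let_def N norm_slice_embed[OF \<eta>]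
    by (subst sphere_surface_area) (rule DIM_positive, rule refl)
qed

text \<open>Integrability belongs to the conclusion because the integral of a nonintegrable function
  is 0 by convention. The last hypothesis places in the slice of \<open>U\<close> the poles at which
  the Cauchy-Pompeiu formula is applied.\<close>

theorem theorem4p3:
  fixes D :: "'a::{finite,linorder} slice_point set"
    and F :: "'a slice_point \<Rightarrow> complex^('a, 'b::{finite,linorder}) blade"
    and f :: "('a, 'b) point \<Rightarrow> ('a, 'b) clifford"
    and \<Omega> U :: "('a, 'b) point set"
    and \<eta> :: "real^'b::{finite,linorder}"
    and n :: "'a slice_point \<Rightarrow> 'a slice_point"
    and x :: "('a, 'b) point"
  assumes "open D" and "reflection_invariant D"
    and "stem_function D F" and "C1_closure D F"
    and "\<Omega> = p_completion D"
    and "\<forall>w\<in>\<Omega>. f w = induced F w"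
    and "open U" and "connected U"
    and "\<eta> \<in> sphere 0 1"
    and "slice \<eta> U \<subseteq> slice \<eta> \<Omega>"
    and "open (slice \<eta> U)" and "connected (slice \<eta> U)" and "bounded (slice \<eta> U)"
    and "smooth_boundary (slice \<eta> U)"
    and "frontier (slice \<eta> U) \<subseteq> slice \<eta> \<Omega>"
    and "\<forall>z\<in>frontier (slice \<eta> U). unit_exterior_normal (slice \<eta> U) z (n z)"
    and "x \<in> U"
    and "x \<in> range (slice_embed \<eta>) \<or>
         (fst x, norm (snd x)) \<in> slice \<eta> U \<and> (fst x, - norm (snd x)) \<in> slice \<eta> U"
  shows "let S = frontier (slice \<eta> U);
             A = (\<lambda>z. slice_cauchy_kernel \<eta> (slice_embed \<eta> z) x
                   \<odot> paravector (slice_embed \<eta> (n z)) \<odot> f (slice_embed \<eta> z));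
             B = (\<lambda>z. slice_cauchy_kernel \<eta> (slice_embed \<eta> z) x \<odot> slice_dirac \<eta> f z)
         in set_integrable (surface_measure S) S A \<and>
            set_integrable lborel (slice \<eta> U) B \<and>
            f x = (LINT z:S|surface_measure S. A z) - (LINT z:slice \<eta> U|lborel. B z)"
proof -
  note D = assms(1) and refl = assms(2) and stem = assms(3) and \<eta> = assms(9)
  define G where "G = slice \<eta> U"
  let ?S = "frontier G"
  let ?\<mu> = "surface_measure ?S"
  define h where "h z = f (slice_embed \<eta> z)" for z
  let ?L = "\<lambda>z::'a slice_point. paravector (slice_embed \<eta> z) :: ('a, 'b) clifford"
  let ?Lc = "\<lambda>z::'a slice_point. paravector (conjugate (slice_embed \<eta> z)) :: ('a, 'b) clifford"
  define E where "E a z = cauchy_E (slice_embed \<eta> z - slice_embed \<eta> a)" for z a :: "'a slice_point"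
  have slice\<Omega>: "slice \<eta> \<Omega> = D"
    unfolding slice_def assms(5) using p_completion_slice[OF refl \<eta>] by auto
  have G: "open G" "bounded G" and sm: "smooth_boundary G"
    and n: "\<forall>z\<in>?S. unit_exterior_normal G z (n z)"
    using assms(11,13,14,16) by (simp_all add: G_def)
  have GD: "G \<subseteq> D" and cD: "closure G \<subseteq> D"
    using assms(10,15) unfolding slice\<Omega> G_def closure_Un_frontier by auto
  have \<mu>: "is_surface_measure ?S ?\<mu>" by (rule surface_measure_exists[OF sm G])
  have hD: "h z = part1 (F z) + imag \<eta> \<odot> part2 (F z)" if "z \<in> D" for z
  proof -
    have "slice_embed \<eta> z \<in> \<Omega>" using that slice\<Omega> by (auto simp: slice_def)
    then show ?thesis using assms(6) induced_slice_embed[OF stem refl \<eta> that] by (simp add: h_def)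
  qed
  have C1: "C1_on D h" by (rule C1_on_cong[OF C1_on_slice_function[OF assms(4)] D hD])
  have dirac: "slice_dirac \<eta> f z = (\<Sum>k\<in>Basis. ?L k \<odot> frechet_derivative h (at z) k)" if "z \<in> G" for z
    using slice_dirac_eq[of D f \<eta> z] C1 that GD unfolding h_def[abs_def] by blast
  have L: "bounded_linear ?L" and Lc: "bounded_linear ?Lc"
    unfolding linear_conv_bounded_linear[symmetric]
    using linear_compose[OF linear_slice_embed linear_paravector]
      linear_compose[OF linear_compose[OF linear_slice_embed linear_conjugate] linear_paravector]
    by (simp_all add: comp_def)
  have LcL: "?Lc w \<odot> ?L w = (w \<bullet> w) *\<^sub>R clifford_one" for w
    by (simp only: conjugate_mult_paravector norm_slice_embed[OF \<eta>] power2_norm_eq_inner)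
  have CP: "set_integrable ?\<mu> ?S (\<lambda>z. E a z \<odot> ?L (n z) \<odot> h z)"
    "set_integrable lborel G (\<lambda>z. E a z \<odot> slice_dirac \<eta> f z)"
    "h a = (LINT z:?S|?\<mu>. E a z \<odot> ?L (n z) \<odot> h z) - (LINT z:G|lborel. E a z \<odot> slice_dirac \<eta> f z)" if a: "a \<in> G" for a
  proof -
    note cp = cauchy_pompeiu[OF L Lc LcL \<mu> sm G n D cD C1 a]
    have E_eq: "E a z = (1 / (DIM('a slice_point) * unit_ball_vol (DIM('a slice_point)))) *\<^sub>R
      (1 / norm (z - a) ^ DIM('a slice_point)) *\<^sub>R ?Lc (z - a)" for z
      unfolding E_def by (rule cauchy_E_slice_embed[OF \<eta>])
    show "set_integrable ?\<mu> ?S (\<lambda>z. E a z \<odot> ?L (n z) \<odot> h z)" unfolding E_eq by (rule cp(1))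
    have cp2: "set_integrable lborel G (\<lambda>z. E a z \<odot> (\<Sum>k\<in>Basis. ?L k \<odot> frechet_derivative h (at z) k))"
      unfolding E_eq by (rule cp(2))
    have cp3: "h a = (LINT z:?S|?\<mu>. E a z \<odot> ?L (n z) \<odot> h z) -
      (LINT z:G|lborel. E a z \<odot> (\<Sum>k\<in>Basis. ?L k \<odot> frechet_derivative h (at z) k))"
      unfolding E_eq by (rule cp(3))
    have Gm: "G \<in> sets lborel" using G(1) by simp
    show "set_integrable lborel G (\<lambda>z. E a z \<odot> slice_dirac \<eta> f z)"
      by (rule set_integrable_cong[OF HOL.refl HOL.refl, THEN iffD2, OF _ cp2]) (simp add: dirac)
    have "(LINT z:G|lborel. E a z \<odot> slice_dirac \<eta> f z) =
        (LINT z:G|lborel. E a z \<odot> (\<Sum>k\<in>Basis. ?L k \<odot> frechet_derivative h (at z) k))"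
      by (rule set_lebesgue_integral_cong[OF Gm]) (simp add: dirac)
    then show "h a = (LINT z:?S|?\<mu>. E a z \<odot> ?L (n z) \<odot> h z) - (LINT z:G|lborel. E a z \<odot> slice_dirac \<eta> f z)"
      using cp3 by simp
  qed
  define \<omega> where "\<omega> = direction (snd x)"
  define r where "r = norm (snd x)"
  \<comment> \<open>The coefficients of the two poles. They multiply from the left, so by
    associativity they pass through both integrals.\<close>
  define cp cm :: "('a, 'b) clifford" where "cp = (1/2) *\<^sub>R (clifford_one - imag \<omega> \<odot> imag \<eta>)" and "cm = (1/2) *\<^sub>R (clifford_one + imag \<omega> \<odot> imag \<eta>)"
  define K where "K z = slice_cauchy_kernel \<eta> (slice_embed \<eta> z) x" for z
  have K: "K z = cp \<odot> E (fst x, r) z + cm \<odot> E (fst x, - r) z" for z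
    by (simp add: K_def slice_cauchy_kernel_def Let_def cp_def cm_def \<omega>_def r_def E_def slice_embed_def)
  have \<eta>2: "imag \<eta> \<odot> imag \<eta> = - (clifford_one :: ('a, 'b) clifford)" by (rule imag_unit_square[OF \<eta>])
  have x: "x = (fst x, r *\<^sub>R \<omega>)" by (simp add: r_def \<omega>_def norm_scaleR_direction)
  have "set_integrable ?\<mu> ?S (\<lambda>z. K z \<odot> ?L (n z) \<odot> h z) \<and> set_integrable lborel G (\<lambda>z. K z \<odot> slice_dirac \<eta> f z) \<and>
    f x = (LINT z:?S|?\<mu>. K z \<odot> ?L (n z) \<odot> h z) - (LINT z:G|lborel. K z \<odot> slice_dirac \<eta> f z)"
  proof (cases "x \<in> range (slice_embed \<eta>)")
    case True
    then obtain a where a: "x = slice_embed \<eta> a" by blast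
    have aG: "a \<in> G" using a assms(17) by (simp add: G_def slice_def)
    obtain s where s: "a = (fst x, s)" using a by (cases a) (simp add: slice_embed_def)
    have \<eta>1: "norm \<eta> = 1" using \<eta> by simp
    have sx: "snd x = s *\<^sub>R \<eta>" using arg_cong[OF a, of snd] arg_cong[OF s, of snd] by (simp add: slice_embed_def)
    have rs: "r = \<bar>s\<bar>" by (simp add: r_def sx \<eta>1)
    \<comment> \<open>In the slice \<open>\<omega>\<close> is \<open>\<eta>\<close> or
      \<open>- \<eta>\<close> unless \<open>s = 0\<close>, so one coefficient is the unit and the
      other 0. For \<open>s = 0\<close> the direction is arbitrary, but the poles coincide and the
      coefficients add up to the unit.\<close>
    have KE: "K z = E a z" for z
    proof -
      consider "s > 0" | "s < 0" | "s = 0" by linarith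
      then show ?thesis
      proof cases
        case 1
        then have "\<omega> = \<eta>" using \<eta>1 by (auto simp: \<omega>_def sx direction_def)
        then have "cp = clifford_one" "cm = 0"
          by (simp_all add: cp_def cm_def \<eta>2 flip: scaleR_2)
        then show ?thesis using 1 by (simp add: K s rs clifford_one_left clifford.zero_left)
      next
        case 2
        then have "\<omega> = - \<eta>" using \<eta>1 by (auto simp: \<omega>_def sx direction_def)
        then have "cp = 0" "cm = clifford_one"
          by (simp_all add: cp_def cm_def \<eta>2 imag_minus clifford.minus_left flip: scaleR_2)
        then show ?thesis using 2 by (simp add: K s rs clifford_one_left clifford.zero_left)
      next
        case 3
        have "cp + cm = clifford_one"
          by (simp add: cp_def cm_def flip: scaleR_right_distrib scaleR_2)
        then show ?thesis using 3 by (simp add: K s rs clifford_one_left flip: clifford.add_left)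
      qed
    qed
    have "f x = h a" by (simp add: h_def a)
    then show ?thesis unfolding KE using CP[OF aG] by simp
  next
    case False
    then have pm: "(fst x, r) \<in> G" "(fst x, - r) \<in> G" using assms(18) by (simp_all add: r_def G_def)
    have zp: "(fst x, r) \<in> D" "(fst x, - r) \<in> D" using pm GD by auto
    define P Q where "P = part1 (F (fst x, r))" and "Q = part2 (F (fst x, r))"
    \<comment> \<open>Obtained from the pole \<open>(fst x, r)\<close>, which lies in
      \<open>D\<close>; it gives access to the values of \<open>f\<close> as an induced
      function.\<close>
    have "x \<in> \<Omega>"
      unfolding assms(5) p_completion_def
    proof (rule UN_I)
      show "\<omega> \<in> sphere 0 1" unfolding \<omega>_def by (rule direction_in_sphere)
      have "r \<ge> 0" by (simp add: r_def)
      with x zp(1) show "x \<in> {(xp, r *\<^sub>R \<omega>) | xp r. (xp, r) \<in> D \<and> r \<ge> 0}" by blast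
    qed
    then have fx: "f x = P + imag \<omega> \<odot> Q"
      using assms(6) by (simp add: induced_def Let_def P_def Q_def r_def \<omega>_def)
    have hp: "h (fst x, r) = P + imag \<eta> \<odot> Q" using hD[OF zp(1)] by (simp add: P_def Q_def)
    have "part1 (F (fst x, - r)) = P" "part2 (F (fst x, - r)) = - Q"
      using stem zp(1) by (auto simp: stem_function_def P_def Q_def)
    then have hm: "h (fst x, - r) = P - imag \<eta> \<odot> Q" using hD[OF zp(2)] by (simp add: clifford.minus_right)
    \<comment> \<open>The representation formula: \<open>\<eta>\<close> squares to minus the unit,
      which turns the product of \<open>\<omega> \<eta>\<close> and \<open>\<eta> Q\<close> into
      \<open>- \<omega> Q\<close>; the terms \<open>\<eta> Q\<close> and
      \<open>\<omega> \<eta> P\<close> cancel.\<close>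
    have rep: "f x = cp \<odot> h (fst x, r) + cm \<odot> h (fst x, - r)"
    proof -
      let ?j = "imag \<omega> \<odot> imag \<eta>"
      have j: "?j \<odot> (imag \<eta> \<odot> Q) = - (imag \<omega> \<odot> Q)"
      proof -
        have "?j \<odot> (imag \<eta> \<odot> Q) = imag \<omega> \<odot> ((imag \<eta> \<odot> imag \<eta>) \<odot> Q)" by (simp only: clifford_mult_assoc)
        then show ?thesis by (simp add: \<eta>2 clifford.minus_left clifford.minus_right clifford_one_left)
      qed
      have half: "(1/2) *\<^sub>R ((p + e) - (q + t)) + (1/2) *\<^sub>R ((p - e) + (q - t)) = p - t" for p e q t :: "('a, 'b) clifford"
      proof -
        have "((p + e) - (q + t)) + ((p - e) + (q - t)) = 2 *\<^sub>R (p - t)" by (simp add: scaleR_2)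
        then show ?thesis unfolding scaleR_right_distrib[symmetric] by simp
      qed
      have "cp \<odot> h (fst x, r) + cm \<odot> h (fst x, - r) =
        (1/2) *\<^sub>R ((P + imag \<eta> \<odot> Q) - (?j \<odot> P + ?j \<odot> (imag \<eta> \<odot> Q))) +
        (1/2) *\<^sub>R ((P - imag \<eta> \<odot> Q) + (?j \<odot> P - ?j \<odot> (imag \<eta> \<odot> Q)))"
        unfolding hp hm cp_def cm_def clifford.scaleR_left
        by (simp only: clifford.diff_left clifford.add_left clifford.add_right clifford.diff_right clifford_one_left)
          (simp add: algebra_simps)
      also have "\<dots> = P - ?j \<odot> (imag \<eta> \<odot> Q)"
        by (rule half)
      also have "\<dots> = P + imag \<omega> \<odot> Q" unfolding j by simp
      finally show ?thesis unfolding fx by simp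
    qed
    have KA: "K z \<odot> ?L (n z) \<odot> h z = cp \<odot> (E (fst x, r) z \<odot> ?L (n z) \<odot> h z) + cm \<odot> (E (fst x, - r) z \<odot> ?L (n z) \<odot> h z)" for z
      unfolding K by (simp only: clifford.add_left clifford_mult_assoc)
    have KB: "K z \<odot> slice_dirac \<eta> f z = cp \<odot> (E (fst x, r) z \<odot> slice_dirac \<eta> f z) + cm \<odot> (E (fst x, - r) z \<odot> slice_dirac \<eta> f z)" for z
      unfolding K by (simp only: clifford.add_left clifford_mult_assoc)
    note A1 = set_integral_clifford_mult[OF CP(1)[OF pm(1)], of cp] and A2 = set_integral_clifford_mult[OF CP(1)[OF pm(2)], of cm]
    note B1 = set_integral_clifford_mult[OF CP(2)[OF pm(1)], of cp] and B2 = set_integral_clifford_mult[OF CP(2)[OF pm(2)], of cm]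
    have "set_integrable ?\<mu> ?S (\<lambda>z. K z \<odot> ?L (n z) \<odot> h z)"
      unfolding KA by (rule set_integral_add(1)[OF A1(1) A2(1)])
    moreover have "set_integrable lborel G (\<lambda>z. K z \<odot> slice_dirac \<eta> f z)"
      unfolding KB by (rule set_integral_add(1)[OF B1(1) B2(1)])
    moreover have "f x = (LINT z:?S|?\<mu>. K z \<odot> ?L (n z) \<odot> h z) - (LINT z:G|lborel. K z \<odot> slice_dirac \<eta> f z)"
      unfolding KA KB set_integral_add(2)[OF A1(1) A2(1)] set_integral_add(2)[OF B1(1) B2(1)] A1(2) A2(2) B1(2) B2(2)
      unfolding rep CP(3)[OF pm(1)] CP(3)[OF pm(2)] clifford.diff_right by simp
    ultimately show ?thesis by blast
  qed
  then show ?thesis unfolding Let_def G_def K_def h_def .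
qed

end
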